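(* Let $\kappa$ be a regular uncountable cardinal, $\chi<\kappa$ an infinite regular cardinal such that $\kappa$ is $({<}\chi)$-closed, and $\varsigma<\kappa$ an ordinal. If $\mathrm P^\bullet(\kappa,\kappa,{}_\chi{\sqsubseteq},\kappa,\{E^\kappa_{\ge\chi}\},\kappa)$ holds, then there exists a normal, prolific, $\varsigma$-splitting, $\chi$-complete, uniformly homogeneous streamlined $\kappa$-Souslin tree.
   Context: $\kappa$ is $({<}\chi)$-closed if $\lambda^{<\chi}<\kappa$ for all $\lambda<\kappa$. $E^\kappa_{\ge\chi}:=\{\alpha<\kappa\mid\mathrm{cf}(\alpha)\ge\chi\}$. $H_\kappa$: sets of hereditary cardinality $<\kappa$. A streamlined tree is a set $T\subseteq{}^{<\kappa}H_\kappa$ closed under restrictions, ordered by $\subsetneq$; $T_\alpha:=T\cap{}^\alpha H_\kappa$. It is a streamlined $\kappa$-Souslin tree if $(T,\subsetneq)$ has height $\kappa$, levels of size $<\kappa$, and no branch or antichain of size $\kappa$. $T$ is normal if for $\alpha<\beta$ with $T_\beta\neq\emptyset$ every $s\in T_\alpha$ extends to some element of $T_\beta$; prolific if for all $\alpha<\kappa$, $t\in T_\alpha$, $\{t^\frown\langle i\rangle\mid i<\max\{\omega,\alpha\}\}\subseteq T_{\alpha+1}$; $\varsigma$-splitting if every node has at least $\varsigma$ immediate successors; $\chi$-complete if unions of $\subsetneq$-increasing sequences from $T$ of length $<\chi$ lie in $T$. For $x,y\in{}^{<\kappa}H_\kappa$ with $\mathrm{dom}(x)<\mathrm{dom}(y)$,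 $x*y$ is the function on $\mathrm{dom}(y)$ equal to $x$ on $\mathrm{dom}(x)$ and to $y$ elsewhere. $T$ is uniformly homogeneous if for all $y\in T$ and $x\in T$ with $\mathrm{dom}(x)<\mathrm{dom}(y)$, $x*y\in T$. Notation: $\mathrm{acc}(C):=\{\alpha\in C\mid\sup(C\cap\alpha)=\alpha>0\}$; $C(j)$ is the $j$-th element of $C$; $\mathrm{succ}_n(C):=\{C(j+1)\mid j<n,\ j+1<\mathrm{otp}(C)\}$; $\mathrm{acc}(\kappa)$: nonzero limit ordinals below $\kappa$. $\mathcal F(\kappa)$: functions $C$ whose domain $\partial C$ is a nonempty club subset of $\sup(\partial C)$ not containing its supremum, with values in $H_\kappa$; $\alpha_C:=\sup(\partial C)$. $C\,{}_\chi{\sqsubseteq}\,D$ iff ($C=D\restriction\alpha_C$ or $\mathrm{cf}(\alpha_C)<\chi$). For $B\subseteq\kappa$, $\Omega\subseteq H_\kappa$, $p\in H_{\kappa^+}$, $C\in\mathcal F(\kappa)$: $B(\Omega,p,C)$ is the set of $\beta\in B\cap\partial C$ for which some $\mathcal M\prec H_{\kappa^+}$ has $p\in\mathcal M$, $\mathcal M\cap\kappa=\beta$, $\mathcal M\cap\Omega=C(\beta)$. $\mathrm P^\bullet(\kappa,\mu,\mathcal R,\theta,\mathcal S,\nu)$ asserts the existence of $\langle\mathcal C_\alpha\mid\alpha<\kappa\rangle$ and a partition $\langle B_\iota\mid\iota<\kappa\rangle$ of $\kappa$ such that for every $\alpha\in\mathrm{acc}(\kappa)$: $\mathcal C_\alpha\subseteq\{C\in\mathcal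 F(\kappa)\mid\alpha_C=\alpha\}$, $0<|\mathcal C_\alpha|<\mu$, and for all $C\in\mathcal C_\alpha$, $\bar\alpha\in\mathrm{acc}(\partial C)$ there is $D\in\mathcal C_{\bar\alpha}$ with $D\,\mathcal R\,C$; and for every $\langle(\Omega_i,p_i,\iota_i)\mid i<\theta\rangle$ of elements of $\mathcal P(H_\kappa)\times H_{\kappa^+}\times\kappa$, every $S\in\mathcal S$ and every $n<\omega$, there are stationarily many $\alpha\in S$ with $|\mathcal C_\alpha|<\nu$ such that for all $C\in\mathcal C_\alpha$, $i<\min\{\alpha,\theta\}$: $\sup\{\gamma\in\partial C\mid\mathrm{succ}_n(\partial C\setminus\gamma)\subseteq B_{\iota_i}(\Omega_i,p_i,C)\}=\alpha$. *)

theory Defs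
  imports Main "HOL-Library.Disjoint_Sets"
begin

unbundle cardinal_syntax

section \<open>The set-theoretic universe\<close>

text \<open>
  The type \<open>'a hset\<close> consists of all sets of hereditary cardinality at most \<open>\<mu> = \<aleph>\<^sub>0 + |'a|\<close>,
  i.e. it is \<open>H\<^bsub>\<mu>\<^sup>+\<^esub>\<close>. It is built as the well-founded trees with branching \<open>nat + 'a\<close>
  modulo bisimilarity. Its membership structure \<open>elts\<close> is determined up to isomorphism by
  \<open>elts_inject\<close>, \<open>wf_mem\<close>, \<open>elts_bound\<close> and \<open>elts_surj\<close> below. For every cardinal
  \<open>\<kappa> \<le> \<mu>\<close> it contains \<open>\<kappa>\<close> itself and all of \<open>H\<^bsub>\<kappa>\<^sup>+\<^esub>\<close>. HOL sets of type \<open>'a hset set\<close> serve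
  as arbitrary subcollections (trees, subsets of \<open>H\<^sub>\<kappa>\<close>, elementary submodels, \<open>H\<^bsub>\<kappa>\<^sup>+\<^esub>\<close> itself).
\<close>

datatype 'a pset = Empty | Fam "nat + 'a \<Rightarrow> 'a pset"

primrec pelts :: "'a pset \<Rightarrow> 'a pset set" where
  "pelts Empty = {}"
| "pelts (Fam f) = range f"

primrec peq :: "'a pset \<Rightarrow> 'a pset \<Rightarrow> bool" where
  "peq Empty y \<longleftrightarrow> pelts y = {}"
| "peq (Fam f) y \<longleftrightarrow> (\<forall>i. \<exists>z\<in>pelts y. peq (f i) z) \<and> (\<forall>z\<in>pelts y. \<exists>i. peq (f i) z)"

lemma peq_iff:
  "peq x y \<longleftrightarrow> (\<forall>u\<in>pelts x. \<exists>z\<in>pelts y. peq u z) \<and> (\<forall>z\<in>pelts y. \<exists>u\<in>pelts x. peq u z)"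
  by (cases x) auto

lemma peq_refl: "peq x x"
proof (induction x)
  case (Fam f)
  then show ?case by auto
qed simp

lemma peq_sym: "peq x y \<Longrightarrow> peq y x"
proof (induction x arbitrary: y)
  case Empty
  then show ?case by (simp add: peq_iff[of y])
next
  case (Fam f)
  have "\<exists>u\<in>range f. peq z u" if z: "z \<in> pelts y" for z
  proof -
    obtain i where "peq (f i) z" using Fam.prems z by auto
    then have "peq z (f i)" by (rule Fam.IH[OF rangeI])
    then show ?thesis by blast
  qed
  moreover have "\<exists>z\<in>pelts y. peq z (f i)" for i
  proof -
    obtain z where z: "z \<in> pelts y" "peq (f i) z" using Fam.prems by auto
    have "peq z (f i)" by (rule Fam.IH[OF rangeI z(2)])
    with z show ?thesis by blast
  qed
  ultimately show ?case
    unfolding peq_iff[of y] by (simp only: pelts.simps) blast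
qed

lemma peq_trans: "peq x y \<Longrightarrow> peq y z \<Longrightarrow> peq x z"
proof (induction x arbitrary: y z)
  case Empty
  then show ?case by (simp add: peq_iff[of y])
next
  case (Fam f)
  have yz: "\<forall>v\<in>pelts y. \<exists>w\<in>pelts z. peq v w" "\<forall>w\<in>pelts z. \<exists>v\<in>pelts y. peq v w"
    using Fam.prems(2) unfolding peq_iff[of y] by auto
  have "\<exists>w\<in>pelts z. peq (f i) w" for i
  proof -
    obtain v where v: "v \<in> pelts y" "peq (f i) v" using Fam.prems(1) by auto
    obtain w where w: "w \<in> pelts z" "peq v w" using yz v by blast
    have "peq (f i) w" by (rule Fam.IH[OF rangeI v(2) w(2)])
    with w show ?thesis by blast
  qed
  moreover have "\<exists>i. peq (f i) w" if w: "w \<in> pelts z" for w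
  proof -
    obtain v where v: "v \<in> pelts y" "peq v w" using yz w by blast
    obtain i where i: "peq (f i) v" using Fam.prems(1) v by auto
    have "peq (f i) w" by (rule Fam.IH[OF rangeI i v(2)])
    then show ?thesis by blast
  qed
  ultimately show ?case by simp
qed

quotient_type 'a hset = "'a pset" / peq
  by (intro equivpI reflpI sympI transpI) (blast intro: peq_refl peq_sym peq_trans)+

definition elts :: "'a hset \<Rightarrow> 'a hset set" where
  "elts x = abs_hset ` pelts (rep_hset x)"

lemma abs_hset_eq_iff: "abs_hset x = abs_hset y \<longleftrightarrow> peq x y"
  by (rule hset.abs_eq_iff)

lemma abs_rep_hset: "abs_hset (rep_hset x) = x"
  by (rule Quotient3_abs_rep[OF Quotient3_hset])

lemma image_abs_hset_eq_iff: "abs_hset ` pelts x = abs_hset ` pelts y \<longleftrightarrow> peq x y"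
proof -
  have "abs_hset ` pelts x \<subseteq> abs_hset ` pelts y \<longleftrightarrow> (\<forall>u\<in>pelts x. \<exists>z\<in>pelts y. peq u z)"
    by (simp add: image_subset_iff image_iff abs_hset_eq_iff)
  moreover have "abs_hset ` pelts y \<subseteq> abs_hset ` pelts x \<longleftrightarrow> (\<forall>z\<in>pelts y. \<exists>u\<in>pelts x. peq u z)"
    by (simp add: image_subset_iff image_iff abs_hset_eq_iff[symmetric])
      (metis (no_types))
  ultimately show ?thesis
    unfolding set_eq_subset peq_iff[of x y] by simp
qed

lemma elts_abs: "elts (abs_hset x) = abs_hset ` pelts x"
proof -
  have "peq (rep_hset (abs_hset x)) x"
    using abs_hset_eq_iff abs_rep_hset by blast
  then show ?thesis
    unfolding elts_def by (simp add: image_abs_hset_eq_iff)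
qed

lemma elts_inject: "elts x = elts y \<longleftrightarrow> x = y"
proof -
  have "elts x = elts y \<longleftrightarrow> abs_hset (rep_hset x) = abs_hset (rep_hset y)"
    unfolding elts_def image_abs_hset_eq_iff abs_hset_eq_iff ..
  then show ?thesis by (simp only: abs_rep_hset)
qed

lemma elts_bound: "|elts (x :: 'a hset)| \<le>o |UNIV :: (nat + 'a) set|"
proof (cases "rep_hset x")
  case Empty
  then show ?thesis by (simp add: elts_def card_of_empty)
next
  case (Fam f)
  then have "elts x = (abs_hset \<circ> f) ` UNIV"
    by (auto simp: elts_def)
  then show ?thesis by (metis card_of_image)
qed

lemma elts_surj:
  fixes A :: "'a hset set"
  assumes "|A| \<le>o |UNIV :: (nat + 'a) set|"
  shows "\<exists>x. elts x = A"
proof (cases "A = {}")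
  case True
  then have "elts (abs_hset Empty) = A"
    by (simp add: elts_abs)
  then show ?thesis by blast
next
  case False
  from card_of_ordLeq2[OF this, of "UNIV :: (nat + 'a) set"] assms
  obtain g :: "nat + 'a \<Rightarrow> 'a hset" where g: "range g = A"
    by (elim iffD2[THEN exE]) auto
  have "elts (abs_hset (Fam (rep_hset \<circ> g))) = range g"
    by (simp add: elts_abs abs_rep_hset image_image)
  then have "elts (abs_hset (Fam (rep_hset \<circ> g))) = A"
    by (simp only: g)
  then show ?thesis by blast
qed

definition mem_rel :: "('a hset \<times> 'a hset) set" where
  "mem_rel = {(x, y). x \<in> elts y}"

lemma wf_mem: "wf (mem_rel :: ('a hset \<times> 'a hset) set)"
proof (rule wfUNIVI)
  fix P :: "'a hset \<Rightarrow> bool" and x :: "'a hset"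
  assume step: "\<forall>x. (\<forall>y. (y, x) \<in> mem_rel \<longrightarrow> P y) \<longrightarrow> P x"
  have "P (abs_hset u)" for u
  proof (induction u)
    case Empty
    show ?case using step by (simp add: mem_rel_def elts_abs)
  next
    case (Fam f)
    have "\<forall>y. (y, abs_hset (Fam f)) \<in> mem_rel \<longrightarrow> P y"
      using Fam.IH by (auto simp: mem_rel_def elts_abs)
    then show ?case using step by blast
  qed
  then have "P (abs_hset (rep_hset x))" .
  then show "P x" by (simp only: abs_rep_hset)
qed

text \<open>\<open>mk A\<close> is the element whose members are those of \<open>A\<close>; meaningful for \<open>|A| \<le> \<mu>\<close>.\<close>

definition mk :: "'a hset set \<Rightarrow> 'a hset" where
  "mk A = (THE x. elts x = A)"

lemma elts_mk:
  assumes "|A :: 'a hset set| \<le>o |UNIV :: (nat + 'a) set|"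
  shows "elts (mk A) = A"
proof -
  obtain x where x: "elts x = A" using elts_surj[OF assms] by (rule exE)
  then have "(THE y. elts y = A) = x"
    by (intro the_equality) (simp_all add: elts_inject[symmetric])
  with x show ?thesis by (simp only: mk_def)
qed

section \<open>Ordinals and cardinals\<close>

definition Ord :: "'a hset \<Rightarrow> bool" where
  "Ord \<alpha> \<longleftrightarrow> (\<forall>x\<in>elts \<alpha>. elts x \<subseteq> elts \<alpha>) \<and> (\<forall>x\<in>elts \<alpha>. \<forall>y\<in>elts x. elts y \<subseteq> elts x)"

text \<open>For ordinals, \<open>\<alpha> < \<beta>\<close> is \<open>\<alpha> \<in> elts \<beta>\<close> and \<open>\<alpha> \<le> \<beta>\<close> is \<open>elts \<alpha> \<subseteq> elts \<beta>\<close>.\<close>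

definition zero :: "'a hset" where "zero = mk {}"

definition succ :: "'a hset \<Rightarrow> 'a hset" where "succ x = mk (insert x (elts x))"

primrec ord_of_nat :: "nat \<Rightarrow> 'a hset" where
  "ord_of_nat 0 = zero"
| "ord_of_nat (Suc n) = succ (ord_of_nat n)"

definition omega :: "'a hset" where "omega = mk (range ord_of_nat)"

definition omax :: "'a hset \<Rightarrow> 'a hset \<Rightarrow> 'a hset" where
  "omax \<alpha> \<beta> = (if elts \<alpha> \<subseteq> elts \<beta> then \<beta> else \<alpha>)"

definition omin :: "'a hset \<Rightarrow> 'a hset \<Rightarrow> 'a hset" where
  "omin \<alpha> \<beta> = (if elts \<alpha> \<subseteq> elts \<beta> then \<alpha> else \<beta>)"

definition osup :: "'a hset set \<Rightarrow> 'a hset" where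
  "osup A = mk (\<Union>x\<in>A. elts x)"

definition otp :: "'a hset set \<Rightarrow> 'a hset" where
  "otp A = (THE \<alpha>. Ord \<alpha> \<and>
     (\<exists>f. bij_betw f (elts \<alpha>) A \<and> (\<forall>\<xi>\<in>elts \<alpha>. \<forall>\<eta>\<in>elts \<alpha>. \<xi> \<in> elts \<eta> \<longleftrightarrow> f \<xi> \<in> elts (f \<eta>))))"

definition Cardinal :: "'a hset \<Rightarrow> bool" where
  "Cardinal \<kappa> \<longleftrightarrow> Ord \<kappa> \<and> (\<forall>\<alpha>\<in>elts \<kappa>. |elts \<alpha>| <o |elts \<kappa>| )"

definition has_cofinal_map :: "'a hset \<Rightarrow> 'a hset \<Rightarrow> bool" where
  "has_cofinal_map \<beta> \<alpha> \<longleftrightarrow>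
     (\<exists>f. f ` elts \<beta> \<subseteq> elts \<alpha> \<and> (\<forall>\<xi>\<in>elts \<alpha>. \<exists>\<eta>\<in>elts \<beta>. elts \<xi> \<subseteq> elts (f \<eta>)))"

definition cf :: "'a hset \<Rightarrow> 'a hset" where
  "cf \<alpha> = (THE \<beta>. Ord \<beta> \<and> has_cofinal_map \<beta> \<alpha> \<and> (\<forall>\<gamma>\<in>elts \<beta>. \<not> has_cofinal_map \<gamma> \<alpha>))"

definition regular_cardinal :: "'a hset \<Rightarrow> bool" where
  "regular_cardinal \<kappa> \<longleftrightarrow> Cardinal \<kappa> \<and> elts omega \<subseteq> elts \<kappa> \<and> cf \<kappa> = \<kappa>"

text \<open>\<open>acc(C)\<close> for a set \<open>C\<close> of ordinals, so that \<open>acc(\<kappa>)\<close> is \<open>acc_pts (elts \<kappa>)\<close>; and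
  \<open>E\<^sup>\<kappa>\<^bsub>\<ge>\<chi>\<^esub>\<close>.\<close>

definition acc_pts :: "'a hset set \<Rightarrow> 'a hset set" where
  "acc_pts C = {\<alpha> \<in> C. osup (C \<inter> elts \<alpha>) = \<alpha> \<and> zero \<in> elts \<alpha>}"

definition cof_ge :: "'a hset \<Rightarrow> 'a hset \<Rightarrow> 'a hset set" where
  "cof_ge \<kappa> \<chi> = {\<alpha> \<in> elts \<kappa>. elts \<chi> \<subseteq> elts (cf \<alpha>)}"

definition club_in :: "'a hset \<Rightarrow> 'a hset set \<Rightarrow> bool" where
  "club_in \<delta> C \<longleftrightarrow> C \<subseteq> elts \<delta> \<and> osup C = \<delta> \<and>
     (\<forall>\<gamma>\<in>elts \<delta>. zero \<in> elts \<gamma> \<and> osup (C \<inter> elts \<gamma>) = \<gamma> \<longrightarrow> \<gamma> \<in> C)"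

definition stationary_in :: "'a hset \<Rightarrow> 'a hset set \<Rightarrow> bool" where
  "stationary_in \<kappa> S \<longleftrightarrow> S \<subseteq> elts \<kappa> \<and> (\<forall>C. club_in \<kappa> C \<longrightarrow> S \<inter> C \<noteq> {})"

text \<open>\<open>C(j)\<close>, the \<open>j\<close>-th element of a set of ordinals \<open>C\<close>, and \<open>succ\<^sub>n(C)\<close> for \<open>n < \<omega>\<close>.\<close>

definition nth_elt :: "'a hset set \<Rightarrow> 'a hset \<Rightarrow> 'a hset" where
  "nth_elt C j = (THE \<gamma>. \<gamma> \<in> C \<and> otp (C \<inter> elts \<gamma>) = j)"

definition succ_n :: "nat \<Rightarrow> 'a hset set \<Rightarrow> 'a hset set" where
  "succ_n n C = {nth_elt C (ord_of_nat (Suc j)) | j. j < n \<and> ord_of_nat (Suc j) \<in> elts (otp C)}"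

section \<open>Functions as sets of Kuratowski pairs\<close>

definition pair :: "'a hset \<Rightarrow> 'a hset \<Rightarrow> 'a hset" where
  "pair x y = mk {mk {x}, mk {x, y}}"

definition is_fun :: "'a hset \<Rightarrow> bool" where
  "is_fun f \<longleftrightarrow> (\<forall>z\<in>elts f. \<exists>x y. z = pair x y) \<and>
     (\<forall>x y y'. pair x y \<in> elts f \<and> pair x y' \<in> elts f \<longrightarrow> y = y')"

definition fdom :: "'a hset \<Rightarrow> 'a hset set" where
  "fdom f = {x. \<exists>y. pair x y \<in> elts f}"

definition fran :: "'a hset \<Rightarrow> 'a hset set" where
  "fran f = {y. \<exists>x. pair x y \<in> elts f}"

definition app :: "'a hset \<Rightarrow> 'a hset \<Rightarrow> 'a hset" where
  "app f x = (THE y. pair x y \<in> elts f)"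

definition restr :: "'a hset \<Rightarrow> 'a hset set \<Rightarrow> 'a hset" where
  "restr f A = mk {z \<in> elts f. \<exists>x\<in>A. \<exists>y. z = pair x y}"

text \<open>\<open>\<^sup>\<alpha>X\<close> and \<open>\<^sup><\<^sup>\<alpha>X\<close>.\<close>

definition seqs :: "'a hset \<Rightarrow> 'a hset set \<Rightarrow> 'a hset set" where
  "seqs \<alpha> X = {f. is_fun f \<and> fdom f = elts \<alpha> \<and> fran f \<subseteq> X}"

definition seqs_below :: "'a hset \<Rightarrow> 'a hset set \<Rightarrow> 'a hset set" where
  "seqs_below \<alpha> X = (\<Union>\<beta>\<in>elts \<alpha>. seqs \<beta> X)"

text \<open>\<open>\<mu>\<^sup><\<^sup>\<chi>\<close> is taken as the cardinality of the set of all sequences of length below \<open>\<chi>\<close> in \<open>\<mu>\<close>.\<close>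

definition lt_closed :: "'a hset \<Rightarrow> 'a hset \<Rightarrow> bool" where
  "lt_closed \<chi> \<kappa> \<longleftrightarrow> (\<forall>\<mu>\<in>elts \<kappa>. |seqs_below \<chi> (elts \<mu>)| <o |elts \<kappa>| )"

section \<open>Hereditary cardinality and elementary submodels\<close>

definition trcl_set :: "'a hset \<Rightarrow> 'a hset set" where
  "trcl_set x = {y. (y, x) \<in> mem_rel\<^sup>+}"

definition hered_lt :: "'b rel \<Rightarrow> 'a hset set" where
  "hered_lt r = {x. |trcl_set x| <o r}"

abbreviation H :: "'a hset \<Rightarrow> 'a hset set" where
  "H \<kappa> \<equiv> hered_lt |elts \<kappa>|"

abbreviation Hplus :: "'a hset \<Rightarrow> 'a hset set" where
  "Hplus \<kappa> \<equiv> hered_lt (cardSuc |elts \<kappa>| )"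

text \<open>First-order formulas of the language of set theory, with variables named by naturals.\<close>

datatype fm = Mem nat nat | Eq nat nat | Neg fm | Conj fm fm | Exists nat fm

primrec sat :: "'a hset set \<Rightarrow> (nat \<Rightarrow> 'a hset) \<Rightarrow> fm \<Rightarrow> bool" where
  "sat M e (Mem i j) \<longleftrightarrow> e i \<in> elts (e j)"
| "sat M e (Eq i j) \<longleftrightarrow> e i = e j"
| "sat M e (Neg \<phi>) \<longleftrightarrow> \<not> sat M e \<phi>"
| "sat M e (Conj \<phi> \<psi>) \<longleftrightarrow> sat M e \<phi> \<and> sat M e \<psi>"
| "sat M e (Exists i \<phi>) \<longleftrightarrow> (\<exists>x\<in>M. sat M (e(i := x)) \<phi>)"

definition elem_submodel :: "'a hset set \<Rightarrow> 'a hset set \<Rightarrow> bool" (infix \<open>\<prec>\<close> 50) where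
  "M \<prec> N \<longleftrightarrow> M \<noteq> {} \<and> M \<subseteq> N \<and> (\<forall>\<phi> e. range e \<subseteq> M \<longrightarrow> (sat M e \<phi> \<longleftrightarrow> sat N e \<phi>))"

section \<open>The proxy principle\<close>

text \<open>\<open>fdom C\<close> is \<open>\<partial>C\<close>.\<close>

definition alpha_of :: "'a hset \<Rightarrow> 'a hset" where
  "alpha_of C = osup (fdom C)"

definition club_funs :: "'a hset \<Rightarrow> 'a hset set" where
  "club_funs \<kappa> = {C. is_fun C \<and> fdom C \<noteq> {} \<and> fdom C \<subseteq> elts \<kappa> \<and> club_in (alpha_of C) (fdom C) \<and>
     alpha_of C \<notin> fdom C \<and> fran C \<subseteq> H \<kappa>}"

definition sq_chi :: "'a hset \<Rightarrow> 'a hset \<Rightarrow> 'a hset \<Rightarrow> bool" where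
  "sq_chi \<chi> C D \<longleftrightarrow> C = restr D (elts (alpha_of C)) \<or> cf (alpha_of C) \<in> elts \<chi>"

text \<open>\<open>B(\<Omega>,p,C)\<close>; \<open>app C \<beta>\<close> is the value \<open>C(\<beta>)\<close> of the function \<open>C\<close>.\<close>

definition guess_set ::
  "'a hset \<Rightarrow> 'a hset set \<Rightarrow> 'a hset set \<Rightarrow> 'a hset \<Rightarrow> 'a hset \<Rightarrow> 'a hset set" where
  "guess_set \<kappa> B \<Omega> p C = {\<beta> \<in> B \<inter> fdom C.
     \<exists>M. M \<prec> Hplus \<kappa> \<and> p \<in> M \<and> M \<inter> elts \<kappa> = elts \<beta> \<and> M \<inter> \<Omega> = elts (app C \<beta>)}"

text \<open>The cells \<open>B\<^sub>\<iota>\<close> of the partition are not required to be nonempty; if \<open>\<theta> > 0\<close> and \<open>\<S>\<close> is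
  nonempty, this follows from the guessing clause.\<close>

definition P_bullet ::
  "'a hset \<Rightarrow> 'a hset \<Rightarrow> ('a hset \<Rightarrow> 'a hset \<Rightarrow> bool) \<Rightarrow> 'a hset \<Rightarrow> 'a hset set set \<Rightarrow> 'a hset \<Rightarrow> bool"
  where
  "P_bullet \<kappa> \<mu> R \<theta> \<S> \<nu> \<longleftrightarrow>
     (\<exists>(\<C> :: 'a hset \<Rightarrow> 'a hset set) (B :: 'a hset \<Rightarrow> 'a hset set).
        disjoint_family_on B (elts \<kappa>) \<and> (\<Union>\<iota>\<in>elts \<kappa>. B \<iota>) = elts \<kappa> \<and>
        (\<forall>\<alpha>\<in>acc_pts (elts \<kappa>).
           \<C> \<alpha> \<subseteq> {C \<in> club_funs \<kappa>. alpha_of C = \<alpha>} \<and>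
           \<C> \<alpha> \<noteq> {} \<and> |\<C> \<alpha>| <o |elts \<mu>| \<and>
           (\<forall>C\<in>\<C> \<alpha>. \<forall>\<alpha>'\<in>acc_pts (fdom C). \<exists>D\<in>\<C> \<alpha>'. R D C)) \<and>
        (\<forall>(\<Omega> :: 'a hset \<Rightarrow> 'a hset set) (p :: 'a hset \<Rightarrow> 'a hset) (\<iota> :: 'a hset \<Rightarrow> 'a hset).
           (\<forall>i\<in>elts \<theta>. \<Omega> i \<subseteq> H \<kappa> \<and> p i \<in> Hplus \<kappa> \<and> \<iota> i \<in> elts \<kappa>) \<longrightarrow>
           (\<forall>S\<in>\<S>. \<forall>n :: nat.
              stationary_in \<kappa> {\<alpha> \<in> S. |\<C> \<alpha>| <o |elts \<nu>| \<and>
                (\<forall>C\<in>\<C> \<alpha>. \<forall>i\<in>elts (omin \<alpha> \<theta>).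
                   osup {\<gamma> \<in> fdom C.
                     succ_n n (fdom C - elts \<gamma>) \<subseteq> guess_set \<kappa> (B (\<iota> i)) (\<Omega> i) (p i) C} = \<alpha>)})))"

section \<open>Streamlined trees\<close>

text \<open>The tree order \<open>s \<subset> t\<close> on functions is \<open>elts s \<subset> elts t\<close>.\<close>

definition streamlined_tree :: "'a hset \<Rightarrow> 'a hset set \<Rightarrow> bool" where
  "streamlined_tree \<kappa> T \<longleftrightarrow> T \<subseteq> seqs_below \<kappa> (H \<kappa>) \<and>
     (\<forall>t\<in>T. \<forall>\<alpha>\<in>elts \<kappa>. restr t (elts \<alpha>) \<in> T)"

definition level :: "'a hset \<Rightarrow> 'a hset set \<Rightarrow> 'a hset \<Rightarrow> 'a hset set" where
  "level \<kappa> T \<alpha> = T \<inter> seqs \<alpha> (H \<kappa>)"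

text \<open>The height is the least ordinal with empty level. Since \<open>T\<close> is closed under restrictions,
  the \<open>\<alpha>\<close>-th level of the tree order is \<open>T\<^sub>\<alpha>\<close>.\<close>

definition tree_height :: "'a hset \<Rightarrow> 'a hset set \<Rightarrow> 'a hset" where
  "tree_height \<kappa> T = (THE \<alpha>. Ord \<alpha> \<and> level \<kappa> T \<alpha> = {} \<and> (\<forall>\<beta>\<in>elts \<alpha>. level \<kappa> T \<beta> \<noteq> {}))"

definition tree_chain :: "'a hset set \<Rightarrow> 'a hset set \<Rightarrow> bool" where
  "tree_chain T b \<longleftrightarrow> b \<subseteq> T \<and> (\<forall>s\<in>b. \<forall>t\<in>b. s = t \<or> elts s \<subset> elts t \<or> elts t \<subset> elts s)"

definition tree_branch :: "'a hset set \<Rightarrow> 'a hset set \<Rightarrow> bool" where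
  "tree_branch T b \<longleftrightarrow> tree_chain T b \<and> (\<forall>c. tree_chain T c \<and> b \<subseteq> c \<longrightarrow> c = b)"

definition tree_antichain :: "'a hset set \<Rightarrow> 'a hset set \<Rightarrow> bool" where
  "tree_antichain T A \<longleftrightarrow> A \<subseteq> T \<and> (\<forall>s\<in>A. \<forall>t\<in>A. \<not> elts s \<subset> elts t)"

definition souslin_tree :: "'a hset \<Rightarrow> 'a hset set \<Rightarrow> bool" where
  "souslin_tree \<kappa> T \<longleftrightarrow> streamlined_tree \<kappa> T \<and> tree_height \<kappa> T = \<kappa> \<and>
     (\<forall>\<alpha>\<in>elts \<kappa>. |level \<kappa> T \<alpha>| <o |elts \<kappa>| ) \<and>
     \<not> (\<exists>b. tree_branch T b \<and> |b| =o |elts \<kappa>| ) \<and>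
     \<not> (\<exists>A. tree_antichain T A \<and> |A| =o |elts \<kappa>| )"

definition normal_tree :: "'a hset \<Rightarrow> 'a hset set \<Rightarrow> bool" where
  "normal_tree \<kappa> T \<longleftrightarrow> (\<forall>\<beta>\<in>elts \<kappa>. \<forall>\<alpha>\<in>elts \<beta>. level \<kappa> T \<beta> \<noteq> {} \<longrightarrow>
     (\<forall>s\<in>level \<kappa> T \<alpha>. \<exists>t\<in>level \<kappa> T \<beta>. elts s \<subset> elts t))"

text \<open>\<open>append_val \<alpha> t i\<close> is \<open>t\<^sup>\<frown>\<langle>i\<rangle>\<close> for \<open>t\<close> of length \<open>\<alpha>\<close>.\<close>

definition append_val :: "'a hset \<Rightarrow> 'a hset \<Rightarrow> 'a hset \<Rightarrow> 'a hset" where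
  "append_val \<alpha> t i = mk (insert (pair \<alpha> i) (elts t))"

definition prolific_tree :: "'a hset \<Rightarrow> 'a hset set \<Rightarrow> bool" where
  "prolific_tree \<kappa> T \<longleftrightarrow> (\<forall>\<alpha>\<in>elts \<kappa>. \<forall>t\<in>level \<kappa> T \<alpha>.
     {append_val \<alpha> t i | i. i \<in> elts (omax omega \<alpha>)} \<subseteq> level \<kappa> T (succ \<alpha>))"

definition immediate_succs :: "'a hset set \<Rightarrow> 'a hset \<Rightarrow> 'a hset set" where
  "immediate_succs T t =
     {s \<in> T. elts t \<subset> elts s \<and> \<not> (\<exists>r\<in>T. elts t \<subset> elts r \<and> elts r \<subset> elts s)}"

definition splitting_tree :: "'a hset \<Rightarrow> 'a hset set \<Rightarrow> bool" where
  "splitting_tree \<sigma> T \<longleftrightarrow> (\<forall>t\<in>T. |elts \<sigma>| \<le>o |immediate_succs T t| )"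

definition complete_tree :: "'a hset \<Rightarrow> 'a hset set \<Rightarrow> bool" where
  "complete_tree \<chi> T \<longleftrightarrow> (\<forall>\<eta>\<in>elts \<chi>. \<forall>f :: 'a hset \<Rightarrow> 'a hset.
     (\<forall>\<xi>\<in>elts \<eta>. f \<xi> \<in> T) \<and> (\<forall>\<xi>\<in>elts \<eta>. \<forall>\<xi>'\<in>elts \<xi>. elts (f \<xi>') \<subset> elts (f \<xi>)) \<longrightarrow>
     mk (\<Union>\<xi>\<in>elts \<eta>. elts (f \<xi>)) \<in> T)"

definition graft :: "'a hset \<Rightarrow> 'a hset \<Rightarrow> 'a hset" where
  "graft x y = mk (elts x \<union> elts (restr y (fdom y - fdom x)))"

text \<open>For functions on ordinals, \<open>fdom x \<subset> fdom y\<close> says \<open>dom(x) < dom(y)\<close>.\<close>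

definition uniformly_homogeneous :: "'a hset set \<Rightarrow> bool" where
  "uniformly_homogeneous T \<longleftrightarrow> (\<forall>y\<in>T. \<forall>x\<in>T. fdom x \<subset> fdom y \<longrightarrow> graft x y \<in> T)"

end

theory Submission
  imports Defs
begin

text \<open>
  The levels \<open>T\<^sub>\<alpha>\<close> are built by recursion. Successor levels split as widely as required. At a limit
  of cofinality below \<open>\<chi>\<close> all branches are kept; \<open>({<}\<chi>)\<close>-closedness keeps the level small. At any other
  limit, every \<open>C \<in> \<C>\<^sub>\<alpha>\<close> determines one branch \<open>b\<^sup>C\<close> of \<open>T \<restriction> \<alpha>\<close>, and \<open>T\<^sub>\<alpha>\<close> consists of the nodes
  \<open>x * b\<^sup>C\<close> with \<open>x \<in> T \<restriction> \<alpha>\<close>, which makes \<open>T\<close> uniformly homogeneous, hence normal. The branch \<open>b\<^sup>C\<close> is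
  built along \<open>\<partial>C\<close>: in passing from \<open>\<gamma>\<close> to the next point \<open>\<beta> \<in> B\<^sub>\<iota>\<close>, it is continued in such a way that
  \<open>x\<^sub>\<iota> * b\<^sup>C\<close> meets the set of nodes whose indices lie in \<open>C(\<beta>)\<close>, if possible, where \<open>x\<^sub>\<iota>\<close> is the \<open>\<iota>\<close>-th node
  of an enumeration of \<open>T\<close>. Coherence puts \<open>b\<^sup>C \<restriction> \<alpha>'\<close> into \<open>T\<^bsub>\<alpha>'\<^esub>\<close> at the accumulation points \<open>\<alpha>'\<close> of
  \<open>\<partial>C\<close>.

  Given an antichain \<open>A\<close>, the nodes that lie in \<open>A\<close> or are incomparable with all of \<open>A\<close> are predense. Let
  \<open>\<Omega> \<subseteq> \<kappa>\<close> be the set of their indices and let \<open>p\<close> be a club of points closed under the relevant Skolem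
  functions. If \<open>p \<in> \<M> \<prec> H\<^bsub>\<kappa>\<^sup>+\<^esub>\<close> and \<open>\<M> \<inter> \<kappa> = \<beta>\<close>, then \<open>\<beta> \<in> p\<close> and \<open>\<M> \<inter> \<Omega> = \<Omega> \<inter> \<beta>\<close>. So at a level \<open>\<alpha>\<close>
  provided by the guessing clause every search succeeds, every node of \<open>T\<^sub>\<alpha>\<close> extends a node of lower level
  with index in \<open>\<Omega>\<close>, and therefore \<open>A \<subseteq> T \<restriction> \<alpha>\<close>.
\<close>

section \<open>Regular uncountable ordinals in a well-ordered type\<close>

text \<open>The cardinal is represented by the initial segment below \<open>\<kappa>\<close>.
  \<open>bounded\<close> is regularity. \<open>bounded_nat\<close> treats countable sequences
  separately, since an abstract well-order offers no \<omega> to index them; it excludes \<omega>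
  and makes \<open>\<kappa>\<close> a limit.\<close>

locale regular_uncountable =
  fixes \<kappa> :: "'o::wellorder"
  assumes initial: "\<alpha> < \<kappa> \<Longrightarrow> |{..<\<alpha>}| <o |{..<\<kappa>}|"
    and bounded: "\<lbrakk>\<alpha> < \<kappa>; \<And>\<xi>. \<xi> < \<alpha> \<Longrightarrow> f \<xi> < \<kappa>\<rbrakk> \<Longrightarrow> \<exists>\<delta><\<kappa>. \<forall>\<xi><\<alpha>. f \<xi> < (\<delta>::'o)"
    and bounded_nat: "(\<And>n::nat. s n < \<kappa>) \<Longrightarrow> \<exists>\<delta><\<kappa>. \<forall>n. s n < (\<delta>::'o)"
begin

text \<open>The order below \<open>\<kappa>\<close> as a reflexive relation, the form in which facts
  on \<open>regularCard\<close> and on bounds for unions are available.\<close>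

definition less_rel :: "'o rel" where
  "less_rel = {(x, y). x \<le> y \<and> y < \<kappa>}"

lemma Field_less_rel: "Field less_rel = {..<\<kappa>}"
  unfolding less_rel_def Field_def by force

lemma underS_less_rel: "a < \<kappa> \<Longrightarrow> underS less_rel a = {..<a}"
  unfolding less_rel_def underS_def by auto

lemma Well_order_less_rel: "Well_order less_rel"
proof -
  have "wf {(x, y::'o). x < y}" by (rule wf)
  then have "wf (less_rel - Id)"
    by (rule wf_subset) (auto simp: less_rel_def)
  then show ?thesis
    unfolding well_order_on_def linear_order_on_def partial_order_on_def preorder_on_def
      Field_less_rel
    by (auto simp: less_rel_def refl_on_def trans_def antisym_def total_on_def)
qed

text \<open>The cardinal of a set is least among its well-orders, so \<open>|X|\<close> is strictly
  below \<open>less_rel\<close> and therefore isomorphic to a proper initial segment of it.\<close>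

lemma card_less_imp_bij:
  assumes "|X| <o |{..<\<kappa>}|"
  shows "\<exists>\<delta><\<kappa>. \<exists>f. bij_betw f X {..<\<delta>}"
proof -
  have "|{..<\<kappa>}| \<le>o less_rel"
    using card_of_least[of "{..<\<kappa>}" less_rel] Well_order_less_rel by (simp add: Field_less_rel)
  with assms have "|X| <o less_rel" by (rule ordLess_ordLeq_trans)
  then obtain a where a: "a \<in> Field less_rel" "|X| =o Restr less_rel (underS less_rel a)"
    using ordLess_iff_ordIso_Restr[OF Well_order_less_rel card_of_Well_order] by blast
  have "a < \<kappa>" using a(1) by (simp add: Field_less_rel)
  moreover have "Field (Restr less_rel (underS less_rel a)) = {..<a}"
    using \<open>a < \<kappa>\<close> unfolding underS_less_rel[OF \<open>a < \<kappa>\<close>]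
    by (force simp: less_rel_def Field_def)
  then have "|X| =o |{..<a}|"
    using card_of_cong[OF a(2)] by (simp add: Field_card_of)
  ultimately show ?thesis
    using card_of_ordIso[of X "{..<a}"] by blast
qed

text \<open>Otherwise \<open>|{..<\<kappa>}|\<close> would be isomorphic to the segment below some
  \<open>a < \<kappa>\<close>, against \<open>initial\<close>.\<close>

lemma Card_order_less_rel: "Card_order less_rel"
proof (rule ccontr)
  assume "\<not> ?thesis"
  then have "|{..<\<kappa>}| <o less_rel"
    using Card_order_iff_ordLeq_card_of[of less_rel] Well_order_less_rel card_of_Well_order
      not_ordLeq_iff_ordLess by (metis Field_less_rel)
  then obtain a where a: "a \<in> Field less_rel"
      "|{..<\<kappa>}| =o Restr less_rel (underS less_rel a)"
    using ordLess_iff_ordIso_Restr[OF Well_order_less_rel card_of_Well_order] by blast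
  have "a < \<kappa>" using a(1) by (simp add: Field_less_rel)
  have "Field (Restr less_rel (underS less_rel a)) = {..<a}"
    using \<open>a < \<kappa>\<close> unfolding underS_less_rel[OF \<open>a < \<kappa>\<close>]
    by (force simp: less_rel_def Field_def)
  then have "|{..<\<kappa>}| =o |{..<a}|"
    using card_of_cong[OF a(2)] by (simp add: Field_card_of)
  then show False
    using initial[OF \<open>a < \<kappa>\<close>] not_ordLess_ordIso ordIso_symmetric by blast
qed

lemma less_rel_ordIso: "less_rel =o |{..<\<kappa>}|"
  using Card_order_iff_ordIso_card_of[of less_rel] Card_order_less_rel by (simp add: Field_less_rel)

section \<open>Regularity for index sets of size below \<kappa>\<close>

lemma exists_greater: "\<beta> < \<kappa> \<Longrightarrow> \<exists>\<delta><\<kappa>. \<beta> < \<delta>"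
  using bounded_nat[of "\<lambda>_. \<beta>"] by blast

text \<open>\<open>X\<close> is reindexed by an ordinal below \<open>\<kappa>\<close>, after which
  \<open>bounded\<close> applies.\<close>

lemma bounded_card:
  assumes "|X| <o |{..<\<kappa>}|" and "\<And>x. x \<in> X \<Longrightarrow> f x < \<kappa>"
  shows "\<exists>\<delta><\<kappa>. \<forall>x\<in>X. f x < \<delta>"
proof -
  obtain \<delta> e where \<delta>: "\<delta> < \<kappa>" "bij_betw e X {..<\<delta>}"
    using card_less_imp_bij[OF assms(1)] by blast
  define g where "g = the_inv_into X e"
  have g: "g \<xi> \<in> X" if "\<xi> < \<delta>" for \<xi>
    using bij_betw_the_inv_into[OF \<delta>(2)] that unfolding g_def bij_betw_def by blast
  obtain \<epsilon> where \<epsilon>: "\<epsilon> < \<kappa>" "\<forall>\<xi><\<delta>. f (g \<xi>) < \<epsilon>"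
    using bounded[OF \<delta>(1), of "\<lambda>\<xi>. f (g \<xi>)"] g assms(2) by blast
  have "f x < \<epsilon>" if "x \<in> X" for x
  proof -
    have "e x < \<delta>" "g (e x) = x"
      using \<delta>(2) that by (auto simp: g_def bij_betw_def the_inv_into_f_f)
    then show ?thesis using \<epsilon>(2) by metis
  qed
  with \<epsilon>(1) show ?thesis by blast
qed

lemma regularCard_less_rel: "regularCard less_rel"
  unfolding regularCard_def
proof (intro allI impI)
  fix K assume K: "K \<subseteq> Field less_rel \<and> cofinal K less_rel"
  show "|K| =o less_rel"
  proof (rule ccontr)
    assume "\<not> ?thesis"
    moreover have "|K| \<le>o |{..<\<kappa>}|" using K by (simp add: Field_less_rel card_of_mono1)
    ultimately have "|K| <o |{..<\<kappa>}|"
      using less_rel_ordIso ordIso_symmetric ordIso_transitive ordLeq_iff_ordLess_or_ordIso by blast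
    then obtain \<delta> where \<delta>: "\<delta> < \<kappa>" "\<forall>x\<in>K. x < \<delta>"
      using bounded_card[of K "\<lambda>x. x"] K by (auto simp: Field_less_rel)
    then obtain b where "b \<in> K" "(\<delta>, b) \<in> less_rel"
      using K unfolding cofinal_def Field_less_rel by blast
    with \<delta> show False unfolding less_rel_def by force
  qed
qed

lemma infinite_below: "infinite {..<\<kappa>}" if "\<beta> < \<kappa>"
proof
  assume fin: "finite {..<\<kappa>}"
  then have "Max {..<\<kappa>} \<in> {..<\<kappa>}" using that by (intro Max_in) auto
  then obtain \<delta> where "\<delta> < \<kappa>" "Max {..<\<kappa>} < \<delta>" using exists_greater by blast
  with fin show False using Max_ge[of "{..<\<kappa>}" \<delta>] by (simp add: not_le[symmetric])
qed

lemma UNION_less: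
  assumes "|I| <o |{..<\<kappa>}|" and "\<And>i. i \<in> I \<Longrightarrow> |A i| <o |{..<\<kappa>}|"
  shows "|\<Union>i\<in>I. A i| <o |{..<\<kappa>}|"
proof -
  \<comment> \<open>\<open>infinite_below\<close> requires some point below \<open>\<kappa>\<close>;
    the strict inequality for \<open>|I|\<close> provides one.\<close>
  have "{..<\<kappa>} \<noteq> {}"
    using assms(1) not_ordLess_ordLeq[OF assms(1)] card_of_empty[of I] by auto
  then have "\<not> finite (Field less_rel)" using infinite_below by (auto simp: Field_less_rel)
  then have "Cinfinite less_rel"
    using Card_order_less_rel by (simp add: cinfinite_def)
  then have "|\<Union>i\<in>I. A i| <o less_rel"
    by (rule regularCard_UNION_bound[OF _ regularCard_less_rel])
      (use assms in \<open>simp_all add: ordLess_ordIso_trans[OF _ ordIso_symmetric[OF less_rel_ordIso]]\<close>)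
  then show ?thesis by (rule ordLess_ordIso_trans[OF _ less_rel_ordIso])
qed

lemma image2_less:
  assumes "|A| <o |{..<\<kappa>}|" and "|B| <o |{..<\<kappa>}|"
  shows "|{f a b |a b. a \<in> A \<and> b \<in> B}| <o |{..<\<kappa>}|"
proof -
  have "|\<Union>a\<in>A. f a ` B| <o |{..<\<kappa>}|"
    using assms by (intro UNION_less ordLeq_ordLess_trans[OF card_of_image])
  moreover have "(\<Union>a\<in>A. f a ` B) = {f a b |a b. a \<in> A \<and> b \<in> B}" by auto
  ultimately show ?thesis by simp
qed

section \<open>Closed unbounded sets\<close>

definition club :: "'o set \<Rightarrow> bool" where
  "club D \<longleftrightarrow> D \<subseteq> {..<\<kappa>} \<and> (\<forall>\<xi><\<kappa>. \<exists>\<delta>\<in>D. \<xi> < \<delta>) \<and>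
     (\<forall>\<delta><\<kappa>. (\<exists>\<xi>. \<xi> < \<delta>) \<longrightarrow> (\<forall>\<xi><\<delta>. \<exists>\<eta>\<in>D. \<xi> < \<eta> \<and> \<eta> < \<delta>) \<longrightarrow> \<delta> \<in> D)"

text \<open>Unboundedness: a function \<open>F\<close> that bounds witnesses for all \<xi> <
  \<delta> at once is iterated \<omega> times, and the limit is a closure point. It stays below
  \<open>\<kappa>\<close> by \<open>bounded_nat\<close>.\<close>

lemma club_closure_points:
  assumes R: "\<And>\<xi>. \<xi> < \<kappa> \<Longrightarrow> \<exists>\<delta><\<kappa>. R \<xi> \<delta>"
  shows "club {\<delta>. \<delta> < \<kappa> \<and> (\<forall>\<xi><\<delta>. \<exists>\<delta>'<\<delta>. R \<xi> \<delta>')}" (is "club ?D")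
  unfolding club_def
proof (intro conjI allI impI)
  fix \<xi>\<^sub>0 assume \<xi>\<^sub>0: "\<xi>\<^sub>0 < \<kappa>"
  have "\<exists>\<epsilon>. \<delta> < \<kappa> \<longrightarrow> \<epsilon> < \<kappa> \<and> \<delta> < \<epsilon> \<and> (\<forall>\<xi><\<delta>. \<exists>\<delta>'<\<epsilon>. R \<xi> \<delta>')" for \<delta>
  proof (cases "\<delta> < \<kappa>")
    case True
    have "\<exists>G. \<forall>\<xi><\<delta>. G \<xi> < \<kappa> \<and> R \<xi> (G \<xi>)"
      using R True by (intro choice allI) (metis order.strict_trans)
    then obtain G where G: "\<forall>\<xi><\<delta>. G \<xi> < \<kappa> \<and> R \<xi> (G \<xi>)" by blast
    then obtain \<epsilon> where \<epsilon>: "\<epsilon> < \<kappa>" "\<forall>\<xi><\<delta>. G \<xi> < \<epsilon>" using bounded[OF True, of G] by blast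
    obtain \<epsilon>' where \<epsilon>': "\<epsilon>' < \<kappa>" "\<delta> < \<epsilon>'" using exists_greater[OF True] by blast
    have "max \<epsilon> \<epsilon>' < \<kappa> \<and> \<delta> < max \<epsilon> \<epsilon>' \<and> (\<forall>\<xi><\<delta>. \<exists>\<delta>'<max \<epsilon> \<epsilon>'. R \<xi> \<delta>')"
      using \<epsilon> \<epsilon>' G by (auto simp: less_max_iff_disj)
    then show ?thesis by blast
  qed auto
  then obtain F where F: "\<And>\<delta>. \<delta> < \<kappa> \<Longrightarrow> F \<delta> < \<kappa> \<and> \<delta> < F \<delta> \<and> (\<forall>\<xi><\<delta>. \<exists>\<delta>'<F \<delta>. R \<xi> \<delta>')"
    by metis
  define s where "s n = (F ^^ n) \<xi>\<^sub>0" for n :: nat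
  have s: "s n < \<kappa>" for n by (induction n) (auto simp: s_def \<xi>\<^sub>0 F)
  \<comment> \<open>This is the limit of the strictly increasing \<open>s n\<close>. A point below
    it is below some \<open>s (Suc n)\<close>, and \<open>F\<close> puts its witness below
    \<open>s (Suc (Suc n))\<close>.\<close>
  define \<delta> where "\<delta> = (LEAST d. \<forall>n. s n < d)"
  have ex: "\<exists>d<\<kappa>. \<forall>n. s n < d" using bounded_nat[of s] s by blast
  have \<delta>: "\<forall>n. s n < \<delta>" unfolding \<delta>_def by (rule LeastI_ex) (use ex in blast)
  obtain d where "d < \<kappa>" "\<forall>n. s n < d" using ex by blast
  moreover from this have "\<delta> \<le> d" unfolding \<delta>_def by (intro Least_le)
  ultimately have "\<delta> < \<kappa>" by simp
  moreover have "\<exists>\<delta>'<\<delta>. R \<xi> \<delta>'" if "\<xi> < \<delta>" for \<xi>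
  proof -
    have "\<not> (\<forall>n. s n < \<xi>)" using not_less_Least[of \<xi> "\<lambda>d. \<forall>n. s n < d"] that by (simp add: \<delta>_def)
    then obtain n where "\<xi> \<le> s n" by (auto simp: not_less)
    then have "\<xi> < s (Suc n)" using F[OF s[of n]] by (auto simp: s_def)
    then have "\<exists>\<delta>'<s (Suc (Suc n)). R \<xi> \<delta>'" using F[OF s[of "Suc n"]] by (auto simp: s_def)
    with \<delta> show ?thesis using order.strict_trans by blast
  qed
  moreover have "\<xi>\<^sub>0 < \<delta>" using \<delta>[rule_format, of 0] by (simp add: s_def)
  ultimately show "\<exists>\<delta>\<in>?D. \<xi>\<^sub>0 < \<delta>" by blast
next
  fix \<delta> assume "\<delta> < \<kappa>" "\<forall>\<xi><\<delta>. \<exists>\<eta>\<in>?D. \<xi> < \<eta> \<and> \<eta> < \<delta>"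
  then have "\<exists>\<delta>'<\<delta>. R \<xi> \<delta>'" if "\<xi> < \<delta>" for \<xi>
    using that order.strict_trans by blast
  with \<open>\<delta> < \<kappa>\<close> show "\<delta> \<in> ?D" by simp
qed auto

end

section \<open>Gluing compatible maps\<close>

text \<open>The union of a family of partial maps, made single-valued by choice. It is the true
  union only for a compatible family; all uses are for chains.\<close>

definition glue :: "('a \<rightharpoonup> 'b) set \<Rightarrow> ('a \<rightharpoonup> 'b)" where
  "glue M x = (if \<exists>t\<in>M. x \<in> dom t then (SOME t. t \<in> M \<and> x \<in> dom t) x else None)"

lemma dom_glue: "dom (glue M) = (\<Union>t\<in>M. dom t)"
proof -
  have "(SOME t. t \<in> M \<and> x \<in> dom t) x \<noteq> None" if "\<exists>t\<in>M. x \<in> dom t" for x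
    using someI_ex[of "\<lambda>t. t \<in> M \<and> x \<in> dom t"] that by auto
  then show ?thesis unfolding glue_def dom_def by auto
qed

lemma map_le_glue:
  assumes "\<And>s t. \<lbrakk>s \<in> M; t \<in> M\<rbrakk> \<Longrightarrow> s \<subseteq>\<^sub>m t \<or> t \<subseteq>\<^sub>m s" and "t \<in> M"
  shows "t \<subseteq>\<^sub>m glue M"
  unfolding map_le_def
proof
  fix x assume x: "x \<in> dom t"
  define s where "s = (SOME s. s \<in> M \<and> x \<in> dom s)"
  have s: "s \<in> M \<and> x \<in> dom s" unfolding s_def by (rule someI[of _ t]) (use x assms in blast)
  then have "s x = t x" using assms(1)[of s t] assms(2) x by (metis map_le_def)
  then show "t x = glue M x" using x assms(2) by (auto simp: glue_def s_def)
qed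

text \<open>Every value chosen by \<open>glue\<close> comes from a member of \<open>M\<close> and so
  agrees with \<open>u\<close>. The intended case is a chain with largest member
  \<open>u\<close>.\<close>

lemma glue_eqI:
  assumes "\<And>t. t \<in> M \<Longrightarrow> t \<subseteq>\<^sub>m u" and "dom u = (\<Union>t\<in>M. dom t)"
  shows "glue M = u"
proof
  fix x
  show "glue M x = u x"
  proof (cases "x \<in> dom u")
    case True
    then have "\<exists>t. t \<in> M \<and> x \<in> dom t" using assms(2) by blast
    from someI_ex[OF this] have "(SOME t. t \<in> M \<and> x \<in> dom t) x = u x"
      using assms(1) by (auto simp: map_le_def)
    with True assms(2) show ?thesis by (auto simp: glue_def)
  next
    case False
    then show ?thesis using assms(2) by (metis dom_glue domIff)
  qed
qed

section \<open>Restriction and overriding of partial maps\<close>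

lemma map_restrict_eqI:
  assumes "s \<subseteq>\<^sub>m t" and "X \<subseteq> dom s"
  shows "t |` X = s |` X"
proof
  fix x show "(t |` X) x = (s |` X) x"
    using assms subsetD[OF assms(2), of x] by (cases "x \<in> X") (auto simp: map_le_def)
qed

lemma restrict_dom_superset:
  assumes "dom t \<subseteq> X" shows "t |` X = t"
proof
  fix x show "(t |` X) x = t x"
    using assms by (cases "x \<in> X"; cases "t x") (auto simp: dom_def)
qed

lemma map_le_dom_eq:
  assumes "s \<subseteq>\<^sub>m t" "dom s = dom t" shows "s = t"
  using map_restrict_eqI[OF assms(1) order.refl] restrict_dom_superset[of s "dom s"]
    restrict_dom_superset[of t "dom s"] assms(2) by simp

lemma map_add_eq_right:
  assumes "dom s \<subseteq> dom t" shows "s ++ t = t"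
proof
  fix x show "(s ++ t) x = t x"
    using assms by (cases "t x") (auto simp: map_add_def dom_def)
qed

lemma map_add_map_le:
  assumes "s \<subseteq>\<^sub>m t" shows "t ++ s = t"
proof
  fix x show "(t ++ s) x = t x"
    using assms by (cases "s x") (auto simp: map_add_def map_le_def dom_def)
qed

lemma map_add_mono_left:
  assumes "s \<subseteq>\<^sub>m t" shows "s ++ x \<subseteq>\<^sub>m t ++ x"
  unfolding map_le_def
proof
  fix a assume "a \<in> dom (s ++ x)"
  then show "(s ++ x) a = (t ++ x) a"
    using assms by (cases "x a") (auto simp: map_add_def map_le_def dom_def)
qed

text \<open>Together with \<open>restrict_map_add_left\<close> this covers cutting a graft at an
  initial segment: the cut falls inside the domain of \<open>x\<close> or beyond it.\<close>

lemma restrict_map_add_right: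
  assumes "X \<subseteq> dom x" shows "(t ++ x) |` X = x |` X"
proof
  fix a show "((t ++ x) |` X) a = (x |` X) a"
    using assms by (cases "a \<in> X") auto
qed

lemma restrict_map_add_left:
  assumes "dom x \<subseteq> X" shows "(t ++ x) |` X = (t |` X) ++ x"
proof
  fix a show "((t ++ x) |` X) a = ((t |` X) ++ x) a"
    using assms by (cases "x a"; cases "a \<in> X") (auto simp: map_add_def dom_def)
qed

section \<open>The tree\<close>

text \<open>A relation and not a function, because a largest element of an abstract well-order has
  no successor.\<close>

definition is_succ :: "'o::linorder \<Rightarrow> 'o \<Rightarrow> bool" where
  "is_succ \<beta> \<alpha> \<longleftrightarrow> {..<\<alpha>} = {..\<beta>}"

lemma is_succ_iff: "is_succ \<beta> \<alpha> \<Longrightarrow> \<xi> < \<alpha> \<longleftrightarrow> \<xi> \<le> \<beta>"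
  unfolding is_succ_def by blast

lemma is_succ_unique: "is_succ \<beta> \<alpha> \<Longrightarrow> is_succ \<gamma> \<alpha> \<Longrightarrow> \<beta> = \<gamma>"
  unfolding is_succ_def by simp

lemma not_succ_cofinal:
  assumes "\<nexists>\<beta>. is_succ \<beta> \<alpha>" and "\<xi> < (\<alpha>::'o::linorder)"
  shows "\<exists>\<eta><\<alpha>. \<xi> < \<eta>"
proof (rule ccontr)
  assume "\<not> ?thesis"
  then have "x < \<alpha> \<longleftrightarrow> x \<le> \<xi>" for x using assms(2) by (meson leI order.strict_trans1)
  then have "is_succ \<xi> \<alpha>" unfolding is_succ_def by blast
  with assms(1) show False by blast
qed

text \<open>Cofinality below \<chi>. The guard \<open>f \<zeta> < \<alpha>\<close> lets
  \<open>f\<close> take arbitrary values where it contributes nothing.\<close>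

definition small_cof :: "'o::linorder \<Rightarrow> 'o \<Rightarrow> bool" where
  "small_cof \<chi> \<alpha> \<longleftrightarrow> (\<exists>\<eta><\<chi>. \<exists>f. \<forall>\<xi><\<alpha>. \<exists>\<zeta><\<eta>. f \<zeta> < \<alpha> \<and> \<xi> \<le> f \<zeta>)"

text \<open>Says that \<alpha> is a limit point of \<open>E\<close>. With
  \<open>{..<\<alpha>}\<close> for \<open>E\<close> it says that \<alpha> is a nonzero limit
  ordinal.\<close>

definition unbounded_in :: "'o::linorder \<Rightarrow> 'o set \<Rightarrow> bool" where
  "unbounded_in \<alpha> E \<longleftrightarrow> (\<exists>\<xi>. \<xi> < \<alpha>) \<and> (\<forall>\<xi><\<alpha>. \<exists>\<eta>\<in>E. \<xi> < \<eta> \<and> \<eta> < \<alpha>)"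

definition next_in :: "'o::linorder set \<Rightarrow> 'o \<Rightarrow> 'o \<Rightarrow> bool" where
  "next_in E \<gamma> \<beta> \<longleftrightarrow> \<gamma> \<in> E \<and> \<beta> \<in> E \<and> \<gamma> < \<beta> \<and> (\<forall>\<eta>\<in>E. \<eta> < \<beta> \<longrightarrow> \<eta> \<le> \<gamma>)"

lemma unbounded_in_not_succ: "unbounded_in \<alpha> E \<Longrightarrow> \<nexists>\<beta>. is_succ \<beta> \<alpha>"
  unfolding unbounded_in_def using is_succ_iff[of _ \<alpha>] leD by blast

text \<open>Zero has cofinality 0 and a successor has cofinality 1. With two points below \<chi>, a
  constant map on the nonempty segment below \<open>b\<close> witnesses small cofinality of a
  successor.\<close>

lemma not_small_cof_limit:
  assumes "\<not> small_cof \<chi> \<alpha>" and ab: "a < b" "b < \<chi>"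
  shows "\<nexists>\<beta>. is_succ \<beta> \<alpha>" and "unbounded_in \<alpha> {..<\<alpha>}"
proof -
  show *: "\<nexists>\<beta>. is_succ \<beta> \<alpha>"
  proof
    assume "\<exists>\<beta>. is_succ \<beta> \<alpha>"
    then obtain \<beta> where \<beta>: "is_succ \<beta> \<alpha>" by blast
    then have "\<forall>\<xi><\<alpha>. \<exists>\<zeta><b. \<beta> < \<alpha> \<and> \<xi> \<le> \<beta>"
      using ab(1) is_succ_iff[OF \<beta>] order.refl[of \<beta>] by metis
    then have "small_cof \<chi> \<alpha>"
      unfolding small_cof_def using ab(2) by (intro exI[of _ b] conjI exI[of _ "\<lambda>_. \<beta>"])
    with assms(1) show False ..
  qed
  have "\<exists>\<xi>. \<xi> < \<alpha>"
    using assms(1) ab(2) unfolding small_cof_def by blast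
  then show "unbounded_in \<alpha> {..<\<alpha>}"
    unfolding unbounded_in_def using not_succ_cofinal[OF *] by blast
qed

text \<open>The data of a proxy sequence: \<open>Cs \<alpha>\<close> lists the pairs \<open>(\<partial>C, C)\<close>, and \<open>idx \<beta>\<close> is the \<open>\<iota>\<close> with
  \<open>\<beta> \<in> B\<^sub>\<iota>\<close>. A node of level \<open>\<alpha>\<close> will get \<open>w \<alpha>\<close>
  many immediate successors.\<close>

locale proxy = regular_uncountable \<kappa> for \<kappa> :: "'o::wellorder" +
  fixes \<chi> :: 'o and w :: "'o \<Rightarrow> 'o" and Cs :: "'o \<Rightarrow> ('o set \<times> ('o \<Rightarrow> 'o set)) set"
    and idx :: "'o \<Rightarrow> 'o"
  assumes \<chi>_less: "\<chi> < \<kappa>" and two_less_\<chi>: "\<exists>a b. a < b \<and> b < \<chi>"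
    and powers: "\<lbrakk>\<eta> < \<chi>; \<mu> < \<kappa>\<rbrakk> \<Longrightarrow> |Func {..<\<eta>} {..<\<mu>}| <o |{..<\<kappa>}|"
    and w_less: "\<alpha> < \<kappa> \<Longrightarrow> w \<alpha> < \<kappa>"
    and two_less_w: "\<alpha> < \<kappa> \<Longrightarrow> \<exists>a b. a < b \<and> b < w \<alpha>"
    and Cs_nonempty: "\<lbrakk>\<alpha> < \<kappa>; unbounded_in \<alpha> {..<\<alpha>}\<rbrakk> \<Longrightarrow> Cs \<alpha> \<noteq> {}"
    and Cs_card: "\<lbrakk>\<alpha> < \<kappa>; unbounded_in \<alpha> {..<\<alpha>}\<rbrakk> \<Longrightarrow> |Cs \<alpha>| <o |{..<\<kappa>}|"
    and Cs_sub: "\<lbrakk>\<alpha> < \<kappa>; unbounded_in \<alpha> {..<\<alpha>}; (E, g) \<in> Cs \<alpha>\<rbrakk> \<Longrightarrow> E \<subseteq> {..<\<alpha>}"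
    and Cs_unbounded: "\<lbrakk>\<alpha> < \<kappa>; unbounded_in \<alpha> {..<\<alpha>}; (E, g) \<in> Cs \<alpha>\<rbrakk> \<Longrightarrow> unbounded_in \<alpha> E"
    and Cs_closed: "\<lbrakk>\<alpha> < \<kappa>; unbounded_in \<alpha> {..<\<alpha>}; (E, g) \<in> Cs \<alpha>; \<delta> < \<alpha>; unbounded_in \<delta> E\<rbrakk>
      \<Longrightarrow> \<delta> \<in> E"
    and Cs_coherent: "\<lbrakk>\<alpha> < \<kappa>; unbounded_in \<alpha> {..<\<alpha>}; (E, g) \<in> Cs \<alpha>; \<delta> \<in> E; unbounded_in \<delta> E;
      \<not> small_cof \<chi> \<delta>\<rbrakk> \<Longrightarrow> \<exists>g'. (E \<inter> {..<\<delta>}, g') \<in> Cs \<delta> \<and> (\<forall>\<xi>\<in>E \<inter> {..<\<delta>}. g' \<xi> = g \<xi>)"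
    and guess: "\<lbrakk>club D; \<Omega> \<subseteq> {..<\<kappa>}\<rbrakk> \<Longrightarrow> \<exists>\<alpha><\<kappa>. \<not> small_cof \<chi> \<alpha> \<and>
      (\<forall>(E, g)\<in>Cs \<alpha>. \<forall>i<\<alpha>. \<forall>\<xi><\<alpha>. \<exists>\<gamma> \<beta>. next_in E \<gamma> \<beta> \<and> \<xi> < \<gamma> \<and>
        idx \<beta> = i \<and> \<beta> \<in> D \<and> g \<beta> = \<Omega> \<inter> {..<\<beta>})"
begin

text \<open>The two coordinates of an index are the level of a node and its position in the
  enumeration of that level; only surjectivity of the coding matters.\<close>

definition split :: "'o \<Rightarrow> 'o \<times> 'o" where
  "split = (SOME h. h ` {..<\<kappa>} = {..<\<kappa>} \<times> {..<\<kappa>})"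

definition enum :: "('o \<rightharpoonup> 'o) set \<Rightarrow> 'o \<Rightarrow> ('o \<rightharpoonup> 'o)" where
  "enum X = (SOME e. e ` {..<\<kappa>} = X)"

text \<open>Levels are enumerated one at a time, so \<open>node L i\<close> depends on
  \<open>L\<close> only at \<open>fst (split i)\<close>. This allows the recursion to speak of nodes
  while the tree is still being built.\<close>

definition node :: "('o \<Rightarrow> ('o \<rightharpoonup> 'o) set) \<Rightarrow> 'o \<Rightarrow> ('o \<rightharpoonup> 'o)" where
  "node L i = enum (L (fst (split i))) (snd (split i))"

text \<open>\<open>u\<close> is the branch built so far and \<open>g \<beta>\<close> the guessed set
  of indices. The bounds on the first coordinates restrict attention to nodes of levels below
  \<beta>.\<close>

definition seals where
  "seals L g u \<beta> t \<longleftrightarrow> (\<exists>j\<in>g \<beta>. fst (split j) < \<beta> \<and> fst (split (idx \<beta>)) < \<beta> \<and>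
     node L j \<subseteq>\<^sub>m t \<and> u ++ node L (idx \<beta>) \<subseteq>\<^sub>m t)"

text \<open>If the search fails, any node of level \<beta> is taken. \<open>branch\<close> grafts
  the branch so far onto the result, so extension of \<open>u\<close> is not demanded here; a
  sealing node extends only \<open>u\<close> overridden by the node with index
  \<open>idx \<beta>\<close>.\<close>

definition pick where
  "pick L g u \<beta> = (SOME t. t \<in> L \<beta> \<and> ((\<exists>t\<in>L \<beta>. seals L g u \<beta> t) \<longrightarrow> seals L g u \<beta> t))"

text \<open>\<open>y ++ x\<close> is the paper's \<open>x * y\<close>.\<close>

function branch ::
  "('o \<Rightarrow> ('o \<rightharpoonup> 'o) set) \<Rightarrow> 'o set \<Rightarrow> ('o \<Rightarrow> 'o set) \<Rightarrow> 'o \<Rightarrow> ('o \<rightharpoonup> 'o)" where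
  "branch L E g \<beta> = pick L g (glue (branch L E g ` (E \<inter> {..<\<beta>}))) \<beta> ++
     glue (branch L E g ` (E \<inter> {..<\<beta>}))"
  by pat_completeness auto
termination
  by (relation "inv_image {(x, y). x < y} (\<lambda>(L, E, g, \<beta>). \<beta>)") (auto simp: wf)

declare branch.simps [simp del]

text \<open>The ordinal \<open>0\<close> falls under the second clause, which then yields the level containing only the
  empty map.\<close>

definition level_step :: "('o \<Rightarrow> ('o \<rightharpoonup> 'o) set) \<Rightarrow> 'o \<Rightarrow> ('o \<rightharpoonup> 'o) set" where
  "level_step L \<alpha> =
    (if \<exists>\<beta>. is_succ \<beta> \<alpha> then {t(\<beta> \<mapsto> i) |t \<beta> i. is_succ \<beta> \<alpha> \<and> t \<in> L \<beta> \<and> i < w \<beta>}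
     else if small_cof \<chi> \<alpha> then {t. dom t = {..<\<alpha>} \<and> (\<forall>\<xi><\<alpha>. t |` {..<\<xi>} \<in> L \<xi>)}
     else {glue (branch L E g ` E) ++ x |E g x \<xi>. (E, g) \<in> Cs \<alpha> \<and> \<xi> < \<alpha> \<and> x \<in> L \<xi>})"

text \<open>\<open>level_step\<close> hands the whole function \<open>L\<close> to
  \<open>branch\<close>, so the recursion is taken by \<open>wfrec\<close>; that only earlier levels
  matter is shown in \<open>Lev_unfold\<close>.\<close>

definition Lev :: "'o \<Rightarrow> ('o \<rightharpoonup> 'o) set" where
  "Lev = wfrec {(x, y). x < y} level_step"

section \<open>Surjectivity of the enumerations and locality of the recursion\<close>

lemma split_image:
  assumes "\<xi> < \<kappa>" shows "split ` {..<\<kappa>} = {..<\<kappa>} \<times> {..<\<kappa>}"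
proof -
  have "|{..<\<kappa>} \<times> {..<\<kappa>}| =o |{..<\<kappa>}|"
    by (rule card_of_Times_same_infinite[OF infinite_below[OF assms]])
  then obtain h where "bij_betw h {..<\<kappa>} ({..<\<kappa>} \<times> {..<\<kappa>})"
    using card_of_ordIso ordIso_symmetric by blast
  then have "\<exists>h. h ` {..<\<kappa>} = {..<\<kappa>} \<times> {..<\<kappa>}" unfolding bij_betw_def by blast
  from someI_ex[OF this] show ?thesis unfolding split_def .
qed

lemma split_surj:
  assumes "\<xi> < \<kappa>" "\<zeta> < \<kappa>" shows "\<exists>i<\<kappa>. split i = (\<xi>, \<zeta>)"
proof -
  have "(\<xi>, \<zeta>) \<in> split ` {..<\<kappa>}" using assms by (simp add: split_image)
  then show ?thesis by (metis (no_types, lifting) imageE lessThan_iff)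
qed

lemma enum_surj:
  assumes "X \<noteq> {}" "|X| <o |{..<\<kappa>}|" shows "enum X ` {..<\<kappa>} = X"
proof -
  have "\<exists>e. e ` {..<\<kappa>} = X"
    using card_of_ordLeq2[OF assms(1)] ordLess_imp_ordLeq[OF assms(2)] by blast
  from someI_ex[OF this] show ?thesis unfolding enum_def .
qed

lemma node_cong: "L (fst (split i)) = L' (fst (split i)) \<Longrightarrow> node L i = node L' i"
  unfolding node_def by simp

lemma seals_cong:
  assumes "\<And>\<xi>. \<xi> < \<beta> \<Longrightarrow> L \<xi> = L' \<xi>" "g \<beta> = g' \<beta>"
  shows "seals L g u \<beta> t = seals L' g' u \<beta> t"
proof -
  have "node L i = node L' i" if "fst (split i) < \<beta>" for i
    by (rule node_cong) (rule assms(1)[OF that])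
  then show ?thesis unfolding seals_def assms(2) by (intro bex_cong conj_cong refl) simp_all
qed

lemma pick_cong:
  assumes "\<And>\<xi>. \<xi> \<le> \<beta> \<Longrightarrow> L \<xi> = L' \<xi>" "g \<beta> = g' \<beta>"
  shows "pick L g u \<beta> = pick L' g' u \<beta>"
proof -
  have "seals L g u \<beta> = seals L' g' u \<beta>"
    using assms by (intro ext seals_cong) auto
  then show ?thesis unfolding pick_def using assms(1)[of \<beta>] by simp
qed

text \<open>The value at \<beta> depends only on the data up to \<beta>. This serves twice: to
  unfold the recursion for the levels, and to identify the branches of coherent members of
  \<open>Cs\<close>.\<close>

lemma branch_cong:
  assumes "\<beta> \<in> E" "\<And>\<xi>. \<xi> \<le> \<beta> \<Longrightarrow> L \<xi> = L' \<xi>" "E \<inter> {..\<beta>} = E' \<inter> {..\<beta>}"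
    "\<And>\<xi>. \<lbrakk>\<xi> \<in> E; \<xi> \<le> \<beta>\<rbrakk> \<Longrightarrow> g \<xi> = g' \<xi>"
  shows "branch L E g \<beta> = branch L' E' g' \<beta>"
  using assms
proof (induction \<beta> rule: less_induct)
  case (less \<beta>)
  have eq: "E \<inter> {..<\<gamma>} = E' \<inter> {..<\<gamma>}" "E \<inter> {..\<gamma>} = E' \<inter> {..\<gamma>}" if "\<gamma> \<le> \<beta>" for \<gamma>
  proof -
    have "E \<inter> {..<\<gamma>} = E \<inter> {..\<beta>} \<inter> {..<\<gamma>}" "E' \<inter> {..<\<gamma>} = E' \<inter> {..\<beta>} \<inter> {..<\<gamma>}"
      "E \<inter> {..\<gamma>} = E \<inter> {..\<beta>} \<inter> {..\<gamma>}" "E' \<inter> {..\<gamma>} = E' \<inter> {..\<beta>} \<inter> {..\<gamma>}"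
      using that by auto
    then show "E \<inter> {..<\<gamma>} = E' \<inter> {..<\<gamma>}" "E \<inter> {..\<gamma>} = E' \<inter> {..\<gamma>}"
      using less.prems(3) by simp_all
  qed
  have "branch L E g \<gamma> = branch L' E' g' \<gamma>" if "\<gamma> \<in> E \<inter> {..<\<beta>}" for \<gamma>
  proof (rule less.IH)
    show "E \<inter> {..\<gamma>} = E' \<inter> {..\<gamma>}" by (rule eq) (use that in auto)
  qed (use that less.prems(2,4) in auto)
  then have "branch L E g ` (E \<inter> {..<\<beta>}) = branch L' E' g' ` (E' \<inter> {..<\<beta>})"
    using eq(1)[OF order.refl] by (intro image_cong) auto
  moreover have "pick L g u \<beta> = pick L' g' u \<beta>" for u
    using less.prems by (intro pick_cong) auto
  ultimately show ?case
    unfolding branch.simps[of L E g \<beta>] branch.simps[of L' E' g' \<beta>] by simp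
qed


section \<open>The recursion equation, clause by clause\<close>

lemma not_small_limit:
  assumes "\<not> small_cof \<chi> \<alpha>"
  shows "\<nexists>\<beta>. is_succ \<beta> \<alpha>" and "unbounded_in \<alpha> {..<\<alpha>}"
proof -
  obtain a b where ab: "a < b" "b < \<chi>" using two_less_\<chi> by blast
  show "\<nexists>\<beta>. is_succ \<beta> \<alpha>" and "unbounded_in \<alpha> {..<\<alpha>}"
    by (fact not_small_cof_limit[OF assms ab])+
qed

text \<open>\<open>wfrec\<close> gives the equation for \<open>Lev\<close> cut off at \<alpha>. Each
  clause reads only levels below \<alpha>; in the third this holds because \<open>E\<close> is a
  subset of \<alpha>.\<close>

lemma Lev_unfold:
  assumes "\<alpha> < \<kappa>" shows "Lev \<alpha> = level_step Lev \<alpha>"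
proof -
  define L where "L = cut Lev {(x, y). x < y} \<alpha>"
  have L: "L \<xi> = Lev \<xi>" if "\<xi> < \<alpha>" for \<xi> using that by (simp add: L_def cut_def)
  have eq: "Lev \<alpha> = level_step L \<alpha>"
    unfolding L_def Lev_def by (rule wfrec[OF wf])
  consider (succ) "\<exists>\<beta>. is_succ \<beta> \<alpha>" | (small) "\<nexists>\<beta>. is_succ \<beta> \<alpha>" "small_cof \<chi> \<alpha>"
    | (large) "\<nexists>\<beta>. is_succ \<beta> \<alpha>" "\<not> small_cof \<chi> \<alpha>" by blast
  then have "level_step L \<alpha> = level_step Lev \<alpha>"
  proof cases
    case succ
    then have "is_succ \<beta> \<alpha> \<and> t \<in> L \<beta> \<and> i < w \<beta> \<longleftrightarrow> is_succ \<beta> \<alpha> \<and> t \<in> Lev \<beta> \<and> i < w \<beta>" for \<beta> t i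
      using L is_succ_iff by blast
    with succ show ?thesis by (simp add: level_step_def)
  next
    case small
    then show ?thesis using L by (simp add: level_step_def)
  next
    case large
    have "branch L E g ` E = branch Lev E g ` E" if "(E, g) \<in> Cs \<alpha>" for E g
    proof (intro image_cong refl branch_cong)
      fix \<beta> \<xi> assume "\<beta> \<in> E" "\<xi> \<le> \<beta>"
      then show "L \<xi> = Lev \<xi>"
        using Cs_sub[OF assms not_small_limit(2)[OF large(2)] that] by (intro L) auto
    qed
    then have "(\<exists>E g x \<xi>. t = glue (branch L E g ` E) ++ x \<and> (E, g) \<in> Cs \<alpha> \<and> \<xi> < \<alpha> \<and> x \<in> L \<xi>) \<longleftrightarrow>
      (\<exists>E g x \<xi>. t = glue (branch Lev E g ` E) ++ x \<and> (E, g) \<in> Cs \<alpha> \<and> \<xi> < \<alpha> \<and> x \<in> Lev \<xi>)" for t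
      using L by (metis (no_types, lifting))
    with large show ?thesis by (simp add: level_step_def)
  qed
  with eq show ?thesis by simp
qed

lemma Lev_succ:
  assumes "\<alpha> < \<kappa>" "is_succ \<beta> \<alpha>"
  shows "Lev \<alpha> = {t(\<beta> \<mapsto> i) |t i. t \<in> Lev \<beta> \<and> i < w \<beta>}"
proof -
  have "is_succ \<gamma> \<alpha> \<longleftrightarrow> \<gamma> = \<beta>" for \<gamma> using assms(2) is_succ_unique by blast
  then show ?thesis unfolding Lev_unfold[OF assms(1)] level_step_def by auto
qed

lemma Lev_small:
  assumes "\<alpha> < \<kappa>" "\<nexists>\<beta>. is_succ \<beta> \<alpha>" "small_cof \<chi> \<alpha>"
  shows "Lev \<alpha> = {t. dom t = {..<\<alpha>} \<and> (\<forall>\<xi><\<alpha>. t |` {..<\<xi>} \<in> Lev \<xi>)}"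
  unfolding Lev_unfold[OF assms(1)] level_step_def using assms(2,3) by simp

lemma Lev_large:
  assumes "\<alpha> < \<kappa>" "\<not> small_cof \<chi> \<alpha>"
  shows "Lev \<alpha> = {glue (branch Lev E g ` E) ++ x |E g x \<xi>. (E, g) \<in> Cs \<alpha> \<and> \<xi> < \<alpha> \<and> x \<in> Lev \<xi>}"
  unfolding Lev_unfold[OF assms(1)] level_step_def using assms(2) not_small_limit[OF assms(2)] by simp

section \<open>Closure of the levels under restriction and grafting\<close>

definition bottom :: 'o where "bottom = (LEAST x. True)"

lemma bottom_le: "bottom \<le> x" unfolding bottom_def by (rule Least_le) simp

lemma Lev_bottom: assumes "bottom < \<kappa>" shows "Lev bottom = {Map.empty}"
proof -
  have no: "\<not> x < bottom" for x using bottom_le[of x] by (simp add: not_less)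
  have "\<nexists>\<beta>. is_succ \<beta> bottom" using no is_succ_iff by blast
  moreover have "small_cof \<chi> bottom" unfolding small_cof_def using two_less_\<chi> no by blast
  ultimately show ?thesis using no by (auto simp: Lev_small[OF assms])
qed

text \<open>The invariant of the recursion. Closure under grafting must be part of it, since
  \<open>branch\<close> itself grafts at the points that are not limits of \<open>E\<close>.\<close>

definition coherent_level :: "'o \<Rightarrow> bool" where
  "coherent_level \<alpha> \<longleftrightarrow> Lev \<alpha> \<noteq> {} \<and> (\<forall>t\<in>Lev \<alpha>. dom t = {..<\<alpha>} \<and> (\<forall>\<xi>\<le>\<alpha>. t |` {..<\<xi>} \<in> Lev \<xi>) \<and>
     (\<forall>\<xi><\<alpha>. \<forall>x\<in>Lev \<xi>. t ++ x \<in> Lev \<alpha>))"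

lemma coherent_levelD:
  assumes "coherent_level \<alpha>"
  shows "Lev \<alpha> \<noteq> {}" "t \<in> Lev \<alpha> \<Longrightarrow> dom t = {..<\<alpha>}"
    "\<lbrakk>t \<in> Lev \<alpha>; \<xi> \<le> \<alpha>\<rbrakk> \<Longrightarrow> t |` {..<\<xi>} \<in> Lev \<xi>"
    "\<lbrakk>t \<in> Lev \<alpha>; x \<in> Lev \<xi>; \<xi> < \<alpha>\<rbrakk> \<Longrightarrow> t ++ x \<in> Lev \<alpha>"
  using assms unfolding coherent_level_def by simp_all

text \<open>As \<open>F\<close> is cofinal in \<beta>, the union of the chain has domain \<beta>,
  and each proper restriction of it is a restriction of some \<open>f \<gamma>\<close>. Whether the
  union lies in \<open>Lev \<beta>\<close> is left open.\<close>

lemma glue_chain: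
  assumes lev: "\<And>\<gamma>. \<gamma> < \<beta> \<Longrightarrow> coherent_level \<gamma>" and unb: "unbounded_in \<beta> F" "F \<subseteq> {..<\<beta>}"
    and f: "\<And>\<gamma>. \<gamma> \<in> F \<Longrightarrow> f \<gamma> \<in> Lev \<gamma>" "\<And>\<gamma> \<delta>. \<lbrakk>\<gamma> \<in> F; \<delta> \<in> F; \<gamma> < \<delta>\<rbrakk> \<Longrightarrow> f \<gamma> \<subseteq>\<^sub>m f \<delta>"
  shows "dom (glue (f ` F)) = {..<\<beta>}" "\<And>\<gamma>. \<gamma> \<in> F \<Longrightarrow> f \<gamma> \<subseteq>\<^sub>m glue (f ` F)"
    "\<And>\<xi>. \<xi> < \<beta> \<Longrightarrow> glue (f ` F) |` {..<\<xi>} \<in> Lev \<xi>"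
proof -
  have domf: "dom (f \<gamma>) = {..<\<gamma>}" if "\<gamma> \<in> F" for \<gamma>
    using coherent_levelD(2)[OF lev f(1)] that unb(2) by blast
  have "(\<Union>\<gamma>\<in>F. {..<\<gamma>}) = {..<\<beta>}"
    using unb unfolding unbounded_in_def by (auto intro: order.strict_trans)
  then show "dom (glue (f ` F)) = {..<\<beta>}" by (simp add: dom_glue domf)
  show le: "f \<gamma> \<subseteq>\<^sub>m glue (f ` F)" if "\<gamma> \<in> F" for \<gamma>
  proof (rule map_le_glue)
    fix s t assume "s \<in> f ` F" "t \<in> f ` F"
    then obtain \<eta> \<zeta> where "\<eta> \<in> F" "s = f \<eta>" "\<zeta> \<in> F" "t = f \<zeta>" by blast
    then show "s \<subseteq>\<^sub>m t \<or> t \<subseteq>\<^sub>m s"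
      using f(2)[of \<eta> \<zeta>] f(2)[of \<zeta> \<eta>] by (cases rule: linorder_cases[of \<eta> \<zeta>]) auto
  qed (use that in simp)
  show "glue (f ` F) |` {..<\<xi>} \<in> Lev \<xi>" if \<xi>: "\<xi> < \<beta>" for \<xi>
  proof -
    obtain \<gamma> where \<gamma>: "\<gamma> \<in> F" "\<xi> < \<gamma>" using unb(1) \<xi> unfolding unbounded_in_def by blast
    have "glue (f ` F) |` {..<\<xi>} = f \<gamma> |` {..<\<xi>}"
      by (rule map_restrict_eqI[OF le]) (use \<gamma> in \<open>auto simp: domf\<close>)
    then show ?thesis using coherent_levelD(3)[OF lev f(1), of \<gamma> \<xi>] \<gamma> unb(2) by auto
  qed
qed

lemma pick_in_level:
  assumes "Lev \<beta> \<noteq> {}"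
  shows "pick Lev g u \<beta> \<in> Lev \<beta>"
    and "\<exists>t\<in>Lev \<beta>. seals Lev g u \<beta> t \<Longrightarrow> seals Lev g u \<beta> (pick Lev g u \<beta>)"
proof -
  have "\<exists>t. t \<in> Lev \<beta> \<and> ((\<exists>t\<in>Lev \<beta>. seals Lev g u \<beta> t) \<longrightarrow> seals Lev g u \<beta> t)"
    using assms by blast
  from someI_ex[OF this]
  show "pick Lev g u \<beta> \<in> Lev \<beta>"
    and "\<exists>t\<in>Lev \<beta>. seals Lev g u \<beta> t \<Longrightarrow> seals Lev g u \<beta> (pick Lev g u \<beta>)"
    unfolding pick_def by simp_all
qed

text \<open>Induction along \<open>E\<close>. At a limit point of \<open>E\<close> the union of the
  earlier values must itself be a node, by completeness or by coherence. At any other point there is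
  a last earlier value, which is grafted onto the picked node.\<close>

lemma branch_in_level:
  assumes \<alpha>: "\<alpha> < \<kappa>" "unbounded_in \<alpha> {..<\<alpha>}" and C: "(E, g) \<in> Cs \<alpha>"
    and lev: "\<And>\<gamma>. \<gamma> < \<alpha> \<Longrightarrow> coherent_level \<gamma>" and \<beta>: "\<beta> \<in> E"
  shows "branch Lev E g \<beta> \<in> Lev \<beta> \<and> (\<forall>\<gamma>\<in>E. \<gamma> < \<beta> \<longrightarrow> branch Lev E g \<gamma> \<subseteq>\<^sub>m branch Lev E g \<beta>)"
  using \<beta>
proof (induction \<beta> rule: less_induct)
  case (less \<beta>)
  let ?b = "branch Lev E g" and ?F = "E \<inter> {..<\<beta>}"
  define u where "u = glue (?b ` ?F)"
  have sub: "E \<subseteq> {..<\<alpha>}" by (rule Cs_sub[OF \<alpha> C])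
  with less.prems have \<beta>\<alpha>: "\<beta> < \<alpha>" by blast
  have b\<beta>: "?b \<beta> = pick Lev g u \<beta> ++ u" unfolding u_def by (rule branch.simps)
  have t: "pick Lev g u \<beta> \<in> Lev \<beta>" by (rule pick_in_level(1)[OF coherent_levelD(1)[OF lev[OF \<beta>\<alpha>]]])
  have IH: "?b \<gamma> \<in> Lev \<gamma>" "\<And>\<delta>. \<lbrakk>\<delta> \<in> E; \<delta> < \<gamma>\<rbrakk> \<Longrightarrow> ?b \<delta> \<subseteq>\<^sub>m ?b \<gamma>" if "\<gamma> \<in> ?F" for \<gamma>
    using less.IH[of \<gamma>] that by auto
  have le: "?b \<gamma> \<subseteq>\<^sub>m u" if "\<gamma> \<in> ?F" for \<gamma> unfolding u_def
  proof (rule map_le_glue)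
    fix s t assume "s \<in> ?b ` ?F" "t \<in> ?b ` ?F"
    then obtain \<eta> \<zeta> where "\<eta> \<in> ?F" "s = ?b \<eta>" "\<zeta> \<in> ?F" "t = ?b \<zeta>" by blast
    then show "s \<subseteq>\<^sub>m t \<or> t \<subseteq>\<^sub>m s"
      using IH(2)[of \<eta> \<zeta>] IH(2)[of \<zeta> \<eta>] by (cases rule: linorder_cases[of \<eta> \<zeta>]) auto
  qed (use that in simp)
  have "?b \<beta> \<in> Lev \<beta>"
  proof (cases "unbounded_in \<beta> E")
    case True
    then have unb: "unbounded_in \<beta> ?F" unfolding unbounded_in_def by auto
    have coh: "coherent_level \<gamma>" if "\<gamma> < \<beta>" for \<gamma> using lev that \<beta>\<alpha> by auto
    note gl = glue_chain[OF coh unb Int_lower2, of ?b, folded u_def]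
    have dom: "dom u = {..<\<beta>}" and restr: "\<And>\<xi>. \<xi> < \<beta> \<Longrightarrow> u |` {..<\<xi>} \<in> Lev \<xi>"
      using gl(1,3) IH by auto
    have "u \<in> Lev \<beta>"
    proof (cases "small_cof \<chi> \<beta>")
      case small: True
      then show ?thesis
        using Lev_small[OF _ unbounded_in_not_succ[OF True] small] \<beta>\<alpha> \<alpha>(1) dom restr by auto
    next
      case large: False
      have \<beta>\<kappa>: "\<beta> < \<kappa>" using \<beta>\<alpha> \<alpha>(1) by simp
      \<comment> \<open>Coherence makes \<open>E\<close> below \<beta> a member of
        \<open>Cs \<beta>\<close> with the same guesses, so its branch is \<open>u\<close>. Grafting
        the empty map, the node of level \<open>bottom\<close>, shows that \<open>u\<close> itself
        belongs to the level.\<close>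
      obtain g' where g': "(?F, g') \<in> Cs \<beta>" "\<forall>\<xi>\<in>?F. g' \<xi> = g \<xi>"
        using Cs_coherent[OF \<alpha> C less.prems True large] by blast
      have "branch Lev ?F g' ` ?F = ?b ` ?F"
        by (intro image_cong refl branch_cong) (use g'(2) in auto)
      then have "glue (branch Lev ?F g' ` ?F) ++ Map.empty = u" by (simp add: u_def)
      moreover have "bottom < \<beta>" using True bottom_le unfolding unbounded_in_def by (metis order.strict_trans1)
      moreover have "Map.empty \<in> Lev bottom" using Lev_bottom \<open>bottom < \<beta>\<close> \<beta>\<kappa> by auto
      ultimately show ?thesis
        unfolding Lev_large[OF \<beta>\<kappa> large] using g'(1) by blast
    qed
    \<comment> \<open>Here \<open>u\<close> already has full domain, so the picked node is
      overridden completely.\<close>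
    moreover have "?b \<beta> = u"
      unfolding b\<beta> by (rule map_add_eq_right) (use coherent_levelD(2)[OF lev[OF \<beta>\<alpha>] t] dom in simp)
    ultimately show ?thesis by simp
  next
    case False
    show ?thesis
    proof (cases "?F = {}")
      case True
      then have "u = Map.empty" by (simp add: u_def glue_def fun_eq_iff)
      then show ?thesis unfolding b\<beta> using t by simp
    next
      case nonempty: False
      then obtain \<xi> where \<xi>: "\<xi> < \<beta>" "\<forall>\<eta>\<in>E. \<eta> < \<beta> \<longrightarrow> \<eta> \<le> \<xi>"
        using False unfolding unbounded_in_def by (metis IntE equals0I lessThan_iff not_le)
      \<comment> \<open>Closedness of \<open>E\<close>: a supremum of the earlier points that is not
        attained would be a limit point of \<open>E\<close> below \<beta>, hence a point of
        \<open>E\<close>.\<close>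
      have least: "\<exists>\<gamma>\<in>?F. \<forall>\<eta>\<in>?F. \<eta> \<le> \<gamma>"
      proof (rule ccontr)
        assume no: "\<not> ?thesis"
        define \<delta> where "\<delta> = (LEAST d. \<forall>\<eta>\<in>?F. \<eta> \<le> d)"
        have ub: "\<forall>\<eta>\<in>?F. \<eta> \<le> \<delta>" unfolding \<delta>_def by (rule LeastI[of _ \<xi>]) (use \<xi> in auto)
        have "\<delta> \<le> \<xi>" unfolding \<delta>_def by (rule Least_le) (use \<xi> in auto)
        then have "\<delta> < \<beta>" using \<xi>(1) by simp
        then have "\<delta> \<notin> E" using no ub by blast
        then have lt: "\<eta> < \<delta>" if "\<eta> \<in> ?F" for \<eta> using ub that by (auto simp: order.order_iff_strict)
        have "\<exists>\<eta>\<in>?F. \<zeta> < \<eta>" if "\<zeta> < \<delta>" for \<zeta>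
          using not_less_Least[of \<zeta> "\<lambda>d. \<forall>\<eta>\<in>?F. \<eta> \<le> d"] that unfolding \<delta>_def by (auto simp: not_le)
        then have "unbounded_in \<delta> E"
          unfolding unbounded_in_def using lt nonempty by blast
        then have "\<delta> \<in> E" using Cs_closed[OF \<alpha> C] \<open>\<delta> < \<beta>\<close> \<beta>\<alpha> by simp
        with \<open>\<delta> \<notin> E\<close> show False ..
      qed
      then obtain \<gamma> where \<gamma>: "\<gamma> \<in> ?F" "\<forall>\<eta>\<in>?F. \<eta> \<le> \<gamma>" by blast
      have "u = ?b \<gamma>" unfolding u_def
      proof (rule glue_eqI)
        show *: "t \<subseteq>\<^sub>m ?b \<gamma>" if "t \<in> ?b ` ?F" for t
        proof -
          obtain \<eta> where \<eta>: "\<eta> \<in> ?F" "t = ?b \<eta>"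
            using \<open>t \<in> ?b ` ?F\<close> by blast
          then have "\<eta> = \<gamma> \<or> \<eta> < \<gamma>" using \<gamma>(2) by (auto simp: order.order_iff_strict)
          then show ?thesis using \<eta> IH(2)[OF \<gamma>(1)] by auto
        qed
        show "dom (?b \<gamma>) = (\<Union>t\<in>?b ` ?F. dom t)" using *[THEN map_le_implies_dom_le] \<gamma>(1) by blast
      qed
      then show ?thesis
        unfolding b\<beta> using coherent_levelD(4)[OF lev[OF \<beta>\<alpha>] t, of "?b \<gamma>" \<gamma>] IH(1) \<gamma>(1) by simp
    qed
  qed
  moreover have "?b \<gamma> \<subseteq>\<^sub>m ?b \<beta>" if "\<gamma> \<in> E" "\<gamma> < \<beta>" for \<gamma>
    unfolding b\<beta> using le[of \<gamma>] that map_le_map_add map_le_trans by blast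
  ultimately show ?case by blast
qed


lemma branch_glue:
  assumes \<alpha>: "\<alpha> < \<kappa>" "unbounded_in \<alpha> {..<\<alpha>}" and C: "(E, g) \<in> Cs \<alpha>"
    and lev: "\<And>\<gamma>. \<gamma> < \<alpha> \<Longrightarrow> coherent_level \<gamma>"
  shows "dom (glue (branch Lev E g ` E)) = {..<\<alpha>}"
    "\<And>\<gamma>. \<gamma> \<in> E \<Longrightarrow> branch Lev E g \<gamma> \<subseteq>\<^sub>m glue (branch Lev E g ` E)"
    "\<And>\<xi>. \<xi> < \<alpha> \<Longrightarrow> glue (branch Lev E g ` E) |` {..<\<xi>} \<in> Lev \<xi>"
  using glue_chain[OF lev Cs_unbounded[OF \<alpha> C] Cs_sub[OF \<alpha> C], of "branch Lev E g"]
    branch_in_level[OF \<alpha> C lev] by auto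

lemma coherent_level_succ:
  assumes \<alpha>: "\<alpha> < \<kappa>" "is_succ \<beta> \<alpha>" and lev: "\<And>\<gamma>. \<gamma> < \<alpha> \<Longrightarrow> coherent_level \<gamma>"
  shows "coherent_level \<alpha>"
  unfolding coherent_level_def
proof (intro conjI ballI allI impI)
  note L = Lev_succ[OF \<alpha>] and lt = is_succ_iff[OF \<alpha>(2)]
  have "\<beta> < \<alpha>" using lt by simp
  note D = coherent_levelD[OF lev[OF this]]
  have "\<beta> < \<kappa>" using \<open>\<beta> < \<alpha>\<close> \<alpha>(1) by simp
  then obtain i where "i < w \<beta>" using two_less_w by blast
  with D(1) show "Lev \<alpha> \<noteq> {}" unfolding L by blast
  fix s assume s\<alpha>: "s \<in> Lev \<alpha>"
  then obtain t i where s: "s = t(\<beta> \<mapsto> i)" "t \<in> Lev \<beta>" "i < w \<beta>" unfolding L by blast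
  have domt: "dom t = {..<\<beta>}" by (rule D(2)[OF s(2)])
  have "{..<\<alpha>} = insert \<beta> {..<\<beta>}" using lt by (auto simp: order.order_iff_strict)
  then show doms: "dom s = {..<\<alpha>}" by (simp add: s(1) domt)
  show "s |` {..<\<xi>} \<in> Lev \<xi>" if "\<xi> \<le> \<alpha>" for \<xi>
  proof (cases "\<xi> = \<alpha>")
    case True
    then show ?thesis using s\<alpha> doms restrict_dom_superset[of s] by simp
  next
    case False
    then have "\<xi> < \<alpha>" using that by simp
    then have "\<xi> \<le> \<beta>" by (simp only: lt)
    then have "\<beta> \<notin> {..<\<xi>}" by auto
    then have "s |` {..<\<xi>} = t |` {..<\<xi>}" unfolding s(1) by (simp only: restrict_fun_upd if_False)
    then show ?thesis using D(3)[OF s(2) \<open>\<xi> \<le> \<beta>\<close>] by simp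
  qed
  show "s ++ x \<in> Lev \<alpha>" if "\<xi> < \<alpha>" "x \<in> Lev \<xi>" for \<xi> x
  proof -
    have "\<xi> \<le> \<beta>" using that(1) lt by simp
    have "dom x \<subseteq> {..<\<beta>}" using coherent_levelD(2)[OF lev[OF that(1)] that(2)] \<open>\<xi> \<le> \<beta>\<close> by simp
    \<comment> \<open>The length of \<open>x\<close> is at most \<beta>, so the graft leaves the
      last value \<open>i\<close> in place.\<close>
    then have "s ++ x = (t ++ x)(\<beta> \<mapsto> i)" unfolding s(1)
      by (intro map_add_upd_left) auto
    moreover have "t ++ x \<in> Lev \<beta>"
    proof (cases "\<xi> = \<beta>")
      case True
      then show ?thesis using map_add_eq_right[of t x] domt D(2) that(2) by auto
    next
      case False
      then show ?thesis using D(4)[OF s(2) that(2)] \<open>\<xi> \<le> \<beta>\<close> by simp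
    qed
    ultimately show ?thesis unfolding L using s(3) by blast
  qed
qed

lemma coherent_level_small:
  assumes \<alpha>: "\<alpha> < \<kappa>" "\<nexists>\<beta>. is_succ \<beta> \<alpha>" "small_cof \<chi> \<alpha>"
    and lev: "\<And>\<gamma>. \<gamma> < \<alpha> \<Longrightarrow> coherent_level \<gamma>"
  shows "coherent_level \<alpha>"
  unfolding coherent_level_def
proof (intro conjI ballI allI impI)
  note L = Lev_small[OF \<alpha>]
  show "Lev \<alpha> \<noteq> {}"
  proof (cases "\<exists>\<xi>. \<xi> < \<alpha>")
    case True
    then have unb: "unbounded_in \<alpha> {..<\<alpha>}"
      unfolding unbounded_in_def using not_succ_cofinal[OF \<alpha>(2)] by auto
    \<comment> \<open>All branches are kept at such a level, so the branch along any member of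
      \<open>Cs \<alpha>\<close> witnesses nonemptiness.\<close>
    then obtain E g where C: "(E, g) \<in> Cs \<alpha>" using Cs_nonempty[OF \<alpha>(1)] by fast
    then have "glue (branch Lev E g ` E) \<in> Lev \<alpha>"
      unfolding L using branch_glue[OF \<alpha>(1) unb C lev] by simp
    then show ?thesis by blast
  next
    case False
    then have "Map.empty \<in> Lev \<alpha>" unfolding L by auto
    then show ?thesis by blast
  qed
  fix s assume s: "s \<in> Lev \<alpha>"
  then show doms: "dom s = {..<\<alpha>}" unfolding L by simp
  show "s |` {..<\<xi>} \<in> Lev \<xi>" if "\<xi> \<le> \<alpha>" for \<xi>
  proof (cases "\<xi> = \<alpha>")
    case True
    then show ?thesis using s restrict_dom_superset[of s "{..<\<alpha>}"] doms by simp
  next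
    case False
    then show ?thesis using s that unfolding L by (simp add: order.strict_iff_order)
  qed
  show "s ++ x \<in> Lev \<alpha>" if \<xi>: "\<xi> < \<alpha>" "x \<in> Lev \<xi>" for \<xi> x
  proof -
    have domx: "dom x = {..<\<xi>}" by (rule coherent_levelD(2)[OF lev[OF \<xi>(1)] \<xi>(2)])
    have "(s ++ x) |` {..<\<zeta>} \<in> Lev \<zeta>" if \<zeta>: "\<zeta> < \<alpha>" for \<zeta>
    proof (cases "\<zeta> \<le> \<xi>")
      case True
      then show ?thesis
        using coherent_levelD(3)[OF lev[OF \<xi>(1)] \<xi>(2) True] domx by (simp add: restrict_map_add_right)
    next
      case False
      then have "(s ++ x) |` {..<\<zeta>} = (s |` {..<\<zeta>}) ++ x"
        by (intro restrict_map_add_left) (auto simp: domx)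
      moreover have "s |` {..<\<zeta>} \<in> Lev \<zeta>" using s \<zeta> unfolding L by simp
      ultimately show ?thesis
        using coherent_levelD(4)[OF lev[OF \<zeta>] _ \<xi>(2)] False by simp
    qed
    moreover have "dom (s ++ x) = {..<\<alpha>}" using doms domx \<xi>(1) by auto
    ultimately show ?thesis unfolding L by simp
  qed
qed

lemma coherent_level_large:
  assumes \<alpha>: "\<alpha> < \<kappa>" "\<not> small_cof \<chi> \<alpha>"
    and lev: "\<And>\<gamma>. \<gamma> < \<alpha> \<Longrightarrow> coherent_level \<gamma>"
  shows "coherent_level \<alpha>"
  unfolding coherent_level_def
proof (intro conjI ballI allI impI)
  note L = Lev_large[OF \<alpha>] and lim = not_small_limit(2)[OF \<alpha>(2)]
  have "bottom < \<alpha>" using lim bottom_le unfolding unbounded_in_def by (metis order.strict_trans1)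
  moreover have "Lev bottom \<noteq> {}" using Lev_bottom \<open>bottom < \<alpha>\<close> \<alpha>(1) by simp
  moreover have "Cs \<alpha> \<noteq> {}" by (rule Cs_nonempty[OF \<alpha>(1) lim])
  ultimately show "Lev \<alpha> \<noteq> {}" unfolding L by fast
  fix s assume s\<alpha>: "s \<in> Lev \<alpha>"
  then obtain E g x \<xi> where s: "s = glue (branch Lev E g ` E) ++ x" "(E, g) \<in> Cs \<alpha>" "\<xi> < \<alpha>" "x \<in> Lev \<xi>"
    unfolding L by blast
  define b where "b = glue (branch Lev E g ` E)"
  have domb: "dom b = {..<\<alpha>}" and resb: "\<And>\<xi>. \<xi> < \<alpha> \<Longrightarrow> b |` {..<\<xi>} \<in> Lev \<xi>"
    using branch_glue[OF \<alpha>(1) lim s(2) lev] by (simp_all add: b_def)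
  have sb: "s = b ++ x" by (simp add: s(1) b_def)
  have domx: "dom x = {..<\<xi>}" by (rule coherent_levelD(2)[OF lev[OF s(3)] s(4)])
  show doms: "dom s = {..<\<alpha>}" using s(3) by (auto simp: sb domb domx)
  show "s |` {..<\<zeta>} \<in> Lev \<zeta>" if \<zeta>: "\<zeta> \<le> \<alpha>" for \<zeta>
  proof -
    consider "\<zeta> = \<alpha>" | "\<zeta> \<le> \<xi>" | "\<xi> < \<zeta>" "\<zeta> < \<alpha>" 
      using \<zeta> by (meson not_le order.not_eq_order_implies_strict)
    then show ?thesis
    proof cases
      case 1
      then show ?thesis using s\<alpha> doms restrict_dom_superset[of s] by simp
    next
      case 2
      then show ?thesis
        using coherent_levelD(3)[OF lev[OF s(3)] s(4) 2] domx by (simp add: sb restrict_map_add_right)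
    next
      case 3
      then have "s |` {..<\<zeta>} = (b |` {..<\<zeta>}) ++ x"
        unfolding sb by (intro restrict_map_add_left) (auto simp: domx)
      then show ?thesis using coherent_levelD(4)[OF lev[OF 3(2)] resb[OF 3(2)] s(4) 3(1)] by simp
    qed
  qed
  show "s ++ y \<in> Lev \<alpha>" if \<eta>: "\<eta> < \<alpha>" "y \<in> Lev \<eta>" for \<eta> y
  proof -
    have domy: "dom y = {..<\<eta>}" by (rule coherent_levelD(2)[OF lev[OF \<eta>(1)] \<eta>(2)])
    \<comment> \<open>Overriding is associative, so a second graft onto \<open>b ++ x\<close> is a
      single graft of \<open>x ++ y\<close> onto \<open>b\<close>. It remains to see that
      \<open>x ++ y\<close> is a node of level below \<alpha>.\<close>
    have "\<exists>\<zeta><\<alpha>. x ++ y \<in> Lev \<zeta>"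
    proof (cases "\<xi> \<le> \<eta>")
      case True
      then have "x ++ y = y" by (intro map_add_eq_right) (auto simp: domx domy)
      then show ?thesis using \<eta> by auto
    next
      case False
      then show ?thesis using coherent_levelD(4)[OF lev[OF s(3)] s(4) \<eta>(2)] s(3) by auto
    qed
    moreover have "s ++ y = b ++ (x ++ y)" by (simp add: sb)
    ultimately show ?thesis unfolding L b_def using s(2) by blast
  qed
qed

lemma coherent_levels: "\<alpha> < \<kappa> \<Longrightarrow> coherent_level \<alpha>"
proof (induction \<alpha> rule: less_induct)
  case (less \<alpha>)
  have lev: "coherent_level \<gamma>" if "\<gamma> < \<alpha>" for \<gamma> using less that by auto
  consider \<beta> where "is_succ \<beta> \<alpha>" | "\<nexists>\<beta>. is_succ \<beta> \<alpha>" "small_cof \<chi> \<alpha>" | "\<not> small_cof \<chi> \<alpha>" by blast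
  then show ?case
  proof cases
    case 1
    then show ?thesis using coherent_level_succ[OF less.prems 1 lev] by blast
  next
    case 2
    then show ?thesis using coherent_level_small[OF less.prems 2 lev] by blast
  next
    case 3
    then show ?thesis using coherent_level_large[OF less.prems 3 lev] by blast
  qed
qed

section \<open>Extension, values and size of the levels\<close>

lemmas Lev_nonempty = coherent_levelD(1)[OF coherent_levels]
  and Lev_dom = coherent_levelD(2)[OF coherent_levels]
  and Lev_restrict = coherent_levelD(3)[OF coherent_levels]
  and Lev_graft = coherent_levelD(4)[OF coherent_levels]

text \<open>Normality from homogeneity: \<open>x\<close> is grafted onto an arbitrary node of level
  \<alpha>.\<close>

lemma Lev_extend:
  assumes "x \<in> Lev \<xi>" "\<xi> \<le> \<alpha>" "\<alpha> < \<kappa>"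
  shows "\<exists>y\<in>Lev \<alpha>. x \<subseteq>\<^sub>m y"
proof (cases "\<xi> = \<alpha>")
  case True
  then show ?thesis using assms(1) by (intro bexI[of _ x]) simp_all
next
  case False
  obtain y where "y \<in> Lev \<alpha>" using Lev_nonempty[OF assms(3)] by blast
  then have "y ++ x \<in> Lev \<alpha>" using Lev_graft assms False by simp
  then show ?thesis using map_le_map_add by blast
qed

lemma Lev_map_leD:
  assumes "x \<in> Lev \<xi>" "y \<in> Lev \<alpha>" "\<xi> < \<kappa>" "\<alpha> < \<kappa>" "x \<subseteq>\<^sub>m y"
  shows "\<xi> \<le> \<alpha>"
  using map_le_implies_dom_le[OF assms(5)] Lev_dom[OF assms(3,1)] Lev_dom[OF assms(4,2)]
  by (metis lessThan_subset_iff)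

text \<open>New values enter only at successor levels; at a limit every value already occurs in a
  proper restriction.\<close>

lemma Lev_ran: "\<lbrakk>\<alpha> < \<kappa>; t \<in> Lev \<alpha>\<rbrakk> \<Longrightarrow> ran t \<subseteq> {..<\<kappa>}"
proof (induction \<alpha> arbitrary: t rule: less_induct)
  case (less \<alpha>)
  show ?case
  proof (cases "\<exists>\<beta>. is_succ \<beta> \<alpha>")
    case True
    then obtain \<beta> where \<beta>: "is_succ \<beta> \<alpha>" by blast
    then have \<beta>\<kappa>: "\<beta> < \<alpha>" "\<beta> < \<kappa>" using is_succ_iff[OF \<beta>] less.prems(1) by (auto intro: order.strict_trans)
    obtain s i where s: "t = s(\<beta> \<mapsto> i)" "s \<in> Lev \<beta>" "i < w \<beta>"
      using less.prems(2) unfolding Lev_succ[OF less.prems(1) \<beta>] by blast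
    have "ran s \<subseteq> {..<\<kappa>}" by (rule less.IH[OF \<beta>\<kappa> s(2)])
    moreover have "i < \<kappa>" using s(3) w_less[OF \<beta>\<kappa>(2)] by simp
    moreover have "ran t \<subseteq> insert i (ran s)" unfolding s(1) ran_def by auto
    ultimately show ?thesis by auto
  next
    case False
    show ?thesis
    proof
      fix y assume "y \<in> ran t"
      then obtain x where x: "t x = Some y" unfolding ran_def by blast
      then have "x < \<alpha>" using Lev_dom[OF less.prems] by (metis domI lessThan_iff)
      then obtain \<eta> where \<eta>: "\<eta> < \<alpha>" "x < \<eta>" using not_succ_cofinal[OF False] by blast
      then have "t |` {..<\<eta>} \<in> Lev \<eta>" using Lev_restrict[OF less.prems] by simp
      then have "ran (t |` {..<\<eta>}) \<subseteq> {..<\<kappa>}" using less.IH \<eta>(1) less.prems(1) by auto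
      moreover have "(t |` {..<\<eta>}) x = Some y" using \<eta> x by simp
      ultimately show "y \<in> {..<\<kappa>}" unfolding ran_def by blast
    qed
  qed
qed

text \<open>A successor node is determined by a node and a value, a node of large cofinality by a
  member of \<open>Cs \<alpha>\<close> and an earlier node. At small cofinality a node is determined
  by its restrictions along a cofinal sequence of length below \<chi>, and \<open>powers\<close>
  bounds the number of such sequences.\<close>

lemma Lev_card: "\<alpha> < \<kappa> \<Longrightarrow> |Lev \<alpha>| <o |{..<\<kappa>}|"
proof (induction \<alpha> rule: less_induct)
  case (less \<alpha>)
  have below: "|\<Union>\<xi>\<in>{..<\<alpha>}. Lev \<xi>| <o |{..<\<kappa>}|"
    using less by (intro UNION_less initial) auto
  consider \<beta> where "is_succ \<beta> \<alpha>" | "\<nexists>\<beta>. is_succ \<beta> \<alpha>" "small_cof \<chi> \<alpha>" | "\<not> small_cof \<chi> \<alpha>" by blast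
  then show ?case
  proof cases
    case 1
    then have \<beta>: "\<beta> < \<alpha>" "\<beta> < \<kappa>" using is_succ_iff[OF 1] less.prems by (auto intro: order.strict_trans)
    show ?thesis
      using image2_less[OF less.IH[OF \<beta>] initial[OF w_less[OF \<beta>(2)]], of "\<lambda>t i. t(\<beta> \<mapsto> i)"]
      unfolding Lev_succ[OF less.prems 1] by simp
  next
    case 2
    show ?thesis
    proof (cases "\<alpha> = bottom")
      case True
      then show ?thesis
        using Lev_bottom less.prems infinite_below[OF less.prems]
        by (intro finite_ordLess_infinite card_of_Well_order) (simp_all add: Field_card_of)
    next
      case False
      obtain \<eta> f where f: "\<eta> < \<chi>" "\<forall>\<xi><\<alpha>. \<exists>\<zeta><\<eta>. f \<zeta> < \<alpha> \<and> \<xi> \<le> f \<zeta>"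
        using 2(2) unfolding small_cof_def by blast
      obtain \<mu> e where e: "\<mu> < \<kappa>" "bij_betw e (\<Union>\<xi>\<in>{..<\<alpha>}. Lev \<xi>) {..<\<mu>}"
        using card_less_imp_bij[OF below] by blast
      \<comment> \<open>Values of \<open>f\<close> outside \<alpha> are replaced by
        \<open>bottom\<close>, which lies below \<alpha> since the least level has been treated
        separately.\<close>
      define f' where "f' \<zeta> = (if f \<zeta> < \<alpha> then f \<zeta> else bottom)" for \<zeta>
      have f': "f' \<zeta> < \<alpha>" for \<zeta>
        using False bottom_le[of \<alpha>] by (auto simp: f'_def)
      have res: "t |` {..<f' \<zeta>} \<in> (\<Union>\<xi>\<in>{..<\<alpha>}. Lev \<xi>)" if "t \<in> Lev \<alpha>" for t \<zeta>
        using Lev_restrict[OF less.prems that, of "f' \<zeta>"] f'[of \<zeta>]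
        by (intro UN_I[of "f' \<zeta>"]) simp_all
      \<comment> \<open>\<open>Func\<close> requires its members to be \<open>undefined\<close>
        outside their domain.\<close>
      define \<Phi> where "\<Phi> t \<zeta> = (if \<zeta> < \<eta> then e (t |` {..<f' \<zeta>}) else undefined)" for t \<zeta>
      have "inj_on \<Phi> (Lev \<alpha>)"
      proof (rule inj_onI)
        fix s t assume st: "s \<in> Lev \<alpha>" "t \<in> Lev \<alpha>" "\<Phi> s = \<Phi> t"
        have eq: "s |` {..<f' \<zeta>} = t |` {..<f' \<zeta>}" if "\<zeta> < \<eta>" for \<zeta>
          using fun_cong[OF st(3), of \<zeta>] that inj_onD[OF bij_betw_imp_inj_on[OF e(2)]] res[OF st(1)] res[OF st(2)]
          by (simp add: \<Phi>_def)
        show "s = t"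
        proof
          fix x
          show "s x = t x"
          proof (cases "x < \<alpha>")
            case True
            then obtain \<xi> where \<xi>: "\<xi> < \<alpha>" "x < \<xi>" using not_succ_cofinal[OF 2(1)] by blast
            then obtain \<zeta> where \<zeta>: "\<zeta> < \<eta>" "f \<zeta> < \<alpha>" "\<xi> \<le> f \<zeta>" using f(2) by blast
            then have "x < f' \<zeta>" using \<xi>(2) by (simp add: f'_def)
            then show ?thesis using fun_cong[OF eq[OF \<zeta>(1)], of x] by simp
          next
            case False
            then show ?thesis using Lev_dom[OF less.prems] st(1,2) by (metis domIff lessThan_iff)
          qed
        qed
      qed
      moreover have "\<Phi> ` Lev \<alpha> \<subseteq> Func {..<\<eta>} {..<\<mu>}"
      proof
        fix h assume "h \<in> \<Phi> ` Lev \<alpha>"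
        then obtain t where t: "t \<in> Lev \<alpha>" "h = \<Phi> t" by blast
        have "e (t |` {..<f' \<zeta>}) < \<mu>" for \<zeta>
          using bij_betwE[OF e(2)] res[OF t(1)] by blast
        then show "h \<in> Func {..<\<eta>} {..<\<mu>}" unfolding t(2) Func_def \<Phi>_def by simp
      qed
      ultimately have "|Lev \<alpha>| \<le>o |Func {..<\<eta>} {..<\<mu>}|"
        using card_of_ordLeq by blast
      then show ?thesis using powers[OF f(1) e(1)] ordLeq_ordLess_trans by blast
    qed
  next
    case 3
    have "|{glue (branch Lev (fst C) (snd C) ` (fst C)) ++ x |C x. C \<in> Cs \<alpha> \<and> x \<in> (\<Union>\<xi>\<in>{..<\<alpha>}. Lev \<xi>)}|
       <o |{..<\<kappa>}|"
      by (rule image2_less[OF Cs_card[OF less.prems not_small_limit(2)[OF 3]] below])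
    then show ?thesis
      by (rule ordLeq_ordLess_trans[OF card_of_mono1, rotated])
        (use Lev_large[OF less.prems 3] in force)
  qed
qed

section \<open>Successors, indices of nodes, and successor points of \<open>E\<close>\<close>

lemma ex_succ: assumes "\<beta> < \<kappa>" shows "\<exists>\<alpha><\<kappa>. is_succ \<beta> \<alpha>"
proof -
  obtain \<delta> where \<delta>: "\<delta> < \<kappa>" "\<beta> < \<delta>" using exists_greater[OF assms] by blast
  define \<alpha> where "\<alpha> = (LEAST x. \<beta> < x)"
  have "\<beta> < \<alpha>" unfolding \<alpha>_def by (rule LeastI[of _ \<delta>]) (rule \<delta>(2))
  have "\<alpha> \<le> \<delta>" unfolding \<alpha>_def by (rule Least_le) (rule \<delta>(2))
  have "\<xi> < \<alpha> \<longleftrightarrow> \<xi> \<le> \<beta>" for \<xi>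
  proof
    assume "\<xi> < \<alpha>"
    then have "\<not> \<beta> < \<xi>" unfolding \<alpha>_def by (rule not_less_Least)
    then show "\<xi> \<le> \<beta>" by simp
  next
    assume "\<xi> \<le> \<beta>"
    then show "\<xi> < \<alpha>" using \<open>\<beta> < \<alpha>\<close> by simp
  qed
  then have "is_succ \<beta> \<alpha>" unfolding is_succ_def by blast
  moreover have "\<alpha> < \<kappa>" using \<open>\<alpha> \<le> \<delta>\<close> \<delta>(1) by simp
  ultimately show ?thesis by blast
qed

lemma split_less:
  assumes "i < \<kappa>" shows "fst (split i) < \<kappa>" "snd (split i) < \<kappa>"
proof -
  have "split i \<in> split ` {..<\<kappa>}" using assms by simp
  then have "split i \<in> {..<\<kappa>} \<times> {..<\<kappa>}" by (simp only: split_image[OF assms])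
  then show "fst (split i) < \<kappa>" "snd (split i) < \<kappa>" by (simp_all add: mem_Times_iff)
qed

lemma enum_Lev: "\<xi> < \<kappa> \<Longrightarrow> enum (Lev \<xi>) ` {..<\<kappa>} = Lev \<xi>"
  by (intro enum_surj Lev_nonempty Lev_card)

lemma node_in_level: "i < \<kappa> \<Longrightarrow> node Lev i \<in> Lev (fst (split i))"
  unfolding node_def using enum_Lev[of "fst (split i)"] split_less[of i] by blast

lemma ex_node:
  assumes "\<xi> < \<kappa>" "x \<in> Lev \<xi>" shows "\<exists>i<\<kappa>. fst (split i) = \<xi> \<and> node Lev i = x"
proof -
  have "x \<in> enum (Lev \<xi>) ` {..<\<kappa>}" using assms(2) by (simp only: enum_Lev[OF assms(1)])
  then obtain \<zeta> where \<zeta>: "\<zeta> < \<kappa>" "enum (Lev \<xi>) \<zeta> = x" by auto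
  obtain i where "i < \<kappa>" "split i = (\<xi>, \<zeta>)" using split_surj[OF assms(1) \<zeta>(1)] by blast
  then show ?thesis using \<zeta>(2) by (intro exI[of _ i]) (simp add: node_def)
qed

text \<open>The point \<gamma> is the largest point of \<open>E\<close> below \<beta>, so the union
  of all earlier values is the value at \<gamma>.\<close>

lemma branch_next:
  assumes \<alpha>: "\<alpha> < \<kappa>" "unbounded_in \<alpha> {..<\<alpha>}" and C: "(E, g) \<in> Cs \<alpha>" and nx: "next_in E \<gamma> \<beta>"
  shows "branch Lev E g \<beta> = pick Lev g (branch Lev E g \<gamma>) \<beta> ++ branch Lev E g \<gamma>"
proof -
  let ?b = "branch Lev E g"
  have \<gamma>: "\<gamma> \<in> E" "\<gamma> < \<beta>" "\<And>\<eta>. \<lbrakk>\<eta> \<in> E; \<eta> < \<beta>\<rbrakk> \<Longrightarrow> \<eta> \<le> \<gamma>"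
    using nx unfolding next_in_def by auto
  have lev: "coherent_level \<delta>" if "\<delta> < \<alpha>" for \<delta> using that \<alpha>(1) by (intro coherent_levels) simp
  have mono: "?b \<eta> \<subseteq>\<^sub>m ?b \<gamma>" if "\<eta> \<in> E \<inter> {..<\<beta>}" for \<eta>
  proof (cases "\<eta> = \<gamma>")
    case False
    then have "\<eta> < \<gamma>" using \<gamma>(3)[of \<eta>] that by simp
    then show ?thesis using branch_in_level[OF \<alpha> C lev \<gamma>(1)] that by blast
  qed simp
  have "glue (?b ` (E \<inter> {..<\<beta>})) = ?b \<gamma>"
  proof (rule glue_eqI)
    show "dom (?b \<gamma>) = (\<Union>t\<in>?b ` (E \<inter> {..<\<beta>}). dom t)"
      using mono[THEN map_le_implies_dom_le] \<gamma>(1,2) by blast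
  qed (use mono in blast)
  then show ?thesis using branch.simps[of Lev E g \<beta>] by simp
qed

section \<open>Sealing: chains and antichains are small\<close>

definition tree :: "('o \<rightharpoonup> 'o) set" where "tree = (\<Union>\<xi>\<in>{..<\<kappa>}. Lev \<xi>)"

text \<open>The nodes with index in \<Omega> form a predense set. Compatibility is phrased through a
  common extension \<open>y\<close> because that is what the search meets.\<close>

definition dense_index :: "'o set \<Rightarrow> bool" where
  "dense_index \<Omega> \<longleftrightarrow> \<Omega> \<subseteq> {..<\<kappa>} \<and> (\<forall>x\<in>tree. \<exists>y\<in>tree. x \<subseteq>\<^sub>m y \<and> (\<exists>j\<in>\<Omega>. node Lev j \<subseteq>\<^sub>m y))"

text \<open>For \<open>\<beta>\<close> in a club \<open>D\<close> of closure points, the search made by \<open>pick\<close> succeeds below \<open>\<beta>\<close>.\<close>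

lemma ex_sealed_level:
  assumes \<Omega>: "dense_index \<Omega>"
  shows "\<exists>\<alpha><\<kappa>. \<forall>t\<in>Lev \<alpha>. \<exists>j\<in>\<Omega>. fst (split j) < \<alpha> \<and> node Lev j \<subseteq>\<^sub>m t"
proof -
  \<comment> \<open>Closing off under \<open>R\<close> makes two things available below each point
    of \<open>D\<close>: an index for every node of an earlier level, and a witness for predensity
    above that node together with its index in \<Omega>.\<close>
  define R where "R \<xi> \<delta> \<longleftrightarrow> (\<forall>x\<in>Lev \<xi>. (\<exists>i<\<delta>. fst (split i) = \<xi> \<and> node Lev i = x) \<and>
    (\<exists>\<zeta><\<delta>. \<exists>y\<in>Lev \<zeta>. x \<subseteq>\<^sub>m y \<and> (\<exists>j\<in>\<Omega>. j < \<delta> \<and> node Lev j \<subseteq>\<^sub>m y)))" for \<xi> \<delta>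
  have ex_R: "\<exists>\<delta><\<kappa>. R \<xi> \<delta>" if \<xi>: "\<xi> < \<kappa>" for \<xi>
  proof -
    have "\<exists>m<\<kappa>. (\<exists>i\<le>m. fst (split i) = \<xi> \<and> node Lev i = x) \<and>
      (\<exists>\<zeta>\<le>m. \<exists>y\<in>Lev \<zeta>. x \<subseteq>\<^sub>m y \<and> (\<exists>j\<in>\<Omega>. j \<le> m \<and> node Lev j \<subseteq>\<^sub>m y))" if x: "x \<in> Lev \<xi>" for x
    proof -
      obtain i where i: "i < \<kappa>" "fst (split i) = \<xi>" "node Lev i = x" using ex_node[OF \<xi> x] by blast
      have "x \<in> tree" using \<xi> x unfolding tree_def by blast
      then obtain y j where y: "y \<in> tree" "x \<subseteq>\<^sub>m y" "j \<in> \<Omega>" "node Lev j \<subseteq>\<^sub>m y"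
        using \<Omega> unfolding dense_index_def by blast
      obtain \<zeta> where \<zeta>: "\<zeta> < \<kappa>" "y \<in> Lev \<zeta>" using y(1) unfolding tree_def by blast
      have "j < \<kappa>" using \<Omega> y(3) unfolding dense_index_def by blast
      then have m: "max i (max \<zeta> j) < \<kappa>" using i(1) \<zeta>(1) by simp
      have "i \<le> max i (max \<zeta> j)" "\<zeta> \<le> max i (max \<zeta> j)" "j \<le> max i (max \<zeta> j)" by (simp_all add: le_max_iff_disj)
      with m i y \<zeta>(2) show ?thesis by blast
    qed
    then obtain m where m: "\<And>x. x \<in> Lev \<xi> \<Longrightarrow> m x < \<kappa> \<and> (\<exists>i\<le>m x. fst (split i) = \<xi> \<and> node Lev i = x) \<and>
      (\<exists>\<zeta>\<le>m x. \<exists>y\<in>Lev \<zeta>. x \<subseteq>\<^sub>m y \<and> (\<exists>j\<in>\<Omega>. j \<le> m x \<and> node Lev j \<subseteq>\<^sub>m y))"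
      by metis
    then obtain \<delta> where \<delta>: "\<delta> < \<kappa>" "\<forall>x\<in>Lev \<xi>. m x < \<delta>"
      using bounded_card[OF Lev_card[OF \<xi>], of m] by blast
    have "R \<xi> \<delta>" unfolding R_def
    proof (intro ballI conjI)
      fix x assume x: "x \<in> Lev \<xi>"
      have lt: "i < \<delta>" if "i \<le> m x" for i using \<delta>(2) x that by (metis order.strict_trans1)
      show "\<exists>i<\<delta>. fst (split i) = \<xi> \<and> node Lev i = x" using m[OF x] lt by blast
      show "\<exists>\<zeta><\<delta>. \<exists>y\<in>Lev \<zeta>. x \<subseteq>\<^sub>m y \<and> (\<exists>j\<in>\<Omega>. j < \<delta> \<and> node Lev j \<subseteq>\<^sub>m y)" using m[OF x] lt by blast
    qed
    with \<delta>(1) show ?thesis by blast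
  qed
  define D where "D = {\<delta>. \<delta> < \<kappa> \<and> (\<forall>\<xi><\<delta>. \<exists>\<delta>'<\<delta>. R \<xi> \<delta>')}"
  have "club D" unfolding D_def by (rule club_closure_points[OF ex_R])
  moreover have "\<Omega> \<subseteq> {..<\<kappa>}" using \<Omega> unfolding dense_index_def by blast
  ultimately obtain \<alpha> where \<alpha>: "\<alpha> < \<kappa>" "\<not> small_cof \<chi> \<alpha>"
    and guess\<alpha>: "\<And>E g i \<xi>. \<lbrakk>(E, g) \<in> Cs \<alpha>; i < \<alpha>; \<xi> < \<alpha>\<rbrakk> \<Longrightarrow> \<exists>\<gamma> \<beta>. next_in E \<gamma> \<beta> \<and> \<xi> < \<gamma> \<and>
        idx \<beta> = i \<and> \<beta> \<in> D \<and> g \<beta> = \<Omega> \<inter> {..<\<beta>}"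
    using guess[of D \<Omega>] by fast
  have lim: "unbounded_in \<alpha> {..<\<alpha>}" by (rule not_small_limit(2)[OF \<alpha>(2)])
  have lev: "coherent_level \<delta>" if "\<delta> < \<alpha>" for \<delta> using that \<alpha>(1) by (intro coherent_levels) simp
  have "\<exists>j\<in>\<Omega>. fst (split j) < \<alpha> \<and> node Lev j \<subseteq>\<^sub>m t" if t: "t \<in> Lev \<alpha>" for t
  proof -
    obtain E g x \<xi> where s: "t = glue (branch Lev E g ` E) ++ x" "(E, g) \<in> Cs \<alpha>" "\<xi> < \<alpha>" "x \<in> Lev \<xi>"
      using t unfolding Lev_large[OF \<alpha>] by blast
    have sub: "E \<subseteq> {..<\<alpha>}" by (rule Cs_sub[OF \<alpha>(1) lim s(2)])
    \<comment> \<open>A first use of the guess, with the arbitrary index \<open>bottom\<close>, only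
      supplies a point of \<open>D\<close> between \<xi> and \<alpha>. Closure at that point gives
      \<open>x\<close> an index \<open>i\<close> below \<alpha>.\<close>
    have "bottom < \<alpha>" using lim bottom_le unfolding unbounded_in_def by (metis order.strict_trans1)
    then obtain \<gamma>\<^sub>0 \<beta>\<^sub>0 where 0: "next_in E \<gamma>\<^sub>0 \<beta>\<^sub>0" "\<xi> < \<gamma>\<^sub>0" "\<beta>\<^sub>0 \<in> D" using guess\<alpha>[OF s(2) _ s(3)] by blast
    then have "\<xi> < \<beta>\<^sub>0" "\<beta>\<^sub>0 < \<alpha>" using sub unfolding next_in_def by auto
    then obtain \<delta>' where "\<delta>' < \<beta>\<^sub>0" "R \<xi> \<delta>'" using 0(3) unfolding D_def by blast
    then obtain i where i: "i < \<delta>'" "fst (split i) = \<xi>" "node Lev i = x" using s(4) unfolding R_def by blast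
    have "i < \<alpha>" using i(1) \<open>\<delta>' < \<beta>\<^sub>0\<close> \<open>\<beta>\<^sub>0 < \<alpha>\<close> by simp
    \<comment> \<open>The second use takes the index of \<open>x\<close> itself, so that the search
      from \<gamma> to \<beta> is made on behalf of \<open>x\<close>.\<close>
    then obtain \<gamma> \<beta> where \<beta>: "next_in E \<gamma> \<beta>" "\<xi> < \<gamma>" "idx \<beta> = i" "\<beta> \<in> D" "g \<beta> = \<Omega> \<inter> {..<\<beta>}"
      using guess\<alpha>[OF s(2) _ s(3)] by blast
    have lt: "\<gamma> \<in> E" "\<beta> \<in> E" "\<gamma> < \<beta>" "\<beta> < \<alpha>" "\<beta> < \<kappa>"
      using \<beta>(1) sub \<alpha>(1) unfolding next_in_def by auto
    then have \<gamma>\<kappa>: "\<gamma> < \<kappa>" by simp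
    define u where "u = branch Lev E g \<gamma>"
    have u: "u \<in> Lev \<gamma>" unfolding u_def using branch_in_level[OF \<alpha>(1) lim s(2) lev lt(1)] by blast
    have ux: "u ++ x \<in> Lev \<gamma>" by (rule Lev_graft[OF \<gamma>\<kappa> u s(4) \<beta>(2)])
    \<comment> \<open>The node \<open>u ++ x\<close> has level \<gamma> < \<beta>, so closure of
      \<beta> yields an extension of it at a level below \<beta> that lies above a node with index
      in \<Omega> and below \<beta>. Extended to level \<beta>, it shows that the search
      succeeds.\<close>
    obtain \<delta> where \<delta>: "\<delta> < \<beta>" "R \<gamma> \<delta>" using \<beta>(4) lt(3) unfolding D_def by blast
    then obtain \<zeta> y j where y: "\<zeta> < \<delta>" "y \<in> Lev \<zeta>" "u ++ x \<subseteq>\<^sub>m y" "j \<in> \<Omega>" "j < \<delta>" "node Lev j \<subseteq>\<^sub>m y"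
      using ux unfolding R_def by blast
    have \<zeta>: "\<zeta> < \<beta>" "\<zeta> < \<kappa>" and j: "j < \<kappa>" using y(1,5) \<delta>(1) lt(5) by simp_all
    obtain t\<^sub>0 where t0: "t\<^sub>0 \<in> Lev \<beta>" "y \<subseteq>\<^sub>m t\<^sub>0" 
      using Lev_extend[OF y(2) order.strict_implies_order[OF \<zeta>(1)] lt(5)] by blast
    have "fst (split j) \<le> \<zeta>"
      by (rule Lev_map_leD[OF node_in_level[OF j] y(2) split_less(1)[OF j] \<zeta>(2) y(6)])
    then have "fst (split j) < \<beta>" using \<zeta>(1) by simp
    moreover have "fst (split (idx \<beta>)) < \<beta>" using \<beta>(2,3) i(2) lt(3) by simp
    moreover have "j \<in> g \<beta>" using y(4,5) \<delta>(1) \<beta>(5) by simp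
    moreover have "node Lev j \<subseteq>\<^sub>m t\<^sub>0" "u ++ node Lev (idx \<beta>) \<subseteq>\<^sub>m t\<^sub>0"
      using y(3,6) t0(2) map_le_trans \<beta>(3) i(3) by blast+
    ultimately have "seals Lev g u \<beta> t\<^sub>0" unfolding seals_def by blast
    define p where "p = pick Lev g u \<beta>"
    have "seals Lev g u \<beta> p"
      unfolding p_def using pick_in_level(2)[OF Lev_nonempty[OF lt(5)]] t0(1) \<open>seals Lev g u \<beta> t\<^sub>0\<close> by blast
    then obtain j' where j': "j' \<in> \<Omega>" "fst (split j') < \<beta>" "node Lev j' \<subseteq>\<^sub>m p" "u ++ x \<subseteq>\<^sub>m p"
      unfolding seals_def \<beta>(3,5) i(3) by blast
    have "branch Lev E g \<beta> = p ++ u"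
      unfolding p_def u_def by (rule branch_next[OF \<alpha>(1) lim s(2) \<beta>(1)])
    then have "p ++ u \<subseteq>\<^sub>m glue (branch Lev E g ` E)"
      using branch_glue(2)[OF \<alpha>(1) lim s(2) lev lt(2)] by simp
    then have "(p ++ u) ++ x \<subseteq>\<^sub>m t" unfolding s(1) by (rule map_add_mono_left)
    \<comment> \<open>Grafting \<open>u\<close> may destroy the sealing property of
      \<open>p\<close>, but grafting \<open>x\<close> afterwards restores it: the result is
      \<open>p ++ (u ++ x)\<close>, and \<open>u ++ x\<close> is contained in
      \<open>p\<close>.\<close>
    moreover have "(p ++ u) ++ x = p" using map_add_map_le[OF j'(4)] by simp
    ultimately have "node Lev j' \<subseteq>\<^sub>m t" using j'(3) map_le_trans by metis
    moreover have "fst (split j') < \<alpha>" using j'(2) lt(4) by simp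
    ultimately show ?thesis using j'(1) by blast
  qed
  with \<alpha>(1) show ?thesis by blast
qed

text \<open>A node of \<open>A\<close> at level \<alpha> or higher would lie above a member of
  \<open>A'\<close> of level below \<alpha>. A member of \<open>A'\<close> comparable with an
  element of \<open>A\<close> belongs to \<open>A\<close>, against the antichain property. Hence all
  of \<open>A\<close> lies below the sealed level.\<close>

theorem antichain_card:
  assumes A: "A \<subseteq> tree" "\<And>s t. \<lbrakk>s \<in> A; t \<in> A; s \<subseteq>\<^sub>m t\<rbrakk> \<Longrightarrow> s = t"
  shows "|A| <o |{..<\<kappa>}|"
proof -
  define A' where "A' = {x \<in> tree. x \<in> A \<or> (\<forall>a\<in>A. \<not> x \<subseteq>\<^sub>m a \<and> \<not> a \<subseteq>\<^sub>m x)}"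
  define \<Omega> where "\<Omega> = {j. j < \<kappa> \<and> node Lev j \<in> A'}"
  have index: "\<exists>j\<in>\<Omega>. node Lev j = x" if "x \<in> A'" for x
  proof -
    obtain \<xi> where "\<xi> < \<kappa>" "x \<in> Lev \<xi>" using \<open>x \<in> A'\<close> unfolding A'_def tree_def by blast
    then show ?thesis using ex_node[of \<xi> x] \<open>x \<in> A'\<close> unfolding \<Omega>_def by blast
  qed
  have "\<exists>y\<in>tree. x \<subseteq>\<^sub>m y \<and> (\<exists>j\<in>\<Omega>. node Lev j \<subseteq>\<^sub>m y)" if x: "x \<in> tree" for x
  proof -
    consider "x \<in> A'" | a where "a \<in> A" "x \<subseteq>\<^sub>m a" | a where "a \<in> A" "a \<subseteq>\<^sub>m x"
      using x unfolding A'_def by blast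
    then show ?thesis
    proof cases
      case 1
      then show ?thesis using index[OF 1] x map_le_refl by metis
    next
      case 2
      then have "a \<in> A'" "a \<in> tree" using A(1) unfolding A'_def by auto
      then show ?thesis using index[of a] 2 map_le_refl by metis
    next
      case 3
      then have "a \<in> A'" using A(1) unfolding A'_def by auto
      then show ?thesis using index[of a] 3 x map_le_refl by metis
    qed
  qed
  then have "dense_index \<Omega>" unfolding dense_index_def \<Omega>_def by blast
  then obtain \<alpha> where \<alpha>: "\<alpha> < \<kappa>" "\<forall>t\<in>Lev \<alpha>. \<exists>j\<in>\<Omega>. fst (split j) < \<alpha> \<and> node Lev j \<subseteq>\<^sub>m t"
    using ex_sealed_level by blast
  have "A \<subseteq> (\<Union>\<xi>\<in>{..<\<alpha>}. Lev \<xi>)"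
  proof
    fix a assume a: "a \<in> A"
    then obtain \<xi> where \<xi>: "\<xi> < \<kappa>" "a \<in> Lev \<xi>" using A(1) unfolding tree_def by blast
    have "\<not> \<alpha> \<le> \<xi>"
    proof
      assume le: "\<alpha> \<le> \<xi>"
      then have "a |` {..<\<alpha>} \<in> Lev \<alpha>" by (rule Lev_restrict[OF \<xi>])
      then obtain j where j: "j \<in> \<Omega>" "fst (split j) < \<alpha>" "node Lev j \<subseteq>\<^sub>m a |` {..<\<alpha>}"
        using \<alpha>(2) by blast
      moreover have "a |` {..<\<alpha>} \<subseteq>\<^sub>m a" by (auto simp: map_le_def)
      ultimately have le': "node Lev j \<subseteq>\<^sub>m a" using map_le_trans by blast
      have "node Lev j \<in> A'" "j < \<kappa>" using j(1) unfolding \<Omega>_def by auto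
      then have "node Lev j \<in> A" using le' a unfolding A'_def by blast
      then have "a = node Lev j" using A(2)[OF _ a le'] by simp
      then have "\<xi> \<le> fst (split j)"
        using Lev_map_leD[OF \<xi>(2) node_in_level[OF \<open>j < \<kappa>\<close>] \<xi>(1) split_less(1)[OF \<open>j < \<kappa>\<close>]] by simp
      then show False using j(2) le by simp
    qed
    then show "a \<in> (\<Union>\<xi>\<in>{..<\<alpha>}. Lev \<xi>)" using \<xi>(2) by (intro UN_I[of \<xi>]) simp_all
  qed
  then have "|A| \<le>o |\<Union>\<xi>\<in>{..<\<alpha>}. Lev \<xi>|" by (rule card_of_mono1)
  moreover have "|\<Union>\<xi>\<in>{..<\<alpha>}. Lev \<xi>| <o |{..<\<kappa>}|"
    using \<alpha>(1) by (intro UNION_less initial Lev_card) auto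
  ultimately show ?thesis by (rule ordLeq_ordLess_trans)
qed

text \<open>Every node has two immediate successors, and at most one of them lies below a member of
  the chain. Choosing for each \<open>s\<close> a successor \<open>e s\<close> that leaves the chain
  turns the chain into an antichain of the same size.\<close>

theorem chain_card:
  assumes c: "c \<subseteq> tree" "\<And>s t. \<lbrakk>s \<in> c; t \<in> c\<rbrakk> \<Longrightarrow> s \<subseteq>\<^sub>m t \<or> t \<subseteq>\<^sub>m s"
  shows "|c| <o |{..<\<kappa>}|"
proof -
  have "\<exists>s'. s' \<in> tree \<and> (\<forall>t\<in>c. \<not> s' \<subseteq>\<^sub>m t) \<and> (\<exists>\<xi> i. \<xi> < \<kappa> \<and> s \<in> Lev \<xi> \<and> s' = s(\<xi> \<mapsto> i))"
    if s: "s \<in> c" for s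
  proof -
    obtain \<xi> where \<xi>: "\<xi> < \<kappa>" "s \<in> Lev \<xi>" using s c(1) unfolding tree_def by blast
    obtain \<alpha> where \<alpha>: "\<alpha> < \<kappa>" "is_succ \<xi> \<alpha>" using ex_succ[OF \<xi>(1)] by blast
    obtain a b where ab: "a < b" "b < w \<xi>" using two_less_w[OF \<xi>(1)] by blast
    then have "s(\<xi> \<mapsto> a) \<in> Lev \<alpha>" "s(\<xi> \<mapsto> b) \<in> Lev \<alpha>"
      using \<xi>(2) order.strict_trans[OF ab] unfolding Lev_succ[OF \<alpha>] by blast+
    then have in_tree: "s(\<xi> \<mapsto> a) \<in> tree" "s(\<xi> \<mapsto> b) \<in> tree" using \<alpha>(1) unfolding tree_def by blast+
    have "\<not> (s(\<xi> \<mapsto> a) \<subseteq>\<^sub>m t\<^sub>1 \<and> s(\<xi> \<mapsto> b) \<subseteq>\<^sub>m t\<^sub>2)" if "t\<^sub>1 \<in> c" "t\<^sub>2 \<in> c" for t\<^sub>1 t\<^sub>2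
    proof
      assume "s(\<xi> \<mapsto> a) \<subseteq>\<^sub>m t\<^sub>1 \<and> s(\<xi> \<mapsto> b) \<subseteq>\<^sub>m t\<^sub>2"
      then have "t\<^sub>1 \<xi> = Some a" "t\<^sub>2 \<xi> = Some b" unfolding map_le_def by auto
      then show False using c(2)[OF that] ab(1) unfolding map_le_def by (metis domI option.inject order.irrefl)
    qed
    then have "(\<forall>t\<in>c. \<not> s(\<xi> \<mapsto> a) \<subseteq>\<^sub>m t) \<or> (\<forall>t\<in>c. \<not> s(\<xi> \<mapsto> b) \<subseteq>\<^sub>m t)" by blast
    with in_tree \<xi> show ?thesis by blast
  qed
  then obtain e where e: "\<And>s. s \<in> c \<Longrightarrow> e s \<in> tree \<and> (\<forall>t\<in>c. \<not> e s \<subseteq>\<^sub>m t) \<and>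
      (\<exists>\<xi> i. \<xi> < \<kappa> \<and> s \<in> Lev \<xi> \<and> e s = s(\<xi> \<mapsto> i))" by metis
  have eq: "s = t" if st: "s \<in> c" "t \<in> c" "e s \<subseteq>\<^sub>m e t" for s t
  proof -
    obtain \<xi> i where s: "\<xi> < \<kappa>" "s \<in> Lev \<xi>" "e s = s(\<xi> \<mapsto> i)" using e[OF st(1)] by blast
    obtain \<zeta> k where t: "\<zeta> < \<kappa>" "t \<in> Lev \<zeta>" "e t = t(\<zeta> \<mapsto> k)" using e[OF st(2)] by blast
    have doms: "dom s = {..<\<xi>}" and domt: "dom t = {..<\<zeta>}" using Lev_dom s t by blast+
    have "\<xi> \<in> dom (e t)" using map_le_implies_dom_le[OF st(3)] s(3) by auto
    then have "\<xi> \<le> \<zeta>" using t(3) domt by auto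
    moreover have "\<not> \<xi> < \<zeta>"
    proof
      assume lt: "\<xi> < \<zeta>"
      \<comment> \<open>The only point where \<open>e t\<close> goes beyond \<open>t\<close> is
        \<zeta>, which is outside the domain of \<open>e s\<close>. So \<open>e s\<close> would lie
        below a member of the chain.\<close>
      have "e s \<subseteq>\<^sub>m t" unfolding map_le_def
      proof
        fix a assume a: "a \<in> dom (e s)"
        then have "a \<noteq> \<zeta>" using s(3) doms lt by auto
        then show "e s a = t a" using st(3) a t(3) unfolding map_le_def by auto
      qed
      with e[OF st(1)] st(2) show False by blast
    qed
    ultimately have "\<xi> = \<zeta>" by simp
    then have "dom s = dom t" using doms domt by simp
    then show "s = t" using c(2)[OF st(1,2)] map_le_dom_eq by metis
  qed
  have "inj_on e c" by (rule inj_onI) (use eq in simp)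
  then have "|c| \<le>o |e ` c|" using card_of_ordLeq by blast
  moreover have "|e ` c| <o |{..<\<kappa>}|"
  proof (rule antichain_card)
    show "e ` c \<subseteq> tree" using e by blast
    fix s t assume "s \<in> e ` c" "t \<in> e ` c" "s \<subseteq>\<^sub>m t"
    then show "s = t" using eq by auto
  qed
  ultimately show ?thesis by (rule ordLeq_ordLess_trans)
qed

text \<open>Let \<delta> be the supremum of the lengths. If it is attained, the union is a member of
  the sequence. Otherwise \<delta> has cofinality below \<chi>, and the level keeps all branches;
  the empty sequence falls under this case.\<close>

theorem small_chain_glue:
  assumes \<eta>: "\<eta> < \<chi>" and F: "\<And>\<zeta>. \<zeta> < \<eta> \<Longrightarrow> F \<zeta> \<in> tree"
    "\<And>\<zeta> \<zeta>'. \<lbrakk>\<zeta> < \<zeta>'; \<zeta>' < \<eta>\<rbrakk> \<Longrightarrow> F \<zeta> \<subseteq>\<^sub>m F \<zeta>'"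
  shows "glue (F ` {..<\<eta>}) \<in> tree" and "\<And>\<zeta>. \<zeta> < \<eta> \<Longrightarrow> F \<zeta> \<subseteq>\<^sub>m glue (F ` {..<\<eta>})"
proof -
  define u where "u = glue (F ` {..<\<eta>})"
  have comp: "F \<zeta> \<subseteq>\<^sub>m F \<zeta>' \<or> F \<zeta>' \<subseteq>\<^sub>m F \<zeta>" if "\<zeta> < \<eta>" "\<zeta>' < \<eta>" for \<zeta> \<zeta>'
    using that F(2)[of \<zeta> \<zeta>'] F(2)[of \<zeta>' \<zeta>] by (cases rule: linorder_cases[of \<zeta> \<zeta>']) auto
  show le: "F \<zeta> \<subseteq>\<^sub>m glue (F ` {..<\<eta>})" if "\<zeta> < \<eta>" for \<zeta>
    by (rule map_le_glue) (use comp that in auto)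
  have "\<exists>\<alpha>. \<alpha> < \<kappa> \<and> F \<zeta> \<in> Lev \<alpha>" if "\<zeta> < \<eta>" for \<zeta> using F(1)[OF that] unfolding tree_def by blast
  then obtain l where l: "\<And>\<zeta>. \<zeta> < \<eta> \<Longrightarrow> l \<zeta> < \<kappa> \<and> F \<zeta> \<in> Lev (l \<zeta>)" by metis
  have dom: "dom (F \<zeta>) = {..<l \<zeta>}" if "\<zeta> < \<eta>" for \<zeta> using Lev_dom l[OF that] by blast
  have \<eta>\<kappa>: "\<eta> < \<kappa>" using \<eta> \<chi>_less by simp
  obtain d where d: "d < \<kappa>" "\<forall>\<zeta><\<eta>. l \<zeta> < d" using bounded[OF \<eta>\<kappa>, of l] l by blast
  define \<delta> where "\<delta> = (LEAST d. \<forall>\<zeta><\<eta>. l \<zeta> \<le> d)"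
  have ub: "\<forall>\<zeta><\<eta>. l \<zeta> \<le> \<delta>" unfolding \<delta>_def by (rule LeastI[of _ d]) (use d in auto)
  have "\<delta> \<le> d" unfolding \<delta>_def by (rule Least_le) (use d in auto)
  then have \<delta>\<kappa>: "\<delta> < \<kappa>" using d(1) by simp
  have cof: "\<exists>\<zeta><\<eta>. \<xi> < l \<zeta>" if "\<xi> < \<delta>" for \<xi>
    using not_less_Least[of \<xi> "\<lambda>d. \<forall>\<zeta><\<eta>. l \<zeta> \<le> d"] that unfolding \<delta>_def by (auto simp: not_le)
  show "glue (F ` {..<\<eta>}) \<in> tree"
  proof (cases "\<exists>\<zeta><\<eta>. l \<zeta> = \<delta>")
    case True
    then obtain \<zeta> where \<zeta>: "\<zeta> < \<eta>" "l \<zeta> = \<delta>" by blast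
    have "F \<zeta> = u"
    proof (rule map_le_dom_eq)
      show "F \<zeta> \<subseteq>\<^sub>m u" unfolding u_def by (rule le[OF \<zeta>(1)])
      show "dom (F \<zeta>) = dom u" unfolding u_def dom_glue using \<zeta> ub by (auto simp: dom)
    qed
    then show ?thesis using F(1)[OF \<zeta>(1)] unfolding u_def by simp
  next
    case False
    then have lt: "l \<zeta> < \<delta>" if "\<zeta> < \<eta>" for \<zeta> using ub that by (metis order.not_eq_order_implies_strict)
    have "x \<in> dom u \<longleftrightarrow> (\<exists>\<zeta><\<eta>. x < l \<zeta>)" for x
      unfolding u_def dom_glue using dom by auto
    also have "\<dots> x \<longleftrightarrow> x < \<delta>" for x
      using cof lt order.strict_trans by blast
    finally have domu: "dom u = {..<\<delta>}" by blast
    have "\<exists>\<zeta><\<eta>. l \<zeta> < \<delta> \<and> \<xi> \<le> l \<zeta>" if "\<xi> < \<delta>" for \<xi>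
      using cof[OF that] lt by (meson order.strict_implies_order)
    then have "small_cof \<chi> \<delta>" unfolding small_cof_def
      using \<eta> by (intro exI[of _ \<eta>] conjI exI[of _ l]) simp_all
    moreover have "\<nexists>\<beta>. is_succ \<beta> \<delta>"
    proof
      assume "\<exists>\<beta>. is_succ \<beta> \<delta>"
      then obtain \<beta> where \<beta>: "is_succ \<beta> \<delta>" by blast
      then have "\<beta> < \<delta>" using is_succ_iff[OF \<beta>, of \<beta>] by simp
      then obtain \<zeta> where "\<zeta> < \<eta>" "\<beta> < l \<zeta>" using cof by blast
      then show False using lt[of \<zeta>] is_succ_iff[OF \<beta>, of "l \<zeta>"] by simp
    qed
    moreover have "u |` {..<\<xi>} \<in> Lev \<xi>" if \<xi>: "\<xi> < \<delta>" for \<xi>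
    proof -
      obtain \<zeta> where \<zeta>: "\<zeta> < \<eta>" "\<xi> < l \<zeta>" using cof[OF \<xi>] by blast
      have "u |` {..<\<xi>} = F \<zeta> |` {..<\<xi>}"
        by (rule map_restrict_eqI[OF le[OF \<zeta>(1), folded u_def]]) (use \<zeta> in \<open>auto simp: dom\<close>)
      then show ?thesis using Lev_restrict[of "l \<zeta>" "F \<zeta>" \<xi>] l[OF \<zeta>(1)] \<zeta>(2) by simp
    qed
    ultimately have "u \<in> Lev \<delta>" using domu by (simp add: Lev_small[OF \<delta>\<kappa>])
    then show ?thesis using \<delta>\<kappa> unfolding u_def tree_def by blast
  qed
qed

end

section \<open>Sets, pairs and ordinals\<close>

text \<open>The size bound under which a collection is the extension of an element of the universe,
  so that \<open>elts_mk\<close> applies.\<close>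

abbreviation small :: "'a hset set \<Rightarrow> bool" where
  "small (A :: 'a hset set) \<equiv> |A| \<le>o |UNIV :: (nat + 'a) set|"

lemma infinite_bound: "infinite (UNIV :: (nat + 'a) set)"
  by (simp add: finite_Plus_UNIV_iff)

lemma small_subset: "A \<subseteq> B \<Longrightarrow> small B \<Longrightarrow> small A"
  using card_of_mono1 ordLeq_transitive by blast

lemma small_elts: "small (elts x)" by (rule elts_bound)

lemma small_image: "|A| \<le>o |UNIV :: (nat + 'a) set| \<Longrightarrow> small (f ` A :: 'a hset set)"
  using card_of_image ordLeq_transitive by blast

lemma small_finite:
  assumes "finite (A :: 'a hset set)" shows "small A"
  by (rule ordLess_imp_ordLeq, rule finite_ordLess_infinite[OF card_of_Well_order card_of_Well_order])
    (simp_all add: assms Field_card_of infinite_bound)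

lemma small_UN:
  fixes f :: "'b \<Rightarrow> 'a hset"
  assumes "|A| \<le>o |UNIV :: (nat + 'a) set|" shows "small (\<Union>x\<in>A. elts (f x))"
  by (rule card_of_UNION_ordLeq_infinite[OF infinite_bound assms]) (simp add: elts_bound)

lemma elts_eqI: "elts x = elts y \<Longrightarrow> x = y" by (simp add: elts_inject)

lemma mk_elts: "mk (elts x) = x" by (rule elts_eqI) (simp add: elts_mk small_elts)

lemma mem_irrefl: "x \<notin> elts x"
  using wf_not_refl[OF wf_mem] by (auto simp: mem_rel_def)

lemma mem_asym: "x \<in> elts y \<Longrightarrow> y \<notin> elts x"
  using wf_not_sym[OF wf_mem] by (auto simp: mem_rel_def)

lemma mem_induct: "(\<And>x. (\<And>y. y \<in> elts x \<Longrightarrow> P y) \<Longrightarrow> P x) \<Longrightarrow> P a"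
  using wf_induct_rule[OF wf_mem, of P a] by (simp add: mem_rel_def)

lemma elts_zero: "elts zero = {}"
  unfolding zero_def by (simp add: elts_mk small_finite)

lemma pair_inject: "pair x y = pair x' y' \<longleftrightarrow> x = x' \<and> y = y'"
proof
  have e: "elts (mk {a}) = {a}" "elts (mk {a, b}) = {a, b}" for a b :: "'a hset"
    by (simp_all add: elts_mk small_finite)
  have *: "mk {a} = mk {b, c} \<longleftrightarrow> b = a \<and> c = a" "mk {a} = mk {b} \<longleftrightarrow> a = b"
    "mk {a, d} = mk {b, c} \<longleftrightarrow> {a, d} = {b, c}" for a b c d :: "'a hset"
    using elts_inject[of "mk {a}" "mk {b, c}"] elts_inject[of "mk {a}" "mk {b}"]
      elts_inject[of "mk {a, d}" "mk {b, c}"] unfolding e by auto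
  assume "pair x y = pair x' y'"
  then have "{mk {x}, mk {x, y}} = {mk {x'}, mk {x', y'}}"
    using elts_inject[of "pair x y" "pair x' y'"] unfolding pair_def e by simp
  then show "x = x' \<and> y = y'" by (auto simp: doubleton_eq_iff * eq_commute[of "mk {_, _}" "mk {_}"])
qed simp

section \<open>Von Neumann ordinals as a well-ordered type\<close>

lemma Ord_mem: "Ord \<alpha> \<Longrightarrow> x \<in> elts \<alpha> \<Longrightarrow> Ord x"
  unfolding Ord_def by blast

lemma Ord_trans: "Ord \<alpha> \<Longrightarrow> x \<in> elts \<alpha> \<Longrightarrow> y \<in> elts x \<Longrightarrow> y \<in> elts \<alpha>"
  unfolding Ord_def by blast

text \<open>Nested membership induction: if neither ordinal is a member of the other, the two
  induction hypotheses give both inclusions.\<close>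

lemma Ord_linear: "Ord \<alpha> \<Longrightarrow> Ord \<beta> \<Longrightarrow> \<alpha> \<in> elts \<beta> \<or> \<alpha> = \<beta> \<or> \<beta> \<in> elts \<alpha>"
proof (induction \<alpha> arbitrary: \<beta> rule: mem_induct)
  case (1 \<alpha>)
  note outer = 1
  from \<open>Ord \<beta>\<close> show ?case
  proof (induction \<beta> rule: mem_induct)
    case (1 \<beta>)
    show ?case
    proof (rule ccontr)
      assume no: "\<not> ?case"
      have "x \<in> elts \<beta>" if "x \<in> elts \<alpha>" for x
        using outer(1)[OF that Ord_mem[OF outer(2) that] \<open>Ord \<beta>\<close>] no that Ord_trans[OF outer(2) that] by blast
      moreover have "x \<in> elts \<alpha>" if "x \<in> elts \<beta>" for x
        using 1(1)[OF that Ord_mem[OF 1(2) that]] no that Ord_trans[OF 1(2) that] by blast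
      ultimately have "\<alpha> = \<beta>" by (intro elts_eqI) blast
      with no show False by blast
    qed
  qed
qed

lemma Ord_subset_iff: "Ord \<alpha> \<Longrightarrow> Ord \<beta> \<Longrightarrow> elts \<alpha> \<subseteq> elts \<beta> \<longleftrightarrow> \<alpha> \<in> elts \<beta> \<or> \<alpha> = \<beta>"
  using Ord_linear[of \<alpha> \<beta>] mem_irrefl Ord_trans[of \<beta> \<alpha>] by blast

text \<open>The ordinals of the universe become a type of class \<open>wellorder\<close>, to which
  the abstract construction applies with \<kappa> as one of its elements.\<close>

typedef 'a ordinal = "{x :: 'a hset. Ord x}" morphisms hset_of Abs_ordinal
  by (rule exI[of _ zero]) (simp add: Ord_def elts_zero)

lemma Ord_hset_of: "Ord (hset_of a)" using hset_of by simp

lemma ex_hset_of: "Ord x \<Longrightarrow> \<exists>a. hset_of a = x" using Abs_ordinal_inverse by auto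

instantiation ordinal :: (type) wellorder
begin

definition less_eq_ordinal :: "'a ordinal \<Rightarrow> 'a ordinal \<Rightarrow> bool" where
  "a \<le> b \<longleftrightarrow> elts (hset_of a) \<subseteq> elts (hset_of b)"

definition less_ordinal :: "'a ordinal \<Rightarrow> 'a ordinal \<Rightarrow> bool" where
  "a < b \<longleftrightarrow> hset_of a \<in> elts (hset_of b)"

instance
proof
  fix a b c :: "'a ordinal"
  have le: "a \<le> b \<longleftrightarrow> a < b \<or> a = b" for a b :: "'a ordinal"
    unfolding less_eq_ordinal_def less_ordinal_def
    by (simp add: Ord_subset_iff[OF Ord_hset_of Ord_hset_of] hset_of_inject)
  show "a < b \<longleftrightarrow> a \<le> b \<and> \<not> b \<le> a"
    unfolding le using mem_irrefl mem_asym by (auto simp: less_ordinal_def)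
  show "a \<le> a" by (simp add: less_eq_ordinal_def)
  show "a \<le> b \<Longrightarrow> b \<le> c \<Longrightarrow> a \<le> c" by (simp add: less_eq_ordinal_def)
  show "a \<le> b \<Longrightarrow> b \<le> a \<Longrightarrow> a = b"
    by (simp add: less_eq_ordinal_def set_eq_subset[symmetric] elts_inject hset_of_inject)
  show "a \<le> b \<or> b \<le> a"
    unfolding le less_ordinal_def using Ord_linear[OF Ord_hset_of Ord_hset_of] hset_of_inject by blast
  fix P :: "'a ordinal \<Rightarrow> bool"
  assume step: "\<And>x. (\<And>y. y < x \<Longrightarrow> P y) \<Longrightarrow> P x"
  have "\<forall>a. hset_of a = x \<longrightarrow> P a" for x :: "'a hset"
  proof (induction x rule: mem_induct)
    case (1 x)
    then show ?case using step unfolding less_ordinal_def by blast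
  qed
  then show "P a" by blast
qed

end

lemma hset_of_image: "hset_of ` {..<a} = elts (hset_of a)"
proof
  show "elts (hset_of a) \<subseteq> hset_of ` {..<a}"
  proof
    fix x assume x: "x \<in> elts (hset_of a)"
    then obtain b where "hset_of b = x" using ex_hset_of[OF Ord_mem[OF Ord_hset_of x]] by blast
    with x show "x \<in> hset_of ` {..<a}" unfolding less_ordinal_def lessThan_def by blast
  qed
qed (auto simp: less_ordinal_def)

lemma mem_hset_ofE:
  assumes "x \<in> elts (hset_of a)" obtains b where "b < a" "x = hset_of b"
  using assms unfolding hset_of_image[symmetric] by auto

lemma hset_of_mem [simp]: "hset_of b \<in> elts (hset_of a) \<longleftrightarrow> b < a"
  by (simp add: less_ordinal_def)

lemma hset_of_subset [simp]: "elts (hset_of b) \<subseteq> elts (hset_of a) \<longleftrightarrow> b \<le> a"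
  by (simp add: less_eq_ordinal_def)

lemma hset_of_eq [simp]: "hset_of b = hset_of a \<longleftrightarrow> b = a"
  by (rule hset_of_inject)

lemma hset_of_mem_image [simp]: "hset_of b \<in> hset_of ` E \<longleftrightarrow> b \<in> E"
  by (auto simp: hset_of_inject)

lemma inj_hset_of: "inj_on hset_of A" by (simp add: inj_on_def)

lemma card_lessThan: "|{..<a}| =o |elts (hset_of a)|"
proof -
  have "bij_betw hset_of {..<a} (elts (hset_of a))"
    unfolding bij_betw_def using inj_hset_of hset_of_image by blast
  then show ?thesis by (rule card_of_ordIsoI)
qed

lemma card_lessThan_bound: "|{..<a :: 'a ordinal}| \<le>o |UNIV :: (nat + 'a) set|"
  using card_lessThan small_elts ordIso_ordLeq_trans by blast

lemma zero_mem_iff: "zero \<in> elts (hset_of (a :: 'a ordinal)) \<longleftrightarrow> (\<exists>b. b < a)"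
proof -
  have "Ord (zero :: 'a hset)" by (simp add: Ord_def elts_zero)
  then obtain z :: "'a ordinal" where z: "hset_of z = zero" using ex_hset_of by blast
  have "z \<le> b" for b by (simp add: less_eq_ordinal_def z elts_zero)
  then have "z < a \<longleftrightarrow> (\<exists>b. b < a)" using order.strict_trans1 by blast
  then show ?thesis by (simp add: z[symmetric])
qed

text \<open>\<open>osup\<close> is a union, and transitivity keeps it inside \<open>a\<close>.
  Equality therefore means that \<open>X\<close> is unbounded in \<open>a\<close> in the strict
  sense, which forces \<open>a\<close> to be zero or a limit.\<close>

lemma osup_eq_iff:
  assumes "X \<subseteq> elts (hset_of a)"
  shows "osup X = hset_of a \<longleftrightarrow> (\<forall>b<a. \<exists>c<a. hset_of c \<in> X \<and> b < c)"
proof -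
  have small: "small X" by (rule small_subset[OF assms small_elts])
  have "osup X = hset_of a \<longleftrightarrow> (\<Union>x\<in>X. elts x) = elts (hset_of a)"
    unfolding osup_def elts_inject[symmetric] by (simp add: elts_mk small_UN[OF small])
  also have "\<dots> \<longleftrightarrow> elts (hset_of a) \<subseteq> (\<Union>x\<in>X. elts x)"
    using assms Ord_trans[OF Ord_hset_of] by blast
  also have "\<dots> \<longleftrightarrow> (\<forall>b<a. \<exists>c<a. hset_of c \<in> X \<and> b < c)"
  proof
    assume L: "elts (hset_of a) \<subseteq> (\<Union>x\<in>X. elts x)"
    show "\<forall>b<a. \<exists>c<a. hset_of c \<in> X \<and> b < c"
    proof (intro allI impI)
      fix b assume "b < a"
      then have "hset_of b \<in> (\<Union>x\<in>X. elts x)" using L by (meson hset_of_mem subsetD)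
      then obtain x where x: "x \<in> X" "hset_of b \<in> elts x" by blast
      then obtain c where "c < a" "x = hset_of c" using assms mem_hset_ofE by blast
      with x show "\<exists>c<a. hset_of c \<in> X \<and> b < c" by auto
    qed
  next
    assume R: "\<forall>b<a. \<exists>c<a. hset_of c \<in> X \<and> b < c"
    show "elts (hset_of a) \<subseteq> (\<Union>x\<in>X. elts x)"
    proof
      fix x assume "x \<in> elts (hset_of a)"
      then obtain b where "b < a" "x = hset_of b" by (rule mem_hset_ofE)
      with R show "x \<in> (\<Union>x\<in>X. elts x)" by (metis UN_I hset_of_mem)
    qed
  qed
  finally show ?thesis .
qed

section \<open>Successors and natural numbers\<close>

lemma elts_succ: "elts (succ x) = insert x (elts x)"
  unfolding succ_def
proof (rule elts_mk)
  have "insert x (elts x) = (\<Union>y\<in>{x, mk {x}}. elts y)" by (auto simp: elts_mk small_finite)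
  then show "small (insert x (elts x))" using small_UN[OF small_finite, of "{x, mk {x}}" "\<lambda>x. x"] by simp
qed

lemma ord_of_nat_less: "m < n \<Longrightarrow> ord_of_nat m \<in> elts (ord_of_nat n)"
  by (induction n) (auto simp: elts_succ less_Suc_eq)

lemma inj_ord_of_nat: "inj ord_of_nat"
  by (rule linorder_injI) (metis ord_of_nat_less mem_irrefl)

lemma elts_omega: "elts (omega :: 'a hset) = range ord_of_nat"
  unfolding omega_def
proof (rule elts_mk, rule small_image)
  show "|UNIV :: nat set| \<le>o |UNIV :: (nat + 'a) set|"
    using card_of_ordLeq[of "UNIV :: nat set" "UNIV :: (nat + 'a) set"] inj_Inl by blast
qed

section \<open>Order types\<close>

text \<open>The Mostowski collapse of \<open>X\<close> under membership.\<close>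

function collapse :: "'a hset set \<Rightarrow> 'a hset \<Rightarrow> 'a hset" where
  "collapse X x = mk (collapse X ` (X \<inter> elts x))"
  by pat_completeness auto
termination
proof (relation "inv_image mem_rel snd")
qed (simp add: wf_mem, simp add: mem_rel_def)

declare collapse.simps [simp del]

lemma elts_collapse: "elts (collapse X x) = collapse X ` (X \<inter> elts x)"
  unfolding collapse.simps[of X x]
  by (rule elts_mk, rule small_image, rule small_subset[OF Int_lower2 small_elts])

context
  fixes X :: "'a hset set" and a :: "'a ordinal"
  assumes X: "X \<subseteq> elts (hset_of a)"
begin

lemma Ord_in_X: "x \<in> X \<Longrightarrow> Ord x"
  using X Ord_mem[OF Ord_hset_of] by blast

text \<open>The collapse preserves membership by construction; linearity of the ordinals gives the
  converse and injectivity.\<close>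

lemma collapse_mem_iff:
  assumes "x \<in> X" "y \<in> X"
  shows "collapse X x \<in> elts (collapse X y) \<longleftrightarrow> x \<in> elts y"
    and "collapse X x = collapse X y \<longleftrightarrow> x = y"
proof -
  have mono: "collapse X x \<in> elts (collapse X y)" if "x \<in> X" "x \<in> elts y" for x y
    using that by (auto simp: elts_collapse)
  show "collapse X x \<in> elts (collapse X y) \<longleftrightarrow> x \<in> elts y"
    using Ord_linear[OF Ord_in_X Ord_in_X, OF assms] mono[OF assms(1), of y] mono[OF assms(2), of x]
      mem_asym mem_irrefl by metis
  show "collapse X x = collapse X y \<longleftrightarrow> x = y"
    using Ord_linear[OF Ord_in_X Ord_in_X, OF assms] mono[OF assms(1), of y] mono[OF assms(2), of x]
      mem_irrefl by metis
qed

text \<open>The range of the collapse is an ordinal isomorphic to \<open>X\<close>. Any isomorphism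
  from an ordinal onto \<open>X\<close> is inverted by the collapse, by membership induction, so
  that ordinal equals the range and the description in \<open>otp\<close> is unique.\<close>

lemma elts_otp: "elts (otp X) = collapse X ` X"
proof -
  let ?iso = "\<lambda>\<alpha> f. bij_betw f (elts \<alpha>) X \<and>
    (\<forall>\<xi>\<in>elts \<alpha>. \<forall>\<eta>\<in>elts \<alpha>. \<xi> \<in> elts \<eta> \<longleftrightarrow> f \<xi> \<in> elts (f \<eta>))"
  define \<delta> where "\<delta> = mk (collapse X ` X)"
  have \<delta>: "elts \<delta> = collapse X ` X"
    unfolding \<delta>_def by (rule elts_mk, rule small_image, rule small_subset[OF X small_elts])
  have "Ord \<delta>"
    unfolding Ord_def \<delta>
  proof (intro conjI ballI)
    fix z assume "z \<in> collapse X ` X"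
    then obtain x where x: "x \<in> X" "z = collapse X x" by blast
    show "elts z \<subseteq> collapse X ` X" unfolding x(2) elts_collapse by blast
    fix v assume "v \<in> elts z"
    then obtain y where y: "y \<in> X" "y \<in> elts x" "v = collapse X y" unfolding x(2) elts_collapse by blast
    show "elts v \<subseteq> elts z"
      unfolding x(2) y(3) elts_collapse using Ord_trans[OF Ord_in_X[OF x(1)] y(2)] by blast
  qed
  moreover have "\<exists>f. ?iso \<delta> f"
  proof (intro exI conjI ballI)
    let ?f = "the_inv_into X (collapse X)"
    have bij: "bij_betw (collapse X) X (elts \<delta>)"
      unfolding bij_betw_def inj_on_def \<delta> using collapse_mem_iff(2) by blast
    then show "bij_betw ?f (elts \<delta>) X" by (rule bij_betw_the_inv_into)
    have inv: "?f (collapse X x) = x" if "x \<in> X" for x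
      using that by (rule the_inv_into_f_f[OF bij_betw_imp_inj_on[OF bij]])
    fix \<xi> \<eta> assume "\<xi> \<in> elts \<delta>" "\<eta> \<in> elts \<delta>"
    then obtain x y where "x \<in> X" "\<xi> = collapse X x" "y \<in> X" "\<eta> = collapse X y" unfolding \<delta> by blast
    then show "\<xi> \<in> elts \<eta> \<longleftrightarrow> ?f \<xi> \<in> elts (?f \<eta>)" using inv collapse_mem_iff(1) by simp
  qed
  moreover have "\<alpha> = \<delta>" if \<alpha>: "Ord \<alpha>" "?iso \<alpha> f" for \<alpha> f
  proof -
    have bij: "bij_betw f (elts \<alpha>) X" using \<alpha>(2) by blast
    have "\<xi> \<in> elts \<alpha> \<longrightarrow> collapse X (f \<xi>) = \<xi>" for \<xi>
    proof (induction \<xi> rule: mem_induct)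
      case (1 \<xi>)
      show ?case
      proof
        assume \<xi>: "\<xi> \<in> elts \<alpha>"
        have "X \<inter> elts (f \<xi>) = f ` elts \<xi>"
        proof (intro set_eqI iffI)
          fix x assume "x \<in> X \<inter> elts (f \<xi>)"
          then obtain \<eta> where \<eta>: "\<eta> \<in> elts \<alpha>" "x = f \<eta>" using bij unfolding bij_betw_def by blast
          then have "\<eta> \<in> elts \<xi>" using \<alpha>(2) \<xi> \<open>x \<in> X \<inter> elts (f \<xi>)\<close> by blast
          with \<eta> show "x \<in> f ` elts \<xi>" by blast
        next
          fix x assume "x \<in> f ` elts \<xi>"
          then obtain \<eta> where \<eta>: "\<eta> \<in> elts \<xi>" "x = f \<eta>" by blast
          then have "\<eta> \<in> elts \<alpha>" using Ord_trans[OF \<alpha>(1) \<xi>] by blast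
          then show "x \<in> X \<inter> elts (f \<xi>)" using \<alpha>(2) \<eta> \<xi> bij unfolding bij_betw_def by blast
        qed
        then have "elts (collapse X (f \<xi>)) = (\<lambda>\<eta>. collapse X (f \<eta>)) ` elts \<xi>"
          by (simp add: elts_collapse image_image)
        also have "\<dots> = elts \<xi>" using 1 Ord_trans[OF \<alpha>(1) \<xi>] by simp
        finally show "collapse X (f \<xi>) = \<xi>" by (rule elts_eqI)
      qed
    qed
    then have "elts \<alpha> = collapse X ` (f ` elts \<alpha>)" by (simp add: image_image)
    also have "\<dots> = elts \<delta>" using bij unfolding \<delta> bij_betw_def by simp
    finally show ?thesis by (rule elts_eqI)
  qed
  ultimately have "otp X = \<delta>" unfolding otp_def by (intro the_equality) blast+
  then show ?thesis using \<delta> by simp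
qed

end

lemma ord_of_nat_1: "elts (ord_of_nat (Suc 0)) = {zero}"
  by (simp add: elts_succ elts_zero)

text \<open>Counting starts at 0: in the part of \<open>E\<close> from \<gamma> on, the element of
  index 0 is \<gamma> itself and that of index 1 is the next point \<beta>. Thus the guessing clause
  for n = 1 speaks about \<beta> alone.\<close>

lemma succ_n_1:
  fixes E :: "'a ordinal set"
  assumes E: "E \<subseteq> {..<a}" and nx: "next_in E \<gamma> \<beta>"
  shows "succ_n 1 (hset_of ` E - elts (hset_of \<gamma>)) = {hset_of \<beta>}"
proof -
  define X where "X = hset_of ` E - elts (hset_of \<gamma>)"
  have mem: "hset_of b \<in> X \<longleftrightarrow> b \<in> E \<and> \<gamma> \<le> b" for b
    unfolding X_def by (auto simp: not_less)
  have X: "X \<subseteq> elts (hset_of a)" unfolding X_def hset_of_image[symmetric] using E by blast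
  have \<gamma>\<beta>: "\<gamma> \<in> E" "\<beta> \<in> E" "\<gamma> < \<beta>" "\<And>\<eta>. \<lbrakk>\<eta> \<in> E; \<eta> < \<beta>\<rbrakk> \<Longrightarrow> \<eta> \<le> \<gamma>"
    using nx unfolding next_in_def by auto
  have below: "X \<inter> elts (hset_of b) = hset_of ` {c \<in> E. \<gamma> \<le> c \<and> c < b}" for b
    unfolding X_def by (auto simp: not_less)
  have "{c \<in> E. \<gamma> \<le> c \<and> c < \<gamma>} = {}" by auto
  then have \<gamma>0: "X \<inter> elts (hset_of \<gamma>) = {}" unfolding below by simp
  have "{c \<in> E. \<gamma> \<le> c \<and> c < \<beta>} = {\<gamma>}" using \<gamma>\<beta> by (auto intro: order.antisym)
  then have \<beta>1: "X \<inter> elts (hset_of \<beta>) = {hset_of \<gamma>}" unfolding below by simp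
  \<comment> \<open>Stated for all subsets because \<open>nth_elt\<close> collapses an initial part
    of \<open>X\<close> and not \<open>X\<close> itself.\<close>
  have c\<gamma>: "collapse Y (hset_of \<gamma>) = zero" if "Y \<subseteq> X" for Y
    by (rule elts_eqI) (use that \<gamma>0 in \<open>auto simp: elts_collapse elts_zero\<close>)
  have "elts (collapse X (hset_of \<beta>)) = {zero}"
    unfolding elts_collapse \<beta>1 by (simp add: c\<gamma>)
  then have "collapse X (hset_of \<beta>) = ord_of_nat (Suc 0)" by (intro elts_eqI) (simp only: ord_of_nat_1)
  then have one: "ord_of_nat (Suc 0) \<in> elts (otp X)"
    unfolding elts_otp[OF X] using mem \<gamma>\<beta>(2,3) by (metis imageI order.strict_implies_order)
  have "nth_elt X (ord_of_nat (Suc 0)) = hset_of \<beta>"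
    unfolding nth_elt_def
  proof (rule the_equality)
    have "elts (otp (X \<inter> elts (hset_of \<beta>))) = {zero}"
      unfolding elts_otp[OF order.trans[OF Int_lower1 X]] unfolding \<beta>1 using mem \<gamma>\<beta>(1) by (simp add: c\<gamma>)
    then have "otp (X \<inter> elts (hset_of \<beta>)) = ord_of_nat (Suc 0)" by (intro elts_eqI) (simp only: ord_of_nat_1)
    then show "hset_of \<beta> \<in> X \<and> otp (X \<inter> elts (hset_of \<beta>)) = ord_of_nat (Suc 0)"
      using mem \<gamma>\<beta>(2,3) by simp
  next
    fix x assume x: "x \<in> X \<and> otp (X \<inter> elts x) = ord_of_nat (Suc 0)"
    then obtain b where b: "x = hset_of b" using X mem_hset_ofE by blast
    let ?Y = "X \<inter> elts x"
    have Y: "?Y \<subseteq> elts (hset_of a)" using X by blast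
    \<comment> \<open>Order type 1 forces \<open>?Y\<close> to be a singleton. This leaves no room
      for \<open>x\<close> beyond \<beta>, where both \<gamma> and \<beta> would precede it.\<close>
    have "collapse ?Y ` ?Y = {zero}" using x elts_otp[OF Y] ord_of_nat_1 by metis
    then have single: "u = v" if "u \<in> ?Y" "v \<in> ?Y" for u v
      using collapse_mem_iff(2)[OF Y that] that by (metis imageI singletonD)
    have nonempty: "?Y \<noteq> {}" using \<open>collapse ?Y ` ?Y = {zero}\<close> by auto
    have bE: "b \<in> E" "\<gamma> \<le> b" using x mem unfolding b by auto
    have "b \<noteq> \<gamma>" using nonempty \<gamma>0 unfolding b by auto
    then have "\<gamma> < b" using bE(2) by simp
    then have "\<not> b < \<beta>" using \<gamma>\<beta>(4)[OF bE(1)] by auto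
    moreover have "\<not> \<beta> < b"
    proof
      assume "\<beta> < b"
      then have "hset_of \<beta> \<in> ?Y" "hset_of \<gamma> \<in> ?Y" using mem \<gamma>\<beta> \<open>\<gamma> < b\<close> unfolding b by auto
      then have "hset_of \<beta> = hset_of \<gamma>" by (rule single)
      then show False using \<gamma>\<beta>(3) by simp
    qed
    ultimately show "x = hset_of \<beta>" unfolding b by simp
  qed
  then have "succ_n 1 X = {hset_of \<beta>}"
    unfolding succ_n_def using one by (auto simp: less_Suc_eq)
  then show ?thesis unfolding X_def .
qed

section \<open>Cofinality\<close>

lemma cf_props:
  assumes "Ord \<alpha>"
  shows "Ord (cf \<alpha>)" "has_cofinal_map (cf \<alpha>) \<alpha>" "\<gamma> \<in> elts (cf \<alpha>) \<Longrightarrow> \<not> has_cofinal_map \<gamma> \<alpha>"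
proof -
  let ?P = "\<lambda>\<beta>. Ord \<beta> \<and> has_cofinal_map \<beta> \<alpha> \<and> (\<forall>\<gamma>\<in>elts \<beta>. \<not> has_cofinal_map \<gamma> \<alpha>)"
  have triv: "has_cofinal_map \<alpha> \<alpha>"
    unfolding has_cofinal_map_def by (rule exI[of _ "\<lambda>x. x"]) auto
  have "has_cofinal_map \<beta> \<alpha> \<Longrightarrow> Ord \<beta> \<Longrightarrow> \<exists>\<beta>. ?P \<beta>" for \<beta>
  proof (induction \<beta> rule: mem_induct)
    case (1 \<beta>)
    then show ?case using Ord_mem by blast
  qed
  then obtain \<beta> where \<beta>: "?P \<beta>" using triv assms by blast
  have "cf \<alpha> = \<beta>" unfolding cf_def
  proof (rule the_equality[of ?P, OF \<beta>])
    fix \<beta>' assume "?P \<beta>'"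
    with \<beta> show "\<beta>' = \<beta>" using Ord_linear[of \<beta> \<beta>'] by blast
  qed
  with \<beta> show "Ord (cf \<alpha>)" "has_cofinal_map (cf \<alpha>) \<alpha>" "\<gamma> \<in> elts (cf \<alpha>) \<Longrightarrow> \<not> has_cofinal_map \<gamma> \<alpha>"
    by blast+
qed

lemma has_cofinal_mapI:
  fixes a b :: "'a ordinal"
  assumes "\<And>\<xi>. \<xi> < a \<Longrightarrow> \<exists>\<zeta><b. f \<zeta> < a \<and> \<xi> \<le> f \<zeta>" and "z < a"
  shows "has_cofinal_map (hset_of b) (hset_of a)"
proof -
  \<comment> \<open>\<open>has_cofinal_map\<close> demands values in \<open>a\<close>; the default
    \<open>z\<close> replaces values of \<open>f\<close> outside it.\<close>
  define F where "F x = (let y = f (Abs_ordinal x) in hset_of (if y < a then y else z))" for x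
  have F: "F (hset_of \<zeta>) = hset_of (if f \<zeta> < a then f \<zeta> else z)" for \<zeta>
    by (simp add: F_def hset_of_inverse)
  show ?thesis unfolding has_cofinal_map_def
  proof (intro exI[of _ F] conjI ballI)
    show "F ` elts (hset_of b) \<subseteq> elts (hset_of a)"
      unfolding hset_of_image[symmetric] using assms(2) by (auto simp: F image_image)
    fix x assume "x \<in> elts (hset_of a)"
    then obtain \<xi> where \<xi>: "\<xi> < a" "x = hset_of \<xi>" by (rule mem_hset_ofE)
    then obtain \<zeta> where "\<zeta> < b" "f \<zeta> < a" "\<xi> \<le> f \<zeta>" using assms(1) by blast
    then show "\<exists>\<eta>\<in>elts (hset_of b). elts x \<subseteq> elts (F \<eta>)"
      by (intro bexI[of _ "hset_of \<zeta>"]) (simp_all add: F \<xi>(2))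
  qed
qed

lemma has_cofinal_mapD:
  fixes a b :: "'a ordinal"
  assumes "has_cofinal_map (hset_of b) (hset_of a)"
  shows "\<exists>f. \<forall>\<xi><a. \<exists>\<zeta><b. f \<zeta> < a \<and> \<xi> \<le> f \<zeta>"
proof -
  obtain F where F: "F ` elts (hset_of b) \<subseteq> elts (hset_of a)"
    "\<forall>x\<in>elts (hset_of a). \<exists>y\<in>elts (hset_of b). elts x \<subseteq> elts (F y)"
    using assms unfolding has_cofinal_map_def by blast
  show ?thesis
  proof (intro exI[of _ "\<lambda>\<zeta>. Abs_ordinal (F (hset_of \<zeta>))"] allI impI)
    fix \<xi> assume "\<xi> < a"
    then obtain y where y: "y \<in> elts (hset_of b)" "elts (hset_of \<xi>) \<subseteq> elts (F y)" 
      using bspec[OF F(2), of "hset_of \<xi>"] by auto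
    obtain \<zeta> where \<zeta>: "\<zeta> < b" "y = hset_of \<zeta>" using y(1) by (rule mem_hset_ofE)
    obtain c where c: "c < a" "F y = hset_of c" using F(1) y(1) mem_hset_ofE by blast
    then show "\<exists>\<zeta><b. Abs_ordinal (F (hset_of \<zeta>)) < a \<and> \<xi> \<le> Abs_ordinal (F (hset_of \<zeta>))"
      using \<zeta> y(2) by (intro exI[of _ \<zeta>]) (simp add: hset_of_inverse)
  qed
qed

lemma cf_mem_imp_small_cof:
  "cf (hset_of a) \<in> elts (hset_of x) \<Longrightarrow> small_cof x a"
proof -
  assume *: "cf (hset_of a) \<in> elts (hset_of x)"
  then obtain b where "b < x" "cf (hset_of a) = hset_of b" by (rule mem_hset_ofE)
  then show ?thesis
    using has_cofinal_mapD[of b a] cf_props(2)[OF Ord_hset_of, of a] unfolding small_cof_def by auto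
qed

lemma cf_ge_imp_not_small_cof:
  assumes "elts (hset_of x) \<subseteq> elts (cf (hset_of a))" shows "\<not> small_cof x a"
proof
  assume "small_cof x a"
  then obtain b f where b: "b < x" "\<forall>\<xi><a. \<exists>\<zeta><b. f \<zeta> < a \<and> \<xi> \<le> f \<zeta>"
    unfolding small_cof_def by blast
  have mem: "hset_of b \<in> elts (cf (hset_of a))" using assms b(1) by (meson hset_of_mem subsetD)
  then have no: "\<not> has_cofinal_map (hset_of b) (hset_of a)" by (rule cf_props(3)[OF Ord_hset_of])
  show False
  proof (cases "\<exists>z. z < a")
    case True
    then show ?thesis using has_cofinal_mapI[of a b f] b(2) no by blast
  next
    case False
    \<comment> \<open>At zero no default value below \<open>a\<close> exists, but the empty map is
      already cofinal, against the nonzero cofinality assumed.\<close>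
    then have "elts (hset_of a) = {}" using mem_hset_ofE by blast
    then have "has_cofinal_map zero (hset_of a)" unfolding has_cofinal_map_def by (simp add: elts_zero)
    moreover have "zero \<in> elts (cf (hset_of a))"
      using mem zero_mem_iff ex_hset_of[OF cf_props(1)[OF Ord_hset_of]] by (metis mem_hset_ofE)
    ultimately show False using cf_props(3)[OF Ord_hset_of] by blast
  qed
qed

section \<open>Coding maps on ordinals as sets\<close>

text \<open>The graph of \<open>m\<close>. It is a genuine set of pairs only if the domain is within
  the size bound of the universe, hence the premises \<open>small_dom\<close> below.\<close>

definition enc :: "('a ordinal \<rightharpoonup> 'a ordinal) \<Rightarrow> 'a hset" where
  "enc m = mk {pair (hset_of x) (hset_of y) |x y. m x = Some y}"

abbreviation small_dom :: "('a ordinal \<rightharpoonup> 'a ordinal) \<Rightarrow> bool" where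
  "small_dom (m :: 'a ordinal \<rightharpoonup> 'a ordinal) \<equiv> |dom m| \<le>o |UNIV :: (nat + 'a) set|"

lemma small_dom_lessThan: "dom m = {..<a} \<Longrightarrow> small_dom m"
  by (simp add: card_lessThan_bound)

lemma elts_enc:
  assumes "small_dom m"
  shows "elts (enc m) = {pair (hset_of x) (hset_of y) |x y. m x = Some y}"
proof -
  have "{pair (hset_of x) (hset_of y) |x y. m x = Some y} =
    (\<lambda>x. pair (hset_of x) (hset_of (the (m x)))) ` dom m" by force
  then show ?thesis unfolding enc_def using small_image[OF assms] by (intro elts_mk) simp
qed

lemma pair_mem_enc:
  assumes "small_dom m"
  shows "pair x y \<in> elts (enc m) \<longleftrightarrow> (\<exists>a b. x = hset_of a \<and> y = hset_of b \<and> m a = Some b)"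
  unfolding elts_enc[OF assms] by (auto simp: pair_inject)

lemma enc_subset:
  assumes "small_dom s" "small_dom t"
  shows "elts (enc s) \<subseteq> elts (enc t) \<longleftrightarrow> s \<subseteq>\<^sub>m t"
proof
  assume L: "elts (enc s) \<subseteq> elts (enc t)"
  show "s \<subseteq>\<^sub>m t" unfolding map_le_def
  proof
    fix a assume "a \<in> dom s"
    then obtain b where b: "s a = Some b" by blast
    then have "pair (hset_of a) (hset_of b) \<in> elts (enc t)"
      using L pair_mem_enc[OF assms(1)] by blast
    then show "s a = t a" using b pair_mem_enc[OF assms(2)] by auto
  qed
next
  assume R: "s \<subseteq>\<^sub>m t"
  have "t x = Some y" if "s x = Some y" for x y
    using R that unfolding map_le_def by (metis domI)
  then show "elts (enc s) \<subseteq> elts (enc t)" unfolding elts_enc[OF assms(1)] elts_enc[OF assms(2)] by blast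
qed

lemma enc_inject:
  assumes "small_dom s" "small_dom t" shows "enc s = enc t \<longleftrightarrow> s = t"
  using enc_subset[OF assms] enc_subset[OF assms(2,1)] map_le_antisym by (metis order.refl)

lemma enc_psubset:
  assumes "small_dom s" "small_dom t"
  shows "elts (enc s) \<subset> elts (enc t) \<longleftrightarrow> s \<subseteq>\<^sub>m t \<and> s \<noteq> t"
  using enc_subset[OF assms] enc_inject[OF assms] by (simp add: psubset_eq elts_inject)

lemma is_fun_enc: "small_dom m \<Longrightarrow> is_fun (enc m)"
  unfolding is_fun_def pair_mem_enc by (auto simp: elts_enc)

lemma fdom_enc: "small_dom m \<Longrightarrow> fdom (enc m) = hset_of ` dom m"
  unfolding fdom_def by (auto simp: pair_mem_enc)

lemma fran_enc: "small_dom m \<Longrightarrow> fran (enc m) = hset_of ` ran m"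
  unfolding fran_def ran_def by (auto simp: pair_mem_enc)

lemma restr_enc:
  assumes "small_dom m" shows "restr (enc m) (hset_of ` X) = enc (m |` X)"
proof -
  have sub: "small_dom (m |` X)"
    by (rule ordLeq_transitive[OF card_of_mono1 assms]) auto
  have "{z \<in> elts (enc m). \<exists>x\<in>hset_of ` X. \<exists>y. z = pair x y} = elts (enc (m |` X))"
    unfolding elts_enc[OF assms] elts_enc[OF sub]
    by (auto simp: pair_inject restrict_map_def split: if_splits)
  then show ?thesis unfolding restr_def by (simp add: mk_elts)
qed

lemma graft_enc:
  assumes "small_dom x" "small_dom y" "small_dom (y ++ x)"
  shows "graft (enc x) (enc y) = enc (y ++ x)"
proof -
  let ?X = "dom y - dom x"
  have eq: "fdom (enc y) - fdom (enc x) = hset_of ` ?X"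
    unfolding fdom_enc[OF assms(1)] fdom_enc[OF assms(2)] by (rule image_set_diff[symmetric, OF inj_hset_of])
  have sub: "small_dom (y |` ?X)"
    by (rule ordLeq_transitive[OF card_of_mono1 assms(2)]) auto
  have "elts (enc x) \<union> elts (enc (y |` ?X)) = elts (enc (y ++ x))"
    unfolding elts_enc[OF assms(1)] elts_enc[OF assms(3)] elts_enc[OF sub]
    by (auto simp: map_add_Some_iff restrict_map_def dom_def split: if_splits)
  then show ?thesis unfolding graft_def eq restr_enc[OF assms(2)] by (simp add: mk_elts)
qed

lemma append_val_enc:
  assumes "small_dom t" "a \<notin> dom t" "small_dom (t(a \<mapsto> i))"
  shows "append_val (hset_of a) (enc t) (hset_of i) = enc (t(a \<mapsto> i))"
proof -
  have "insert (pair (hset_of a) (hset_of i)) (elts (enc t)) = elts (enc (t(a \<mapsto> i)))"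
    unfolding elts_enc[OF assms(1)] elts_enc[OF assms(3)] using assms(2) by (auto split: if_splits)
  then show ?thesis unfolding append_val_def by (simp add: mk_elts)
qed

section \<open>The coded tree\<close>

text \<open>An ordinal is transitive, so it absorbs the transitive closure of each of its subsets.
  This bounds the hereditary cardinality of ordinals and of sets of ordinals.\<close>

lemma trcl_set_subset:
  assumes "Ord \<alpha>" "elts x \<subseteq> elts \<alpha>" shows "trcl_set x \<subseteq> elts \<alpha>"
proof
  fix y assume "y \<in> trcl_set x"
  then have "(y, x) \<in> mem_rel\<^sup>+" unfolding trcl_set_def by simp
  then show "y \<in> elts \<alpha>"
  proof (induction rule: converse_trancl_induct)
    case (base y)
    then show ?case using assms(2) by (auto simp: mem_rel_def)
  next
    case (step y z)
    then show ?case using Ord_trans[OF assms(1)] by (auto simp: mem_rel_def)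
  qed
qed

locale ordinal_proxy = proxy \<kappa> \<chi> w Cs idx
  for \<kappa> \<chi> :: "'a ordinal" and w Cs idx
begin

abbreviation K :: "'a hset" where "K \<equiv> hset_of \<kappa>"

definition ctree :: "'a hset set" where "ctree = enc ` tree"

lemma ordinal_in_H: "a < \<kappa> \<Longrightarrow> hset_of a \<in> hered_lt |elts K|"
proof -
  assume "a < \<kappa>"
  then have "|{..<a}| <o |{..<\<kappa>}|" by (rule initial)
  then have "|elts (hset_of a)| <o |elts K|"
    using card_lessThan ordIso_symmetric ordIso_ordLess_trans ordLess_ordIso_trans by metis
  moreover have "|trcl_set (hset_of a)| \<le>o |elts (hset_of a)|"
    by (rule card_of_mono1[OF trcl_set_subset[OF Ord_hset_of order.refl]])
  ultimately show ?thesis unfolding hered_lt_def using ordLeq_ordLess_trans by blast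
qed

lemma small_dom_Lev: "\<alpha> < \<kappa> \<Longrightarrow> t \<in> Lev \<alpha> \<Longrightarrow> small_dom t"
  by (rule small_dom_lessThan[OF Lev_dom])

lemma small_dom_tree: "t \<in> tree \<Longrightarrow> small_dom t"
  unfolding tree_def using small_dom_Lev by auto

lemma enc_in_seqs: "\<alpha> < \<kappa> \<Longrightarrow> t \<in> Lev \<alpha> \<Longrightarrow> enc t \<in> seqs (hset_of \<alpha>) (H K)"
  unfolding seqs_def
  using is_fun_enc[OF small_dom_Lev] fdom_enc[OF small_dom_Lev, of \<alpha> t] fran_enc[OF small_dom_Lev, of \<alpha> t]
    Lev_dom[of \<alpha> t] Lev_ran[of \<alpha> t] ordinal_in_H hset_of_image[of \<alpha>] by auto

lemma level_ctree:
  assumes "\<alpha> < \<kappa>" shows "level K ctree (hset_of \<alpha>) = enc ` Lev \<alpha>"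
proof
  show "enc ` Lev \<alpha> \<subseteq> level K ctree (hset_of \<alpha>)"
    using assms enc_in_seqs unfolding level_def ctree_def tree_def by auto
  show "level K ctree (hset_of \<alpha>) \<subseteq> enc ` Lev \<alpha>"
  proof
    fix z assume "z \<in> level K ctree (hset_of \<alpha>)"
    then obtain t \<beta> where t: "z = enc t" "\<beta> < \<kappa>" "t \<in> Lev \<beta>" "fdom z = elts (hset_of \<alpha>)"
      unfolding level_def ctree_def tree_def seqs_def by blast
    have "fdom z = elts (hset_of \<beta>)"
      using enc_in_seqs[OF t(2,3)] unfolding t(1) seqs_def by simp
    then have "\<beta> = \<alpha>" using t(4) by (simp add: elts_inject)
    then show "z \<in> enc ` Lev \<alpha>" using t by simp
  qed
qed

lemma Lev_restrict_any:
  assumes "\<beta> < \<kappa>" "t \<in> Lev \<beta>" shows "\<exists>\<gamma><\<kappa>. t |` {..<\<alpha>} \<in> Lev \<gamma>"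
proof (cases "\<alpha> \<le> \<beta>")
  case True
  then show ?thesis using Lev_restrict[OF assms True] assms(1) by (intro exI[of _ \<alpha>]) simp
next
  case False
  then have "t |` {..<\<alpha>} = t" using Lev_dom[OF assms] by (intro restrict_dom_superset) auto
  then show ?thesis using assms by auto
qed

lemma streamlined_ctree: "streamlined_tree K ctree"
  unfolding streamlined_tree_def
proof (intro conjI ballI)
  show "ctree \<subseteq> seqs_below K (H K)"
    unfolding ctree_def tree_def seqs_below_def using enc_in_seqs hset_of_mem by blast
  fix z x assume "z \<in> ctree" "x \<in> elts K"
  then obtain t \<beta> \<alpha> where t: "z = enc t" "\<beta> < \<kappa>" "t \<in> Lev \<beta>" "x = hset_of \<alpha>"
    unfolding ctree_def tree_def using mem_hset_ofE by (metis (no_types, lifting) UN_E imageE lessThan_iff)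
  have "restr z (elts x) = enc (t |` {..<\<alpha>})"
    unfolding t(1,4) hset_of_image[symmetric] by (rule restr_enc[OF small_dom_Lev[OF t(2,3)]])
  then show "restr z (elts x) \<in> ctree"
    using Lev_restrict_any[OF t(2,3), of \<alpha>] unfolding ctree_def tree_def by auto
qed

section \<open>Height and the Souslin property\<close>

lemma height_ctree: "tree_height K ctree = K"
  unfolding tree_height_def
proof (rule the_equality)
  have "z \<notin> level K ctree K" for z
  proof
    assume z: "z \<in> level K ctree K"
    then obtain t \<beta> where t: "z = enc t" "\<beta> < \<kappa>" "t \<in> Lev \<beta>"
      unfolding level_def ctree_def tree_def by blast
    have "fdom z = elts (hset_of \<beta>)" using enc_in_seqs[OF t(2,3)] unfolding t(1) seqs_def by simp
    then show False using z t(2) unfolding level_def seqs_def by (simp add: elts_inject)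
  qed
  moreover have "level K ctree x \<noteq> {}" if "x \<in> elts K" for x
    using that Lev_nonempty by (elim mem_hset_ofE) (simp add: level_ctree)
  ultimately show top: "Ord K \<and> level K ctree K = {} \<and> (\<forall>\<beta>\<in>elts K. level K ctree \<beta> \<noteq> {})"
    using Ord_hset_of by blast
  fix \<alpha> assume "Ord \<alpha> \<and> level K ctree \<alpha> = {} \<and> (\<forall>\<beta>\<in>elts \<alpha>. level K ctree \<beta> \<noteq> {})"
  then show "\<alpha> = K" using top Ord_linear[of \<alpha> K] by blast
qed

lemma card_K: "|X| <o |{..<\<kappa>}| \<Longrightarrow> |X| <o |elts K|"
  using card_lessThan ordLess_ordIso_trans by blast

text \<open>Inclusion of graphs is extension of maps, so chains and antichains pull back along
  \<open>enc\<close> to those bounded by \<open>chain_card\<close> and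
  \<open>antichain_card\<close>.\<close>

lemma souslin_ctree: "souslin_tree K ctree"
  unfolding souslin_tree_def
proof (intro conjI ballI streamlined_ctree height_ctree notI)
  fix x assume "x \<in> elts K"
  then obtain \<alpha> where "\<alpha> < \<kappa>" "x = hset_of \<alpha>" by (rule mem_hset_ofE)
  then show "|level K ctree x| <o |elts K|"
    using ordLeq_ordLess_trans[OF card_of_image card_K[OF Lev_card]] by (simp add: level_ctree)
next
  assume "\<exists>b. tree_branch ctree b \<and> |b| =o |elts K|"
  then obtain b where b: "tree_chain ctree b" "|b| =o |elts K|" unfolding tree_branch_def by blast
  then obtain c where c: "c \<subseteq> tree" "b = enc ` c"
    unfolding tree_chain_def ctree_def by (metis subset_imageE)
  have "|c| <o |{..<\<kappa>}|"
  proof (rule chain_card[OF c(1)])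
    fix s t assume st: "s \<in> c" "t \<in> c"
    then have sd: "small_dom s" "small_dom t" using c(1) small_dom_tree by blast+
    have "enc s = enc t \<or> elts (enc s) \<subset> elts (enc t) \<or> elts (enc t) \<subset> elts (enc s)"
      using b(1) st unfolding tree_chain_def c(2) by blast
    then show "s \<subseteq>\<^sub>m t \<or> t \<subseteq>\<^sub>m s"
      using enc_inject[OF sd] enc_psubset[OF sd] enc_psubset[OF sd(2,1)] by auto
  qed
  then have "|b| <o |elts K|" unfolding c(2) by (rule ordLeq_ordLess_trans[OF card_of_image card_K])
  then show False using b(2) not_ordLess_ordIso by blast
next
  assume "\<exists>A. tree_antichain ctree A \<and> |A| =o |elts K|"
  then obtain A where A: "tree_antichain ctree A" "|A| =o |elts K|" by blast
  then obtain c where c: "c \<subseteq> tree" "A = enc ` c"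
    unfolding tree_antichain_def ctree_def by (metis subset_imageE)
  have "|c| <o |{..<\<kappa>}|"
  proof (rule antichain_card[OF c(1)])
    fix s t assume st: "s \<in> c" "t \<in> c" "s \<subseteq>\<^sub>m t"
    then have sd: "small_dom s" "small_dom t" using c(1) small_dom_tree by blast+
    have "\<not> elts (enc s) \<subset> elts (enc t)" using A(1) st unfolding tree_antichain_def c(2) by blast
    then show "s = t" using enc_psubset[OF sd] st(3) by blast
  qed
  then have "|A| <o |elts K|" unfolding c(2) by (rule ordLeq_ordLess_trans[OF card_of_image card_K])
  then show False using A(2) not_ordLess_ordIso by blast
qed

section \<open>Normality, splitting, completeness and homogeneity\<close>

lemma normal_ctree: "normal_tree K ctree"
  unfolding normal_tree_def
proof (intro ballI impI)
  fix x y z assume "y \<in> elts K" "x \<in> elts y" and z: "z \<in> level K ctree x"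
  then obtain \<beta> where \<beta>: "\<beta> < \<kappa>" "y = hset_of \<beta>" using mem_hset_ofE by blast
  then obtain \<alpha> where \<alpha>: "\<alpha> < \<beta>" "x = hset_of \<alpha>" using \<open>x \<in> elts y\<close> mem_hset_ofE by blast
  have \<alpha>\<kappa>: "\<alpha> < \<kappa>" using \<alpha>(1) \<beta>(1) by simp
  obtain s where s: "z = enc s" "s \<in> Lev \<alpha>" using z unfolding \<alpha>(2) level_ctree[OF \<alpha>\<kappa>] by blast
  obtain t where t: "t \<in> Lev \<beta>" "s \<subseteq>\<^sub>m t"
    using Lev_extend[OF s(2) order.strict_implies_order[OF \<alpha>(1)] \<beta>(1)] by blast
  have "s \<noteq> t" using Lev_dom[OF \<alpha>\<kappa> s(2)] Lev_dom[OF \<beta>(1) t(1)] \<alpha>(1) by (metis lessThan_eq_iff order.irrefl)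
  then have "elts z \<subset> elts (enc t)"
    unfolding s(1) using enc_psubset[OF small_dom_Lev[OF \<alpha>\<kappa> s(2)] small_dom_Lev[OF \<beta>(1) t(1)]] t(2) by blast
  then show "\<exists>t\<in>level K ctree y. elts z \<subset> elts t"
    unfolding \<beta>(2) level_ctree[OF \<beta>(1)] using t(1) by blast
qed

lemma append_in_level:
  assumes "\<alpha> < \<kappa>" "t \<in> Lev \<alpha>" "i < w \<alpha>"
  shows "append_val (hset_of \<alpha>) (enc t) (hset_of i) = enc (t(\<alpha> \<mapsto> i))"
    and "\<exists>\<beta><\<kappa>. hset_of \<beta> = succ (hset_of \<alpha>) \<and> is_succ \<alpha> \<beta> \<and> t(\<alpha> \<mapsto> i) \<in> Lev \<beta>"
proof -
  obtain \<beta> where \<beta>: "\<beta> < \<kappa>" "is_succ \<alpha> \<beta>" using ex_succ[OF assms(1)] by blast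
  have L: "t(\<alpha> \<mapsto> i) \<in> Lev \<beta>" unfolding Lev_succ[OF \<beta>] using assms(2,3) by blast
  show "append_val (hset_of \<alpha>) (enc t) (hset_of i) = enc (t(\<alpha> \<mapsto> i))"
    by (rule append_val_enc[OF small_dom_Lev[OF assms(1,2)] _ small_dom_Lev[OF \<beta>(1) L]])
      (simp add: Lev_dom[OF assms(1,2)])
  have "{..<\<beta>} = insert \<alpha> {..<\<alpha>}"
    using is_succ_iff[OF \<beta>(2)] by (auto simp: order.order_iff_strict)
  then have "hset_of \<beta> = succ (hset_of \<alpha>)"
    by (intro elts_eqI) (simp add: elts_succ hset_of_image[symmetric])
  with \<beta> L show "\<exists>\<beta><\<kappa>. hset_of \<beta> = succ (hset_of \<alpha>) \<and> is_succ \<alpha> \<beta> \<and> t(\<alpha> \<mapsto> i) \<in> Lev \<beta>" by blast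
qed

lemma prolific_ctree:
  assumes "\<And>\<alpha>. \<alpha> < \<kappa> \<Longrightarrow> elts (omax omega (hset_of \<alpha>)) \<subseteq> elts (hset_of (w \<alpha>))"
  shows "prolific_tree K ctree"
  unfolding prolific_tree_def
proof (intro ballI subsetI)
  fix x z v assume "x \<in> elts K" and z: "z \<in> level K ctree x"
    and v: "v \<in> {append_val x z i |i. i \<in> elts (omax omega x)}"
  then obtain \<alpha> where \<alpha>: "\<alpha> < \<kappa>" "x = hset_of \<alpha>" using mem_hset_ofE by blast
  obtain t where t: "z = enc t" "t \<in> Lev \<alpha>" using z unfolding \<alpha>(2) level_ctree[OF \<alpha>(1)] by blast
  obtain y where y: "v = append_val x z y" "y \<in> elts (omax omega x)" using v by blast
  then have "y \<in> elts (hset_of (w \<alpha>))" using assms[OF \<alpha>(1)] unfolding \<alpha>(2) by blast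
  then obtain i where i: "i < w \<alpha>" "y = hset_of i" by (rule mem_hset_ofE)
  note app = append_in_level[OF \<alpha>(1) t(2) i(1)]
  obtain \<beta> where \<beta>: "\<beta> < \<kappa>" "hset_of \<beta> = succ (hset_of \<alpha>)" "t(\<alpha> \<mapsto> i) \<in> Lev \<beta>" using app(2) by blast
  have "v = enc (t(\<alpha> \<mapsto> i))" unfolding y(1) \<alpha>(2) t(1) i(2) by (rule app(1))
  then show "v \<in> level K ctree (succ x)"
    unfolding \<alpha>(2) \<beta>(2)[symmetric] level_ctree[OF \<beta>(1)] using \<beta>(3) by blast
qed

text \<open>Appending different values gives different nodes, and nothing lies strictly between
  \<open>t\<close> and a map whose domain has just one more point.\<close>

lemma splitting_ctree:
  assumes "\<And>\<alpha>. \<alpha> < \<kappa> \<Longrightarrow> elts \<sigma> \<subseteq> elts (hset_of (w \<alpha>))"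
  shows "splitting_tree \<sigma> ctree"
  unfolding splitting_tree_def
proof
  fix z assume "z \<in> ctree"
  then obtain t \<alpha> where t: "z = enc t" "\<alpha> < \<kappa>" "t \<in> Lev \<alpha>" unfolding ctree_def tree_def by blast
  let ?f = "\<lambda>i. append_val (hset_of \<alpha>) z i"
  have sd: "small_dom t" by (rule small_dom_Lev[OF t(2,3)])
  have domt: "dom t = {..<\<alpha>}" by (rule Lev_dom[OF t(2,3)])
  have f: "\<exists>i \<beta>. y = hset_of i \<and> ?f y = enc (t(\<alpha> \<mapsto> i)) \<and> \<beta> < \<kappa> \<and> t(\<alpha> \<mapsto> i) \<in> Lev \<beta>" if "y \<in> elts \<sigma>" for y
  proof -
    have "y \<in> elts (hset_of (w \<alpha>))" using assms[OF t(2)] that by blast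
    then obtain i where i: "i < w \<alpha>" "y = hset_of i" by (rule mem_hset_ofE)
    then show ?thesis using append_in_level[OF t(2,3) i(1)] unfolding t(1) by blast
  qed
  have "inj_on ?f (elts \<sigma>)"
  proof (rule inj_onI)
    fix y y' assume y: "y \<in> elts \<sigma>" "y' \<in> elts \<sigma>" and eq: "?f y = ?f y'"
    obtain i \<beta> where i: "y = hset_of i" "?f y = enc (t(\<alpha> \<mapsto> i))" "\<beta> < \<kappa>" "t(\<alpha> \<mapsto> i) \<in> Lev \<beta>" using f[OF y(1)] by blast
    obtain j \<gamma> where j: "y' = hset_of j" "?f y' = enc (t(\<alpha> \<mapsto> j))" "\<gamma> < \<kappa>" "t(\<alpha> \<mapsto> j) \<in> Lev \<gamma>" using f[OF y(2)] by blast
    have "t(\<alpha> \<mapsto> i) = t(\<alpha> \<mapsto> j)"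
      using eq enc_inject[OF small_dom_Lev[OF i(3,4)] small_dom_Lev[OF j(3,4)]] unfolding i(2) j(2) by blast
    then have "i = j" by (metis fun_upd_same option.inject)
    then show "y = y'" using i(1) j(1) by simp
  qed
  moreover have "?f ` elts \<sigma> \<subseteq> immediate_succs ctree z"
  proof
    fix v assume "v \<in> ?f ` elts \<sigma>"
    then obtain i \<beta> where v: "v = enc (t(\<alpha> \<mapsto> i))" "\<beta> < \<kappa>" "t(\<alpha> \<mapsto> i) \<in> Lev \<beta>" using f by blast
    have sdv: "small_dom (t(\<alpha> \<mapsto> i))" by (rule small_dom_Lev[OF v(2,3)])
    have "t \<subseteq>\<^sub>m t(\<alpha> \<mapsto> i)" using domt by (auto simp: map_le_def)
    moreover have "t \<noteq> t(\<alpha> \<mapsto> i)" using domt by (metis domI fun_upd_same lessThan_iff order.irrefl)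
    ultimately have less: "elts z \<subset> elts v" unfolding t(1) v(1) using enc_psubset[OF sd sdv] by blast
    have "v \<in> ctree" using v unfolding ctree_def tree_def by blast
    moreover have "\<not> (\<exists>r\<in>ctree. elts z \<subset> elts r \<and> elts r \<subset> elts v)"
    proof
      assume "\<exists>r\<in>ctree. elts z \<subset> elts r \<and> elts r \<subset> elts v"
      then obtain s \<gamma> where s: "\<gamma> < \<kappa>" "s \<in> Lev \<gamma>" "elts z \<subset> elts (enc s)" "elts (enc s) \<subset> elts v"
        unfolding ctree_def tree_def by blast
      have sds: "small_dom s" by (rule small_dom_Lev[OF s(1,2)])
      have le: "t \<subseteq>\<^sub>m s" "t \<noteq> s" "s \<subseteq>\<^sub>m t(\<alpha> \<mapsto> i)" "s \<noteq> t(\<alpha> \<mapsto> i)"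
        using s(3,4) enc_psubset[OF sd sds] enc_psubset[OF sds sdv] unfolding t(1) v(1) by blast+
      have doms: "dom s \<subseteq> insert \<alpha> (dom t)" using map_le_implies_dom_le[OF le(3)] by simp
      show False
      proof (cases "\<alpha> \<in> dom s")
        case True
        then have "dom s = dom (t(\<alpha> \<mapsto> i))" using doms map_le_implies_dom_le[OF le(1)] by auto
        then have "s = t(\<alpha> \<mapsto> i)" by (rule map_le_dom_eq[OF le(3)])
        with le(4) show ?thesis by blast
      next
        case False
        then have "dom s = dom t" using doms map_le_implies_dom_le[OF le(1)] by auto
        then have "t = s" using map_le_dom_eq[OF le(1)] by simp
        with le(2) show ?thesis by blast
      qed
    qed
    ultimately show "v \<in> immediate_succs ctree z" unfolding immediate_succs_def using less by blast
  qed
  ultimately show "|elts \<sigma>| \<le>o |immediate_succs ctree z|" using card_of_ordLeq by blast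
qed

text \<open>The sequence is pulled back along \<open>enc\<close> and glued by
  \<open>small_chain_glue\<close>. The graph of the glued map is the union of the graphs, since each
  point of its domain belongs to the domain of some member.\<close>

lemma complete_ctree: "complete_tree (hset_of \<chi>) ctree"
  unfolding complete_tree_def
proof (intro ballI allI impI, elim conjE)
  fix e f assume e: "e \<in> elts (hset_of \<chi>)" and f: "\<forall>\<xi>\<in>elts e. f \<xi> \<in> ctree"
    and mono: "\<forall>\<xi>\<in>elts e. \<forall>\<xi>'\<in>elts \<xi>. elts (f \<xi>') \<subset> elts (f \<xi>)"
  obtain \<eta> where \<eta>: "\<eta> < \<chi>" "e = hset_of \<eta>" using e by (rule mem_hset_ofE)
  have "\<exists>t. t \<in> tree \<and> f (hset_of \<zeta>) = enc t" if "\<zeta> < \<eta>" for \<zeta>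
  proof -
    have "f (hset_of \<zeta>) \<in> enc ` tree" using f that unfolding \<eta>(2) ctree_def by simp
    then show ?thesis by blast
  qed
  then obtain F where F: "\<And>\<zeta>. \<zeta> < \<eta> \<Longrightarrow> F \<zeta> \<in> tree \<and> f (hset_of \<zeta>) = enc (F \<zeta>)" by metis
  have "F \<zeta> \<subseteq>\<^sub>m F \<zeta>'" if "\<zeta> < \<zeta>'" "\<zeta>' < \<eta>" for \<zeta> \<zeta>'
  proof -
    have "\<zeta> < \<eta>" using that by simp
    have "elts (f (hset_of \<zeta>)) \<subset> elts (f (hset_of \<zeta>'))" using mono that unfolding \<eta>(2) by simp
    then show ?thesis
      using F[OF \<open>\<zeta> < \<eta>\<close>] F[OF that(2)] enc_psubset[OF small_dom_tree small_dom_tree, of "F \<zeta>" "F \<zeta>'"] by simp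
  qed
  note gl = small_chain_glue[OF \<eta>(1) F[THEN conjunct1] this]
  define u where "u = glue (F ` {..<\<eta>})"
  have u: "u \<in> tree" and le: "\<And>\<zeta>. \<zeta> < \<eta> \<Longrightarrow> F \<zeta> \<subseteq>\<^sub>m u" using gl unfolding u_def by simp_all
  have "(\<Union>\<xi>\<in>elts e. elts (f \<xi>)) = (\<Union>\<zeta>\<in>{..<\<eta>}. elts (enc (F \<zeta>)))"
    unfolding \<eta>(2) hset_of_image[symmetric] using F by simp
  also have "\<dots> = elts (enc u)"
  proof
    show "(\<Union>\<zeta>\<in>{..<\<eta>}. elts (enc (F \<zeta>))) \<subseteq> elts (enc u)"
      using le enc_subset[OF small_dom_tree small_dom_tree[OF u]] F by blast
    show "elts (enc u) \<subseteq> (\<Union>\<zeta>\<in>{..<\<eta>}. elts (enc (F \<zeta>)))"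
    proof
      fix z assume "z \<in> elts (enc u)"
      then obtain x y where z: "z = pair (hset_of x) (hset_of y)" "u x = Some y"
        unfolding elts_enc[OF small_dom_tree[OF u]] by blast
      then have "x \<in> dom u" by blast
      then obtain \<zeta> where \<zeta>: "\<zeta> < \<eta>" "x \<in> dom (F \<zeta>)" unfolding u_def dom_glue by blast
      then have "F \<zeta> x = Some y" using le[OF \<zeta>(1)] z(2) unfolding map_le_def by metis
      then have "z \<in> elts (enc (F \<zeta>))"
        using F[OF \<zeta>(1)] unfolding z(1) by (auto simp: elts_enc[OF small_dom_tree])
      with \<zeta>(1) show "z \<in> (\<Union>\<zeta>\<in>{..<\<eta>}. elts (enc (F \<zeta>)))" by blast
    qed
  qed
  finally show "mk (\<Union>\<xi>\<in>elts e. elts (f \<xi>)) \<in> ctree"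
    using u unfolding ctree_def by (simp add: mk_elts)
qed

lemma homogeneous_ctree: "uniformly_homogeneous ctree"
  unfolding uniformly_homogeneous_def
proof (intro ballI impI)
  fix y x assume "y \<in> ctree" "x \<in> ctree" and less: "fdom x \<subset> fdom y"
  then obtain s \<alpha> t \<beta> where s: "x = enc s" "\<alpha> < \<kappa>" "s \<in> Lev \<alpha>" and t: "y = enc t" "\<beta> < \<kappa>" "t \<in> Lev \<beta>"
    unfolding ctree_def tree_def by blast
  have "elts (hset_of \<alpha>) \<subset> elts (hset_of \<beta>)"
    using less enc_in_seqs[OF s(2,3)] enc_in_seqs[OF t(2,3)] unfolding s(1) t(1) seqs_def by simp
  then have "\<alpha> < \<beta>" by (simp add: psubset_eq elts_inject less_le)
  then have L: "t ++ s \<in> Lev \<beta>" by (rule Lev_graft[OF t(2,3) s(3)])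
  then have "graft x y = enc (t ++ s)" unfolding s(1) t(1)
    by (intro graft_enc small_dom_Lev[OF s(2,3)] small_dom_Lev[OF t(2,3)] small_dom_Lev[OF t(2)])
  then show "graft x y \<in> ctree" using L t(2) unfolding ctree_def tree_def by blast
qed

end

section \<open>From the proxy principle to the abstract construction\<close>

lemma unbounded_in_iff:
  "unbounded_in a E \<longleftrightarrow>
    zero \<in> elts (hset_of a) \<and> osup (hset_of ` E \<inter> elts (hset_of a)) = hset_of a"
proof -
  have "(\<forall>b<a. \<exists>c<a. hset_of c \<in> hset_of ` E \<inter> elts (hset_of a) \<and> b < c) \<longleftrightarrow>
    (\<forall>\<xi><a. \<exists>\<eta>\<in>E. \<xi> < \<eta> \<and> \<eta> < a)" by (simp add: Bex_def) blast
  then show ?thesis unfolding unbounded_in_def osup_eq_iff[OF Int_lower2] zero_mem_iff by simp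
qed

lemma acc_pts_iff: "hset_of a \<in> acc_pts (hset_of ` E) \<longleftrightarrow> a \<in> E \<and> unbounded_in a E"
  unfolding acc_pts_def unbounded_in_iff mem_Collect_eq hset_of_mem_image by blast

lemma club_in_iff:
  "club_in (hset_of a) (hset_of ` E) \<longleftrightarrow> E \<subseteq> {..<a} \<and> (\<forall>\<xi><a. \<exists>\<eta>\<in>E. \<xi> < \<eta>) \<and>
    (\<forall>\<gamma><a. unbounded_in \<gamma> E \<longrightarrow> \<gamma> \<in> E)"
proof -
  have sub: "hset_of ` E \<subseteq> elts (hset_of a) \<longleftrightarrow> E \<subseteq> {..<a}" by auto
  have "osup (hset_of ` E) = hset_of a \<longleftrightarrow> (\<forall>\<xi><a. \<exists>\<eta>\<in>E. \<xi> < \<eta>)" if "E \<subseteq> {..<a}"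
  proof -
    have "osup (hset_of ` E) = hset_of a \<longleftrightarrow> (\<forall>b<a. \<exists>c<a. c \<in> E \<and> b < c)"
      using osup_eq_iff[of "hset_of ` E" a] sub that by simp
    then show ?thesis using that by (simp add: subset_iff Bex_def) blast
  qed
  moreover have "(\<forall>\<gamma>\<in>elts (hset_of a). zero \<in> elts \<gamma> \<and> osup (hset_of ` E \<inter> elts \<gamma>) = \<gamma> \<longrightarrow> \<gamma> \<in> hset_of ` E)
    \<longleftrightarrow> (\<forall>\<gamma><a. unbounded_in \<gamma> E \<longrightarrow> \<gamma> \<in> E)"
    unfolding unbounded_in_iff hset_of_image[of a, symmetric] by auto
  ultimately show ?thesis unfolding club_in_def sub by blast
qed

text \<open>An unbounded map from some \<open>a < k\<close> would be cofinal, against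
  \<open>cf\<close> being \<open>k\<close>. Applied to \<omega> < k this also bounds countable
  sequences.\<close>

lemma regular_cardinal_uncountable:
  assumes reg: "regular_cardinal (hset_of k)" and omega: "omega \<in> elts (hset_of k)"
  shows "regular_uncountable k"
proof
  have card: "Cardinal (hset_of k)" and cf: "cf (hset_of k) = hset_of k"
    using reg unfolding regular_cardinal_def by auto
  show "|{..<a}| <o |{..<k}|" if "a < k" for a
  proof -
    have "|elts (hset_of a)| <o |elts (hset_of k)|" using card that unfolding Cardinal_def by simp
    then show ?thesis
      using card_lessThan ordIso_symmetric ordIso_ordLess_trans ordLess_ordIso_trans by metis
  qed
  have no: "\<not> has_cofinal_map x (hset_of k)" if "x \<in> elts (hset_of k)" for x
    using cf_props(3)[OF Ord_hset_of, of x k] that unfolding cf .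
  obtain q where q: "q < k" "omega = hset_of q" using omega by (rule mem_hset_ofE)
  show *: "\<exists>\<delta><k. \<forall>\<xi><a. f \<xi> < \<delta>" if a: "a < k" and f: "\<And>\<xi>. \<xi> < a \<Longrightarrow> f \<xi> < k" for a f
  proof (rule ccontr)
    assume "\<not> ?thesis"
    then have "\<exists>\<zeta><a. f \<zeta> < k \<and> \<xi> \<le> f \<zeta>" if "\<xi> < k" for \<xi> using that f by (meson not_le)
    then have "has_cofinal_map (hset_of a) (hset_of k)" by (rule has_cofinal_mapI[OF _ a])
    with no[of "hset_of a"] a show False by simp
  qed
  show "\<exists>\<delta><k. \<forall>n. s n < \<delta>" if s: "\<And>n::nat. s n < k" for s
  proof -
    \<comment> \<open>The sequence is reindexed by the ordinal \<omega>, which is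
      \<open>hset_of q\<close>.\<close>
    have "\<exists>\<delta><k. \<forall>\<xi><q. s (inv ord_of_nat (hset_of \<xi>)) < \<delta>" by (rule *[OF q(1) s])
    then obtain \<delta> where \<delta>: "\<delta> < k" "\<And>\<xi>. \<xi> < q \<Longrightarrow> s (inv ord_of_nat (hset_of \<xi>)) < \<delta>" by blast
    have "s n < \<delta>" for n
    proof -
      have "ord_of_nat n \<in> elts (hset_of q)" unfolding q(2)[symmetric] elts_omega by simp
      then obtain \<xi> where \<xi>: "\<xi> < q" "ord_of_nat n = hset_of \<xi>" by (rule mem_hset_ofE)
      have "inv ord_of_nat (hset_of \<xi>) = n" unfolding \<xi>(2)[symmetric] by (rule inv_f_f[OF inj_ord_of_nat])
      then show ?thesis using \<delta>(2)[OF \<xi>(1)] by simp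
    qed
    with \<delta>(1) show ?thesis by blast
  qed
qed

text \<open>A function on \<eta> is coded by its graph, a sequence of length \<eta> in \<mu>. The
  coding is injective because members of \<open>Func\<close> are \<open>undefined\<close> outside
  \<eta>.\<close>

lemma lt_closed_Func:
  fixes k x :: "'a ordinal"
  assumes "lt_closed (hset_of x) (hset_of k)" "\<eta> < x" "\<mu> < k"
  shows "|Func {..<\<eta>} {..<\<mu>}| <o |{..<k}|"
proof -
  define c where "c h = enc (\<lambda>\<xi>. if \<xi> < \<eta> then Some (h \<xi>) else None)" for h :: "'a ordinal \<Rightarrow> 'a ordinal"
  have dom: "dom (\<lambda>\<xi>. if \<xi> < \<eta> then Some (h \<xi>) else None) = {..<\<eta>}" for h :: "'a ordinal \<Rightarrow> 'a ordinal"
    by (auto split: if_splits)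
  note sd = small_dom_lessThan[OF dom]
  have "inj_on c (Func {..<\<eta>} {..<\<mu>})"
  proof (rule inj_onI)
    fix g h assume gh: "g \<in> Func {..<\<eta>} {..<\<mu>}" "h \<in> Func {..<\<eta>} {..<\<mu>}" "c g = c h"
    have eq: "(\<lambda>\<xi>. if \<xi> < \<eta> then Some (g \<xi>) else None) = (\<lambda>\<xi>. if \<xi> < \<eta> then Some (h \<xi>) else None)"
      using gh(3) unfolding c_def enc_inject[OF sd sd] .
    show "g = h"
    proof
      fix \<xi> show "g \<xi> = h \<xi>"
        using fun_cong[OF eq, of \<xi>] gh(1,2) unfolding Func_def by (cases "\<xi> < \<eta>") auto
    qed
  qed
  moreover have "c ` Func {..<\<eta>} {..<\<mu>} \<subseteq> seqs_below (hset_of x) (elts (hset_of \<mu>))"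
  proof
    fix z assume "z \<in> c ` Func {..<\<eta>} {..<\<mu>}"
    then obtain h where h: "z = c h" "h \<in> Func {..<\<eta>} {..<\<mu>}" by blast
    have "ran (\<lambda>\<xi>. if \<xi> < \<eta> then Some (h \<xi>) else None) \<subseteq> {..<\<mu>}"
      using h(2) unfolding Func_def ran_def by (auto split: if_splits)
    then have "z \<in> seqs (hset_of \<eta>) (elts (hset_of \<mu>))"
      unfolding h(1) c_def seqs_def using is_fun_enc[OF sd] fdom_enc[OF sd] fran_enc[OF sd]
      by (simp add: dom hset_of_image[symmetric] image_mono)
    then show "z \<in> seqs_below (hset_of x) (elts (hset_of \<mu>))"
      unfolding seqs_below_def using assms(2) by (intro UN_I[of "hset_of \<eta>"]) simp_all
  qed
  ultimately have "|Func {..<\<eta>} {..<\<mu>}| \<le>o |seqs_below (hset_of x) (elts (hset_of \<mu>))|"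
    using card_of_ordLeq by blast
  moreover have "|seqs_below (hset_of x) (elts (hset_of \<mu>))| <o |elts (hset_of k)|"
    using assms(1,3) unfolding lt_closed_def by simp
  ultimately have "|Func {..<\<eta>} {..<\<mu>}| <o |elts (hset_of k)|" by (rule ordLeq_ordLess_trans)
  then show ?thesis using ordLess_ordIso_trans ordIso_symmetric[OF card_lessThan] by blast
qed

section \<open>Elementary submodels and clubs\<close>

lemma mk_in_Hplus:
  assumes "D \<subseteq> elts (hset_of k)"
  shows "elts (mk D) = D" "mk D \<in> Hplus (hset_of k)"
proof -
  show el: "elts (mk D) = D" by (rule elts_mk[OF small_subset[OF assms small_elts]])
  have "|trcl_set (mk D)| \<le>o |elts (hset_of k)|"
    by (rule card_of_mono1[OF trcl_set_subset[OF Ord_hset_of]]) (simp add: el assms)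
  moreover have "|elts (hset_of k)| <o cardSuc |elts (hset_of k)|"
    by (rule cardSuc_greater[OF card_of_Card_order])
  ultimately show "mk D \<in> Hplus (hset_of k)"
    unfolding hered_lt_def using ordLeq_ordLess_trans by blast
qed

text \<open>Only one instance of elementarity is needed, for the formula \<open>\<exists>d \<in> p. i \<in> d\<close>.\<close>

lemma elem_submodel_club:
  assumes M: "M \<prec> Hplus (hset_of k)" "mk (hset_of ` D) \<in> M" "M \<inter> elts (hset_of k) = elts (hset_of b)"
    and D: "D \<subseteq> {..<k}" "\<And>\<xi>. \<xi> < k \<Longrightarrow> \<exists>\<eta>\<in>D. \<xi> < \<eta>" and "b < k" "\<exists>\<xi>. \<xi> < b"
  shows "unbounded_in b D"
  unfolding unbounded_in_def
proof (intro conjI allI impI)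
  let ?N = "Hplus (hset_of k)" and ?p = "mk (hset_of ` D)"
  have sub: "hset_of ` D \<subseteq> elts (hset_of k)" using D(1) by auto
  have p: "elts ?p = hset_of ` D" by (rule mk_in_Hplus(1)[OF sub])
  fix \<xi> assume \<xi>: "\<xi> < b"
  then have "hset_of \<xi> \<in> M" using M(3) hset_of_mem by blast
  \<comment> \<open>Variable 0 denotes the club, 1 denotes \<xi>, and 2 is the quantified element of
    the club above \<xi>.\<close>
  let ?e = "\<lambda>n :: nat. if n = 0 then ?p else hset_of \<xi>" and ?\<phi> = "Exists 2 (Conj (Mem 2 0) (Mem 1 2))"
  have "range ?e \<subseteq> M" using M(2) \<open>hset_of \<xi> \<in> M\<close> by auto
  then have eq: "sat M ?e ?\<phi> = sat ?N ?e ?\<phi>" using M(1) unfolding elem_submodel_def by blast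
  have "\<xi> < k" using \<xi> \<open>b < k\<close> by simp
  then obtain \<eta> where \<eta>: "\<eta> \<in> D" "\<xi> < \<eta>" using D(2) by blast
  have "elts (hset_of \<eta>) \<subseteq> elts (hset_of k)" using \<eta>(1) D(1) by auto
  then have "hset_of \<eta> \<in> ?N" using mk_in_Hplus(2)[of "elts (hset_of \<eta>)" k] by (simp add: mk_elts)
  then have "sat ?N ?e ?\<phi>" using \<eta> by (auto simp: p)
  then have "sat M ?e ?\<phi>" using eq by blast
  then obtain z where z: "z \<in> M" "z \<in> hset_of ` D" "hset_of \<xi> \<in> elts z" by (auto simp: p)
  then obtain \<zeta> where \<zeta>: "z = hset_of \<zeta>" "\<zeta> \<in> D" by blast
  \<comment> \<open>The witness found in \<open>M\<close> is an ordinal below \<open>k\<close>, and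
    \<open>M\<close> meets \<open>k\<close> exactly in \<open>b\<close>.\<close>
  have "z \<in> elts (hset_of b)" using z(1,2) M(3) sub by blast
  then show "\<exists>\<eta>\<in>D. \<xi> < \<eta> \<and> \<eta> < b" using z(3) \<zeta> by auto
qed fact

text \<open>Each function in the proxy sequence is replaced by its domain \<open>dm\<close> and its
  values \<open>val\<close> as sets of abstract ordinals. The club \<open>D\<close> of the abstract
  clause is passed as the parameter of the guess, and \<Omega> as the set to be guessed.\<close>

lemma ordinal_proxyI:
  fixes k x :: "'a ordinal" and w :: "'a ordinal \<Rightarrow> 'a ordinal"
  assumes k: "regular_cardinal (hset_of k)" "omega \<in> elts (hset_of k)"
    and x: "regular_cardinal (hset_of x)" "x < k" and closed: "lt_closed (hset_of x) (hset_of k)"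
    and P: "P_bullet (hset_of k) (hset_of k) (sq_chi (hset_of x)) (hset_of k)
      {cof_ge (hset_of k) (hset_of x)} (hset_of k)"
    and w: "\<And>\<alpha>. \<alpha> < k \<Longrightarrow> w \<alpha> < k" "\<And>\<alpha>. \<alpha> < k \<Longrightarrow> \<exists>a b. a < b \<and> b < w \<alpha>"
  shows "\<exists>Cs idx. ordinal_proxy k x w Cs idx"
proof -
  let ?K = "hset_of k"
  interpret regular_uncountable k by (rule regular_cardinal_uncountable[OF k])
  obtain \<C> B where B: "disjoint_family_on B (elts ?K)" "(\<Union>\<iota>\<in>elts ?K. B \<iota>) = elts ?K"
    and \<C>0: "\<forall>\<alpha>\<in>acc_pts (elts ?K).
           \<C> \<alpha> \<subseteq> {C \<in> club_funs ?K. alpha_of C = \<alpha>} \<and> \<C> \<alpha> \<noteq> {} \<and> |\<C> \<alpha>| <o |elts ?K| \<and>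
           (\<forall>C\<in>\<C> \<alpha>. \<forall>\<alpha>'\<in>acc_pts (fdom C). \<exists>D\<in>\<C> \<alpha>'. sq_chi (hset_of x) D C)"
    and guess0: "\<forall>\<Omega> p \<iota>. (\<forall>i\<in>elts ?K. \<Omega> i \<subseteq> H ?K \<and> p i \<in> Hplus ?K \<and> \<iota> i \<in> elts ?K) \<longrightarrow>
           (\<forall>S\<in>{cof_ge ?K (hset_of x)}. \<forall>n. stationary_in ?K {\<alpha> \<in> S. |\<C> \<alpha>| <o |elts ?K| \<and>
                (\<forall>C\<in>\<C> \<alpha>. \<forall>i\<in>elts (omin \<alpha> ?K).
                   osup {\<gamma> \<in> fdom C.
                     succ_n n (fdom C - elts \<gamma>) \<subseteq> guess_set ?K (B (\<iota> i)) (\<Omega> i) (p i) C} = \<alpha>)})"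
    using P unfolding P_bullet_def by (elim exE conjE) (rule that)
  note \<C> = bspec[OF \<C>0]
  define dm where "dm C = {a. hset_of a \<in> fdom C}" for C :: "'a hset"
  define val where "val C b = {a. hset_of a \<in> elts (app C (hset_of b))}" for C :: "'a hset" and b
  define Cs where "Cs a = (\<lambda>C. (dm C, val C)) ` \<C> (hset_of a)" for a
  define idx where "idx b = (SOME i. i < k \<and> hset_of b \<in> B (hset_of i))" for b
  have acc: "hset_of a \<in> acc_pts (elts ?K)" if "a < k" "unbounded_in a {..<a}" for a
  proof -
    have "unbounded_in a {..<k}"
      using that unfolding unbounded_in_def by (meson lessThan_iff order.strict_trans)
    then show ?thesis using that(1) acc_pts_iff[of a "{..<k}"] unfolding hset_of_image by simp
  qed
  have C: "is_fun C" "fdom C = hset_of ` dm C" "dm C \<subseteq> {..<a}" "\<forall>\<xi><a. \<exists>\<eta>\<in>dm C. \<xi> < \<eta>"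
      "\<forall>\<gamma><a. unbounded_in \<gamma> (dm C) \<longrightarrow> \<gamma> \<in> dm C" "alpha_of C = hset_of a"
    if "a < k" "unbounded_in a {..<a}" "C \<in> \<C> (hset_of a)" for a C
  proof -
    have C: "C \<in> club_funs ?K" "alpha_of C = hset_of a" using \<C>[OF acc[OF that(1,2)]] that(3) by auto
    then show "alpha_of C = hset_of a" "is_fun C" unfolding club_funs_def by auto
    have "fdom C \<subseteq> elts ?K" using C(1) unfolding club_funs_def by auto
    then show dm: "fdom C = hset_of ` dm C" unfolding dm_def hset_of_image[symmetric] by blast
    have "club_in (hset_of a) (hset_of ` dm C)" using C unfolding club_funs_def dm[symmetric] by auto
    then show "dm C \<subseteq> {..<a}" "\<forall>\<xi><a. \<exists>\<eta>\<in>dm C. \<xi> < \<eta>" "\<forall>\<gamma><a. unbounded_in \<gamma> (dm C) \<longrightarrow> \<gamma> \<in> dm C"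
      unfolding club_in_iff by auto
  qed
  \<comment> \<open>The ordinals 0 and 1 serve as the two points below \<chi>.\<close>
  have "elts omega \<subseteq> elts (hset_of x)" using x(1) unfolding regular_cardinal_def by blast
  then have om: "ord_of_nat n \<in> elts (hset_of x)" for n unfolding elts_omega by blast
  obtain x0 where x0: "x0 < x" "ord_of_nat 0 = hset_of x0" using om[of 0] by (rule mem_hset_ofE)
  obtain x1 where x1: "x1 < x" "ord_of_nat 1 = hset_of x1" using om[of 1] by (rule mem_hset_ofE)
  have x01: "x0 < x1" 
  proof -
    have "ord_of_nat 0 \<in> elts (ord_of_nat 1 :: 'a hset)" by (rule ord_of_nat_less) simp
    then show ?thesis unfolding x0(2) x1(2) by simp
  qed
  have idx: "idx b = i" if "b < k" "i < k" "hset_of b \<in> B (hset_of i)" for b i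
  proof -
    have "idx b < k \<and> hset_of b \<in> B (hset_of (idx b))"
      unfolding idx_def by (rule someI[of _ i]) (use that in blast)
    then have "hset_of (idx b) = hset_of i"
      using B(1) that(2,3) unfolding disjoint_family_on_def by (metis IntI empty_iff hset_of_mem)
    then show ?thesis by simp
  qed
  have "ordinal_proxy k x w Cs idx"
  proof
    show "x < k" by fact
    show "\<exists>a b. a < b \<and> b < x" using x01 x1(1) by blast
    show "|Func {..<\<eta>} {..<\<mu>}| <o |{..<k}|" if "\<eta> < x" "\<mu> < k" for \<eta> \<mu>
      by (rule lt_closed_Func[OF closed that])
    fix \<alpha> assume \<alpha>: "\<alpha> < k"
    show "w \<alpha> < k" "\<exists>a b. a < b \<and> b < w \<alpha>" using w \<alpha> by auto
    assume lim: "unbounded_in \<alpha> {..<\<alpha>}"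
    show "Cs \<alpha> \<noteq> {}" using \<C>[OF acc[OF \<alpha> lim]] unfolding Cs_def by blast
    have "|\<C> (hset_of \<alpha>)| <o |elts ?K|" using \<C>[OF acc[OF \<alpha> lim]] by blast
    then have "|Cs \<alpha>| <o |elts ?K|" unfolding Cs_def by (rule ordLeq_ordLess_trans[OF card_of_image])
    then show "|Cs \<alpha>| <o |{..<k}|" using ordLess_ordIso_trans ordIso_symmetric[OF card_lessThan] by blast
    fix E g assume "(E, g) \<in> Cs \<alpha>"
    then obtain D where D: "D \<in> \<C> (hset_of \<alpha>)" "E = dm D" "g = val D" unfolding Cs_def by blast
    note CD = C[OF \<alpha> lim D(1)]
    show "E \<subseteq> {..<\<alpha>}" using CD(3) D(2) by simp
    then show "unbounded_in \<alpha> E" using CD(4) lim unfolding unbounded_in_def D(2) by blast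
    show "\<delta> \<in> E" if "\<delta> < \<alpha>" "unbounded_in \<delta> E" for \<delta> using CD(5) that unfolding D(2) by blast
    show "\<exists>g'. (E \<inter> {..<\<delta>}, g') \<in> Cs \<delta> \<and> (\<forall>\<xi>\<in>E \<inter> {..<\<delta>}. g' \<xi> = g \<xi>)"
      if \<delta>: "\<delta> \<in> E" "unbounded_in \<delta> E" "\<not> small_cof x \<delta>" for \<delta>
    proof -
      have \<delta>k: "\<delta> < k" using \<delta>(1) CD(3) \<alpha> unfolding D(2) by auto
      have lim\<delta>: "unbounded_in \<delta> {..<\<delta>}" using \<delta>(2) unfolding unbounded_in_def by blast
      have "hset_of \<delta> \<in> acc_pts (fdom D)" unfolding CD(2) acc_pts_iff using \<delta> D(2) by simp
      then obtain D' where D': "D' \<in> \<C> (hset_of \<delta>)" "sq_chi (hset_of x) D' D"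
        using \<C>[OF acc[OF \<alpha> lim]] D(1) by blast
      note CD' = C[OF \<delta>k lim\<delta> D'(1)]
      \<comment> \<open>The other alternative of \<open>sq_chi\<close>, cofinality below \<chi>, is
        excluded by the assumption on \<delta>.\<close>
      have "D' = restr D (elts (hset_of \<delta>))"
        using D'(2) cf_mem_imp_small_cof \<delta>(3) unfolding sq_chi_def CD'(6) by blast
      then have "elts D' = {z \<in> elts D. \<exists>u\<in>elts (hset_of \<delta>). \<exists>y. z = pair u y}"
        unfolding restr_def by (simp add: elts_mk[OF small_subset[OF _ small_elts[of D]]])
      then have mem: "pair u v \<in> elts D' \<longleftrightarrow> pair u v \<in> elts D \<and> u \<in> elts (hset_of \<delta>)" for u v
        by (auto simp: pair_inject)
      have "dm D' = E \<inter> {..<\<delta>}" unfolding D(2) dm_def fdom_def mem by auto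
      moreover have "val D' \<xi> = g \<xi>" if "\<xi> \<in> E \<inter> {..<\<delta>}" for \<xi>
        using that unfolding D(3) val_def app_def mem by simp
      moreover have "(dm D', val D') \<in> Cs \<delta>" unfolding Cs_def using D'(1) by blast
      ultimately show ?thesis by metis
    qed
  next
    fix D \<Omega> assume D: "club D" and \<Omega>: "\<Omega> \<subseteq> {..<k}"
    have Dsub: "D \<subseteq> {..<k}" and Dunb: "\<And>\<xi>. \<xi> < k \<Longrightarrow> \<exists>\<eta>\<in>D. \<xi> < \<eta>"
      and Dcl: "\<And>\<delta>. \<delta> < k \<Longrightarrow> unbounded_in \<delta> D \<Longrightarrow> \<delta> \<in> D"
      using D unfolding club_def unbounded_in_def by blast+
    let ?p = "mk (hset_of ` D)" and ?\<Omega> = "hset_of ` \<Omega>"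
    have \<Omega>sub: "?\<Omega> \<subseteq> elts ?K" using \<Omega> by auto
    have "elts ?K \<subseteq> H ?K"
    proof
      fix z assume z: "z \<in> elts ?K"
      have "|trcl_set z| \<le>o |elts z|"
        by (rule card_of_mono1[OF trcl_set_subset[OF Ord_mem[OF Ord_hset_of z] order.refl]])
      moreover have "|elts z| <o |elts ?K|" using k(1) z unfolding regular_cardinal_def Cardinal_def by blast
      ultimately show "z \<in> H ?K" unfolding hered_lt_def using ordLeq_ordLess_trans by blast
    qed
    moreover have "?p \<in> Hplus ?K" by (rule mk_in_Hplus(2)) (use Dsub in auto)
    ultimately have "\<forall>i\<in>elts ?K. ?\<Omega> \<subseteq> H ?K \<and> ?p \<in> Hplus ?K \<and> i \<in> elts ?K" using \<Omega>sub by blast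
    \<comment> \<open>The same set and the same parameter are guessed for every \<open>i\<close>,
      the cell for \<open>i\<close> is \<open>B i\<close>, and n is 1.\<close>
    from spec[OF bspec[OF mp[OF spec[OF spec[OF spec[OF guess0, of "\<lambda>_. ?\<Omega>"], of "\<lambda>_. ?p"], of "\<lambda>i. i"], OF this]
      singletonI], of 1]
    have "stationary_in ?K {\<alpha> \<in> cof_ge ?K (hset_of x). |\<C> \<alpha>| <o |elts ?K| \<and>
                (\<forall>C\<in>\<C> \<alpha>. \<forall>i\<in>elts (omin \<alpha> ?K).
                   osup {\<gamma> \<in> fdom C.
                     succ_n 1 (fdom C - elts \<gamma>) \<subseteq> guess_set ?K (B i) ?\<Omega> ?p C} = \<alpha>)}" .
    moreover have "club_in ?K (elts ?K)"
      using club_in_iff[of k "{..<k}"] exists_greater unfolding hset_of_image by auto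
    ultimately obtain z where z: "z \<in> elts ?K" "elts (hset_of x) \<subseteq> elts (cf z)"
      and gz: "\<And>C i. \<lbrakk>C \<in> \<C> z; i \<in> elts (omin z ?K)\<rbrakk> \<Longrightarrow> osup {\<gamma> \<in> fdom C.
                     succ_n 1 (fdom C - elts \<gamma>) \<subseteq> guess_set ?K (B i) ?\<Omega> ?p C} = z"
      unfolding stationary_in_def cof_ge_def by blast
    obtain \<alpha> where \<alpha>: "\<alpha> < k" "z = hset_of \<alpha>" using z(1) by (rule mem_hset_ofE)
    have large: "\<not> small_cof x \<alpha>" using cf_ge_imp_not_small_cof z(2) unfolding \<alpha>(2) by blast
    have lim: "unbounded_in \<alpha> {..<\<alpha>}" by (rule not_small_cof_limit(2)[OF large x01 x1(1)])
    have "\<exists>\<gamma> \<beta>. next_in E \<gamma> \<beta> \<and> \<xi> < \<gamma> \<and> idx \<beta> = i \<and> \<beta> \<in> D \<and> g \<beta> = \<Omega> \<inter> {..<\<beta>}"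
      if Eg: "(E, g) \<in> Cs \<alpha>" and i: "i < \<alpha>" and \<xi>: "\<xi> < \<alpha>" for E g i \<xi>
    proof -
      obtain F where F: "F \<in> \<C> (hset_of \<alpha>)" "E = dm F" "g = val F" using Eg unfolding Cs_def by blast
      note CF = C[OF \<alpha>(1) lim F(1), folded F(2)]
      have "omin z ?K = hset_of \<alpha>" 
        unfolding \<alpha>(2) omin_def using order.strict_implies_order[OF \<alpha>(1)] by simp
      then have "osup {\<gamma> \<in> fdom F. succ_n 1 (fdom F - elts \<gamma>) \<subseteq> guess_set ?K (B (hset_of i)) ?\<Omega> ?p F} = hset_of \<alpha>"
        using gz[of F "hset_of i"] F(1) i unfolding \<alpha>(2) by simp
      moreover have "{\<gamma> \<in> fdom F. succ_n 1 (fdom F - elts \<gamma>) \<subseteq> guess_set ?K (B (hset_of i)) ?\<Omega> ?p F} \<subseteq> elts (hset_of \<alpha>)"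
        using CF(2,3) by auto
      ultimately obtain \<gamma> where \<gamma>: "\<gamma> < \<alpha>" "\<xi> < \<gamma>" "hset_of \<gamma> \<in> fdom F"
          "succ_n 1 (fdom F - elts (hset_of \<gamma>)) \<subseteq> guess_set ?K (B (hset_of i)) ?\<Omega> ?p F"
        using osup_eq_iff \<xi> by blast
      have \<gamma>E: "\<gamma> \<in> E" using \<gamma>(3) unfolding F(2) dm_def by simp
      \<comment> \<open>The next point of \<open>E\<close> after \<gamma>; by
        \<open>succ_n_1\<close> it is the one point about which the guess speaks.\<close>
      define \<beta> where "\<beta> = (LEAST \<beta>. \<beta> \<in> E \<and> \<gamma> < \<beta>)"
      have "\<exists>\<beta>. \<beta> \<in> E \<and> \<gamma> < \<beta>" using CF(4) \<gamma>(1) by blast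
      then have \<beta>: "\<beta> \<in> E" "\<gamma> < \<beta>" unfolding \<beta>_def by (metis (mono_tags, lifting) LeastI_ex)+
      have nx: "next_in E \<gamma> \<beta>" unfolding next_in_def
        using \<gamma>E \<beta> not_less_Least[of _ "\<lambda>\<beta>. \<beta> \<in> E \<and> \<gamma> < \<beta>", folded \<beta>_def] by (auto simp: not_less)
      have "hset_of \<beta> \<in> guess_set ?K (B (hset_of i)) ?\<Omega> ?p F"
        using \<gamma>(4) unfolding CF(2) succ_n_1[OF CF(3) nx] by simp
      then obtain M where M: "hset_of \<beta> \<in> B (hset_of i)" "M \<prec> Hplus ?K" "?p \<in> M"
          "M \<inter> elts ?K = elts (hset_of \<beta>)" "M \<inter> ?\<Omega> = elts (app F (hset_of \<beta>))"
        unfolding guess_set_def by blast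
      have \<beta>k: "\<beta> < k" using \<beta>(1) CF(3) \<alpha>(1) by auto
      \<comment> \<open>The club belongs to \<open>M\<close>, so by elementarity \<beta> is one of
        its limit points; closedness then puts \<beta> into \<open>D\<close>.\<close>
      have "unbounded_in \<beta> D"
        using elem_submodel_club[OF M(2,3,4) Dsub Dunb \<beta>k] \<beta>(2) by blast
      then have "\<beta> \<in> D" by (rule Dcl[OF \<beta>k])
      moreover have "idx \<beta> = i" by (rule idx[OF \<beta>k _ M(1)]) (use i \<alpha>(1) in simp)
      moreover have "g \<beta> = \<Omega> \<inter> {..<\<beta>}"
      proof -
        have "M \<inter> ?\<Omega> = ?\<Omega> \<inter> elts (hset_of \<beta>)" using M(4) \<Omega>sub by blast
        then show ?thesis unfolding F(3) val_def M(5)[symmetric] by auto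
      qed
      ultimately show ?thesis using nx \<gamma>(2) by blast
    qed
    with \<alpha>(1) large show "\<exists>\<alpha><k. \<not> small_cof x \<alpha> \<and> (\<forall>(E, g)\<in>Cs \<alpha>. \<forall>i<\<alpha>. \<forall>\<xi><\<alpha>.
        \<exists>\<gamma> \<beta>. next_in E \<gamma> \<beta> \<and> \<xi> < \<gamma> \<and> idx \<beta> = i \<and> \<beta> \<in> D \<and> g \<beta> = \<Omega> \<inter> {..<\<beta>})"
      by blast
  qed
  then show ?thesis by blast
qed

theorem theorem6p32:
  fixes \<kappa> \<chi> \<sigma> :: "'a hset"
  assumes "regular_cardinal \<kappa>" and "omega \<in> elts \<kappa>"
    and "regular_cardinal \<chi>" and "\<chi> \<in> elts \<kappa>"
    and "lt_closed \<chi> \<kappa>"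
    and "\<sigma> \<in> elts \<kappa>"
    and "P_bullet \<kappa> \<kappa> (sq_chi \<chi>) \<kappa> {cof_ge \<kappa> \<chi>} \<kappa>"
  shows "\<exists>T. souslin_tree \<kappa> T \<and> normal_tree \<kappa> T \<and> prolific_tree \<kappa> T \<and> splitting_tree \<sigma> T \<and>
    complete_tree \<chi> T \<and> uniformly_homogeneous T"
proof -
  have "Ord \<kappa>" using assms(1) unfolding regular_cardinal_def Cardinal_def by blast
  then obtain k where k: "\<kappa> = hset_of k" using ex_hset_of by blast
  obtain x where x: "x < k" "\<chi> = hset_of x" using assms(4) unfolding k by (rule mem_hset_ofE)
  obtain s where s: "s < k" "\<sigma> = hset_of s" using assms(6) unfolding k by (rule mem_hset_ofE)
  obtain q where q: "q < k" "omega = hset_of q" using assms(2) unfolding k by (rule mem_hset_ofE)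
  \<comment> \<open>The maximum of \<omega>, \<alpha> and \<sigma>: the first two make the tree
    prolific, the third gives the required splitting.\<close>
  define w where "w \<alpha> = max q (max \<alpha> s)" for \<alpha>
  have om: "ord_of_nat n \<in> elts (hset_of q)" for n unfolding q(2)[symmetric] elts_omega by blast
  obtain a where a: "a < q" "ord_of_nat 0 = hset_of a" using om[of 0] by (rule mem_hset_ofE)
  obtain b where b: "b < q" "ord_of_nat 1 = hset_of b" using om[of 1] by (rule mem_hset_ofE)
  have ab: "a < b" 
  proof -
    have "ord_of_nat 0 \<in> elts (ord_of_nat 1 :: 'a hset)" by (rule ord_of_nat_less) simp
    then show ?thesis unfolding a(2) b(2) by simp
  qed
  have "\<exists>Cs idx. ordinal_proxy k x w Cs idx"
  proof (rule ordinal_proxyI)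
    show "w \<alpha> < k" if "\<alpha> < k" for \<alpha> using that q(1) s(1) by (simp add: w_def)
    show "\<exists>a b. a < b \<and> b < w \<alpha>" for \<alpha> using ab b(1) by (auto simp: w_def less_max_iff_disj)
  qed (use assms k x in simp_all)
  then obtain Cs idx where "ordinal_proxy k x w Cs idx" by blast
  then interpret ordinal_proxy k x w Cs idx .
  have "elts (omax omega (hset_of \<alpha>)) \<subseteq> elts (hset_of (w \<alpha>))" for \<alpha>
    unfolding omax_def q(2) w_def by (simp add: le_max_iff_disj)
  moreover have "elts \<sigma> \<subseteq> elts (hset_of (w \<alpha>))" for \<alpha>
    unfolding s(2) w_def by (simp add: le_max_iff_disj)
  ultimately show ?thesis
    unfolding k x(2)
    by (intro exI[of _ ctree] conjI souslin_ctree normal_ctree prolific_ctree splitting_ctree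
        complete_ctree homogeneous_ctree)
qed

end
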